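(* Let $d\ge2$ be an integer, $q\ge 2$ and $s\ge 0$. Then the following two statements are equivalent: (a) there is a constant $C$ such that $\big\| \sup_{t \in (0,1)} |e^{it\sqrt{-\Delta}}f|\big\|_{L^{q}(B^d(0,1))} \le C \|f\|_{H^s(\mathbb{R}^d)}$ for all $f\in H^s(\mathbb R^d)$; (b) there is a constant $C$ such that $\big\| \sup_{t \in \mathbb R} |e^{it\sqrt{-\Delta}}f|\big\|_{L^{q}(B^d(0,1))} \le C \|f\|_{H^s(\mathbb{R}^d)}$ for all $f\in H^s(\mathbb R^d)$.
   Context: The wave operator is $e^{it\sqrt{-\Delta}}f(x)=\frac1{(2\pi)^d}\int_{\mathbb R^d}e^{i(x\cdot\xi+t|\xi|)}\widehat f(\xi)\,d\xi$, with $\widehat f(\xi)=\int e^{-ix\cdot\xi}f(x)\,dx$. $H^s(\mathbb R^d)$ is the inhomogeneous $L^2$ Sobolev space with norm $\|(1-\Delta)^{s/2}f\|_{L^2}$, and $B^d(0,1)$ is the unit ball of $\mathbb R^d$ centered at the origin. As usual, such maximal estimates may be read as a priori estimates for Schwartz functions $f$ with constants independent of $f$, extended to the whole Sobolev space by density. *)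

theory Defs
  imports "HOL-Analysis.Analysis"
begin

definition partial_deriv :: "'d \<Rightarrow> (real^'d \<Rightarrow> complex) \<Rightarrow> (real^'d::finite \<Rightarrow> complex)" where
  "partial_deriv j f = (\<lambda>x. frechet_derivative f (at x) (axis j 1))"

text \<open>The list \<open>js\<close> encodes an iterated partial derivative of arbitrary order. Since
  \<^const>\<open>frechet_derivative\<close> is arbitrary at points of non-differentiability, differentiability
  of every iterated derivative is required explicitly; this is smoothness.\<close>

definition schwartz :: "(real^'d::finite \<Rightarrow> complex) \<Rightarrow> bool" where
  "schwartz f \<longleftrightarrow>
     (\<forall>js :: 'd list.
        (\<forall>x. foldr partial_deriv js f differentiable (at x)) \<and>
        (\<forall>N :: nat. bounded (range (\<lambda>x. (1 + norm x) ^ N *\<^sub>R foldr partial_deriv js f x))))"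

definition fourier :: "(real^'d::finite \<Rightarrow> complex) \<Rightarrow> (real^'d \<Rightarrow> complex)" where
  "fourier f \<xi> = (\<integral>x. cis (- (x \<bullet> \<xi>)) * f x \<partial>lborel)"

definition wave :: "real \<Rightarrow> (real^'d::finite \<Rightarrow> complex) \<Rightarrow> (real^'d \<Rightarrow> complex)" where
  "wave t f x =
     (1 / (2 * pi) ^ CARD('d)) *\<^sub>R (\<integral>\<xi>. cis (x \<bullet> \<xi> + t * norm \<xi>) * fourier f \<xi> \<partial>lborel)"

text \<open>The operator \<open>(1 - \<Delta>)\<^bsup>s/2\<^esup>\<close>, as a Fourier multiplier.\<close>

definition bessel :: "real \<Rightarrow> (real^'d::finite \<Rightarrow> complex) \<Rightarrow> (real^'d \<Rightarrow> complex)" where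
  "bessel s f x =
     (1 / (2 * pi) ^ CARD('d)) *\<^sub>R
       (\<integral>\<xi>. cis (x \<bullet> \<xi>) * of_real ((1 + (norm \<xi>)\<^sup>2) powr (s / 2)) * fourier f \<xi> \<partial>lborel)"

text \<open>Real powers on \<open>[0, \<infinity>]\<close>, used for exponents \<open>p > 0\<close> only.\<close>

definition ennpowr :: "ennreal \<Rightarrow> real \<Rightarrow> ennreal" where
  "ennpowr a p = (if a = \<infinity> then \<infinity> else ennreal (enn2real a powr p))"

definition Lp_norm :: "real \<Rightarrow> (real^'d::finite) set \<Rightarrow> (real^'d \<Rightarrow> ennreal) \<Rightarrow> ennreal" where
  "Lp_norm p A g = ennpowr (\<integral>\<^sup>+x\<in>A. ennpowr (g x) p \<partial>lborel) (1 / p)"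

definition sobolev_norm :: "real \<Rightarrow> (real^'d::finite \<Rightarrow> complex) \<Rightarrow> ennreal" where
  "sobolev_norm s f = Lp_norm 2 UNIV (\<lambda>x. ennreal (norm (bessel s f x)))"

definition wave_maximal :: "real set \<Rightarrow> (real^'d::finite \<Rightarrow> complex) \<Rightarrow> (real^'d \<Rightarrow> ennreal)" where
  "wave_maximal I f x = (SUP t\<in>I. ennreal (norm (wave t f x)))"

text \<open>The supremum over uncountably many \<open>t\<close> has no pointwise meaning for the \<open>L\<^sup>2\<close> classes
  \<open>e\<^bsup>it\<surd>(-\<Delta>)\<^esup>f\<close> with \<open>f \<in> H\<^sup>s\<close> general. As usual, maximal estimates are stated a priori,
  for Schwartz functions and with a constant independent of \<open>f\<close>; they extend to \<open>H\<^sup>s\<close> by density.\<close>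

end

theory Submission
  imports Defs "HOL-Probability.Characteristic_Functions" "HOL-Probability.Sinc_Integral"
begin

text \<open>
  The idea is to bound the supremum over all times by an average of suprema over unit intervals:
  \<open>|u(t,x)|\<^sup>q \<le> \<integral> sup {|u(t\<^sub>0 + \<tau>, x)|\<^sup>q | 0 < \<tau> < 1} dt\<^sub>0\<close> for the solution \<open>u(t) = e\<^bsup>it\<surd>(-\<Delta>)\<^esup>f\<close>.
  For fixed \<open>t\<^sub>0\<close> only the part of \<open>u(t\<^sub>0)\<close> near the unit ball should matter. Instead of
  finite propagation speed we multiply by a Gaussian: on the Fourier side the commutator of the
  Gaussian with \<open>e\<^bsup>i\<tau>\<surd>(-\<Delta>)\<^esup>\<close> is the factor \<open>e\<^bsup>i\<tau>(|\<eta>|-|\<xi>|)\<^esup>\<close>, whose power series gives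
  \<open>e\<^bsup>-|x|\<^sup>2/2\<^esup> u(t\<^sub>0 + \<tau>) = \<Sum>\<^sub>k (i\<tau>)\<^sup>k/k! e\<^bsup>i\<tau>\<surd>(-\<Delta>)\<^esup> h\<^sub>k(t\<^sub>0)\<close>, where the Fourier transform of
  \<open>h\<^sub>k(t\<^sub>0)\<close> is \<open>\<integral> \<gamma>(\<xi>-\<eta>) (|\<eta>|-|\<xi>|)\<^sup>k e\<^bsup>it\<^sub>0|\<eta>|\<^esup> F(\<eta>) d\<eta>\<close> with a Gaussian \<open>\<gamma>\<close> and the Fourier transform
  \<open>F\<close> of \<open>f\<close>. The local estimate, extended from Schwartz functions to functions whose Fourier
  transform is only continuous and rapidly decreasing, applies to each \<open>h\<^sub>k(t\<^sub>0)\<close>. Local smoothing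
  (Plancherel in \<open>t\<^sub>0\<close>) bounds the \<open>L\<^sup>2(dt\<^sub>0; H\<^sup>s)\<close> and \<open>L\<^sup>\<infinity>(dt\<^sub>0; H\<^sup>s)\<close> norms of \<open>h\<^sub>k\<close>,
  hence for \<open>q \<ge> 2\<close> its \<open>L\<^sup>q(dt\<^sub>0; H\<^sup>s)\<close> norm, by the \<open>H\<^sup>s\<close> norm of \<open>f\<close>.
\<close>

section \<open>Integrals over Euclidean space and Gaussians\<close>

text \<open>The phase |\<xi>| is not smooth at the origin, so the transforms of the h_k are in
  general only continuous there, whatever f is. This is the obstacle behind the class
  \<open>rapid\<close> and behind the Gaussian regularisation that carries the local estimate over
  to it.

  Since | |\<eta>| - |\<xi>| | <= |\<xi> - \<eta>|, the Gaussian absorbs the k-th power at the price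
  k!/4^k. The 1/k! of the exponential series cancels k!, and 4^(-k) leaves room for a factor
  2^(k+1), which is spent on replacing the sum over k by its largest term before the power q is
  taken.

  Square integrability in time involves no gain of derivatives. It is a geometric fact: a rapidly
  decreasing weight, wherever it is centred, gives a shell of thickness \<epsilon> around a sphere a
  mass O(\<epsilon>), uniformly in the radius and in the centre.

  The condition q >= 2 enters through interpolation in t_0: bounds of the energy in L^1 and in
  L^\<infinity> control its power q/2 when q/2 >= 1. The unit ball enters through the lower bound
  exp(-1/2) of the Gaussian on it.\<close>

lemma borel_measurable_cis [measurable]: "cis \<in> borel_measurable borel"
  by (intro borel_measurable_continuous_onI continuous_intros)

lemma integral_ext: "(\<And>x. f x = g x) \<Longrightarrow> integral\<^sup>L M f = integral\<^sup>L M g"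
  by (rule Bochner_Integration.integral_cong) auto

lemma integral_lborel_affine:
  fixes f :: "'a::euclidean_space \<Rightarrow> 'b::{banach, second_countable_topology}"
  assumes [measurable]: "f \<in> borel_measurable borel" and "c \<noteq> 0"
  shows "(LBINT x. f x) = \<bar>c\<bar> ^ DIM('a) *\<^sub>R (LBINT x. f (t + c *\<^sub>R x))"
  apply (subst lborel_affine[OF \<open>c \<noteq> 0\<close>, of t])
  apply (subst integral_density)
     apply (auto simp: integral_distr)
  done

lemma nn_integral_lborel_affine:
  fixes f :: "'a::euclidean_space \<Rightarrow> ennreal"
  assumes [measurable]: "f \<in> borel_measurable borel" and "c \<noteq> 0"
  shows "(\<integral>\<^sup>+x. f x \<partial>lborel) = ennreal (\<bar>c\<bar> ^ DIM('a)) * (\<integral>\<^sup>+x. f (t + c *\<^sub>R x) \<partial>lborel)"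
  apply (subst lborel_affine[OF \<open>c \<noteq> 0\<close>, of t])
  apply (subst nn_integral_density)
     apply (auto simp: nn_integral_distr nn_integral_cmult)
  done

lemma nn_integral_lborel_reflect:
  fixes f :: "'a::euclidean_space \<Rightarrow> ennreal"
  assumes [measurable]: "f \<in> borel_measurable borel"
  shows "(\<integral>\<^sup>+x. f (a - x) \<partial>lborel) = (\<integral>\<^sup>+x. f x \<partial>lborel)"
  using nn_integral_lborel_affine[OF assms, of "-1" a] by simp

lemma nn_integral_lborel_translate:
  fixes f :: "'a::euclidean_space \<Rightarrow> ennreal"
  assumes [measurable]: "f \<in> borel_measurable borel"
  shows "(\<integral>\<^sup>+x. f (a + x) \<partial>lborel) = (\<integral>\<^sup>+x. f x \<partial>lborel)"
  using nn_integral_lborel_affine[OF assms, of 1 a] by simp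

lemma integral_lborel_translate:
  fixes f :: "'a::euclidean_space \<Rightarrow> 'b::{banach, second_countable_topology}"
  assumes [measurable]: "f \<in> borel_measurable borel"
  shows "(LBINT x. f (a + x)) = (LBINT x. f x)"
  using integral_lborel_affine[OF assms, of 1 a] by simp

lemma integrable_lborel_translate:
  fixes f :: "'a::euclidean_space \<Rightarrow> 'b::{banach, second_countable_topology}"
  assumes f: "integrable lborel f"
  shows "integrable lborel (\<lambda>x. f (a + x))"
proof -
  have [measurable]: "f \<in> borel_measurable borel" using borel_measurable_integrable[OF f] by simp
  have "(\<integral>\<^sup>+x. ennreal (norm (f (a + x))) \<partial>lborel) = (\<integral>\<^sup>+x. ennreal (norm (f x)) \<partial>lborel)"
    by (rule nn_integral_lborel_translate) measurable
  with f show ?thesis unfolding integrable_iff_bounded by simp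
qed

lemma integral_lborel_prod:
  fixes f :: "'a::euclidean_space \<Rightarrow> real \<Rightarrow> 'b::{real_normed_field, banach, second_countable_topology}"
  assumes int: "\<And>b. b \<in> Basis \<Longrightarrow> integrable lborel (f b)"
  shows "(LBINT x. (\<Prod>b\<in>Basis. f b (x \<bullet> b))) = (\<Prod>b\<in>Basis. (LBINT x. f b x))"
proof -
  interpret product_sigma_finite "\<lambda>_::'a. lborel :: real measure" ..
  have [measurable]: "b \<in> Basis \<Longrightarrow> f b \<in> borel_measurable borel" for b
    using int[of b] by (auto dest: borel_measurable_integrable)
  have "(LBINT x. (\<Prod>b\<in>Basis. f b (x \<bullet> b)))
      = (\<integral>x. (\<Prod>b\<in>Basis. f b (x b)) \<partial>(\<Pi>\<^sub>M b\<in>(Basis::'a set). lborel))"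
    by (subst lborel_eq) (simp add: integral_distr)
  also have "\<dots> = (\<Prod>b\<in>Basis. (LBINT x. f b x))"
    by (rule product_integral_prod) (auto intro: int)
  finally show ?thesis .
qed

lemma integrable_lborel_prod:
  fixes f :: "'a::euclidean_space \<Rightarrow> real \<Rightarrow> real"
  assumes int: "\<And>b. b \<in> Basis \<Longrightarrow> integrable lborel (f b)" and nn: "\<And>b x. 0 \<le> f b x"
  shows "integrable lborel (\<lambda>x. \<Prod>b\<in>Basis. f b (x \<bullet> b))"
proof (rule integrableI_nonneg)
  have [measurable]: "b \<in> Basis \<Longrightarrow> f b \<in> borel_measurable borel" for b
    using int[of b] by (auto dest: borel_measurable_integrable)
  show "(\<lambda>x. \<Prod>b\<in>Basis. f b (x \<bullet> b)) \<in> borel_measurable lborel" by measurable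
  show "AE x in lborel. 0 \<le> (\<Prod>b\<in>Basis. f b (x \<bullet> b))" by (auto intro: prod_nonneg nn)
  have "(\<integral>\<^sup>+x. ennreal (\<Prod>b\<in>Basis. f b (x \<bullet> b)) \<partial>lborel)
    = (\<integral>\<^sup>+x. (\<Prod>b\<in>Basis. ennreal (f b (x \<bullet> b))) \<partial>lborel)"
    by (simp add: prod_ennreal nn)
  also have "\<dots> = (\<Prod>b\<in>Basis. (\<integral>\<^sup>+x. ennreal (f b x) \<partial>lborel))"
    by (rule nn_integral_lborel_prod) auto
  also have "\<dots> = (\<Prod>b\<in>Basis. ennreal (LBINT x. f b x))"
    by (intro prod.cong refl nn_integral_eq_integral) (auto intro: int nn)
  also have "\<dots> < \<infinity>" by (simp add: prod_ennreal integral_nonneg nn)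
  finally show "(\<integral>\<^sup>+x. ennreal (\<Prod>b\<in>Basis. f b (x \<bullet> b)) \<partial>lborel) < \<infinity>" .
qed

abbreviation decay :: "nat \<Rightarrow> 'a::real_normed_vector \<Rightarrow> real" where
  "decay N x \<equiv> inverse ((1 + norm x) ^ N)"

text \<open>Each coordinate takes two of the powers, since 1 + (x \<bullet> b)^2 <= (1 + |x|)^2; the
  majorant is then a product of one-dimensional functions 1/(1 + x^2). This is the origin of the
  exponent \<open>2 * DIM('a)\<close> in all later weights.\<close>

lemma integrable_inverse_bracket:
  "integrable lborel (\<lambda>x::'a::euclidean_space. decay (2 * DIM('a)) x)"
proof (rule Bochner_Integration.integrable_bound)
  have 1: "integrable lborel (\<lambda>x::real. inverse (1 + x^2))"
    using integrable_inverse_1_plus_square by (simp add: set_integrable_def)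
  show "integrable lborel (\<lambda>x::'a. \<Prod>b\<in>Basis. inverse (1 + (x \<bullet> b)^2))"
    by (rule integrable_lborel_prod[OF 1]) auto
  show "AE x::'a in lborel. norm (decay (2 * DIM('a)) x) \<le> norm (\<Prod>b\<in>Basis. inverse (1 + (x \<bullet> b)^2))"
  proof (intro AE_I2)
    fix x :: 'a
    have "decay (2 * DIM('a)) x = (\<Prod>b\<in>(Basis::'a set). decay 2 x)"
      by (simp add: power_mult power_inverse)
    also have "\<dots> \<le> (\<Prod>b\<in>Basis. inverse (1 + (x \<bullet> b)^2))"
    proof (intro prod_mono conjI)
      fix b :: 'a assume "b \<in> Basis"
      then have "(x \<bullet> b)^2 \<le> (norm x)^2"
        by (metis Basis_le_norm abs_norm_cancel abs_le_square_iff)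
      then have "1 + (x \<bullet> b)^2 \<le> (1 + norm x)^2"
        by (simp add: power2_eq_square algebra_simps) (smt (verit) norm_ge_zero)
      then show "decay 2 x \<le> inverse (1 + (x \<bullet> b)^2)"
        by (intro le_imp_inverse_le) (auto intro: add_pos_nonneg)
    qed auto
    finally show "norm (decay (2 * DIM('a)) x) \<le> norm (\<Prod>b\<in>Basis. inverse (1 + (x \<bullet> b)^2))"
      by (auto intro: order_trans)
  qed
qed auto

lemma bracket_add_le: "1 + norm (x + y) \<le> (1 + norm x) * (1 + norm y)"
proof -
  have "1 + norm (x + y) \<le> 1 + norm x + norm y" by (simp add: norm_triangle_ineq)
  also have "\<dots> \<le> (1 + norm x) * (1 + norm y)" by (simp add: algebra_simps)
  finally show ?thesis .
qed

text \<open>A majorant that is a product of integrable functions of the separate variables makes the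
  joint function integrable. The iterated Bochner integrals below all come with such a
  majorant.\<close>

lemma Fubini_dominated:
  fixes k :: "'a::euclidean_space \<Rightarrow> 'b::euclidean_space \<Rightarrow> 'c::{banach, second_countable_topology}"
  assumes k: "(\<lambda>(x, y). k x y) \<in> borel_measurable (lborel \<Otimes>\<^sub>M lborel)"
    and p: "integrable lborel p" and r: "integrable lborel r"
    and le: "\<And>x y. norm (k x y) \<le> p x * r y"
  shows "(LBINT x. (LBINT y. k x y)) = (LBINT y. (LBINT x. k x y))"
proof -
  have "integrable (lborel \<Otimes>\<^sub>M lborel) (\<lambda>(x, y). p x * r y)"
  proof (subst lborel_pair.Fubini_integrable)
    have [measurable]: "p \<in> borel_measurable borel" "r \<in> borel_measurable borel"
      using p r by (auto dest: borel_measurable_integrable)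
    show "(\<lambda>(x, y). p x * r y) \<in> borel_measurable (lborel \<Otimes>\<^sub>M lborel)" by measurable
  qed (use p r in \<open>auto simp: abs_mult\<close>)
  then have i: "integrable (lborel \<Otimes>\<^sub>M lborel) (\<lambda>(x, y). k x y)"
    by (rule Bochner_Integration.integrable_bound) (use k le in \<open>auto intro!: order_trans[OF le]\<close>)
  show "(LBINT x. (LBINT y. k x y)) = (LBINT y. (LBINT x. k x y))"
    using lborel_pair.Fubini_integral[OF i] by simp
qed

section \<open>The Gaussian and its Fourier transform\<close>

lemma powr_neg_half_mult:
  assumes "0 < (a::real)"
  shows "a powr (- real n / 2) * a ^ n = sqrt a ^ n"
    and "a powr (- real n / 2) * a ^ n * a powr (- real n / 2) = 1"
proof -
  have n: "a ^ n = a powr real n" and s: "sqrt a ^ n = a powr (real n / 2)"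
    using assms by (simp_all add: powr_realpow powr_half_sqrt[symmetric] powr_power)
  show "a powr (- real n / 2) * a ^ n = sqrt a ^ n"
    unfolding n s powr_add[symmetric] by simp
  show "a powr (- real n / 2) * a ^ n * a powr (- real n / 2) = 1"
    unfolding n powr_add[symmetric] using assms by simp
qed

text \<open>The standard normal density. Under the normalisation of \<open>ift\<close> it is the
  frequency profile of exp(-|x|^2/2): multiplying by that Gaussian in space convolves with this
  kernel in frequency.\<close>

definition gauss_kernel :: "'a::euclidean_space \<Rightarrow> real" where
  "gauss_kernel z = (2 * pi) powr (- real DIM('a) / 2) * exp (- (norm z)\<^sup>2 / 2)"

lemma cis_sum: "finite A \<Longrightarrow> cis (\<Sum>a\<in>A. f a) = (\<Prod>a\<in>A. cis (f a))"
  by (induction A rule: finite_induct) (auto simp: cis_mult[symmetric])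

text \<open>Everything factors over the coordinates, and the one-dimensional integral is the
  characteristic function of the standard normal distribution.\<close>

lemma integrable_gauss: "integrable lborel (\<lambda>x::'a::euclidean_space. exp (- (norm x)\<^sup>2 / 2))"
  and integral_cis_gauss: "(LBINT x. cis (x \<bullet> (z::'a)) * exp (- (norm x)\<^sup>2 / 2))
    = of_real ((2 * pi) ^ DIM('a) * gauss_kernel z)"
proof -
  have 1: "integrable lborel (\<lambda>x::real. exp (- x\<^sup>2 / 2))"
  proof -
    have "integrable lborel (\<lambda>x. sqrt (2 * pi) * std_normal_density x)"
      by (intro integrable_mult_right) auto
    then show ?thesis by (simp add: std_normal_density_def)
  qed
  have e: "exp (- (norm x)\<^sup>2 / 2) = (\<Prod>b\<in>Basis. exp (- (x \<bullet> b)\<^sup>2 / 2))" for x :: 'a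
    by (simp add: exp_sum[symmetric] sum_divide_distrib[symmetric] sum_negf power2_norm_eq_inner power2_eq_square) (simp add: euclidean_inner[of x x] power2_norm_eq_inner flip: power2_eq_square)
  show "integrable lborel (\<lambda>x::'a::euclidean_space. exp (- (norm x)\<^sup>2 / 2))"
    unfolding e by (rule integrable_lborel_prod) (use 1 in auto)
  have 2: "(LBINT x. cis (x * t) * exp (- x\<^sup>2 / 2)) = of_real (sqrt (2 * pi) * exp (- t\<^sup>2 / 2))" for t :: real
  proof -
    have "complex_of_real (exp (- t\<^sup>2 / 2)) = (\<integral>x. iexp (t * x) \<partial>std_normal_distribution)"
      using fun_cong[OF char_std_normal_distribution, of t] by (simp add: char_def)
    also have "\<dots> = (LBINT x. std_normal_density x *\<^sub>R iexp (t * x))"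
      by (subst integral_density) auto
    also have "\<dots> = (LBINT x. (1 / sqrt (2 * pi)) *\<^sub>R (cis (x * t) * exp (- x\<^sup>2 / 2)))"
      by (rule integral_ext) (simp add: std_normal_density_def cis_conv_exp scaleR_conv_of_real exp_of_real mult_ac)
    also have "\<dots> = (1 / sqrt (2 * pi)) *\<^sub>R (LBINT x. cis (x * t) * exp (- x\<^sup>2 / 2))"
      by (rule integral_scaleR_right)
    finally show ?thesis
      by (simp add: scaleR_conv_of_real field_simps)
  qed
  have "(LBINT x. cis (x \<bullet> (z::'a)) * exp (- (norm x)\<^sup>2 / 2))
     = (LBINT x. (\<Prod>b\<in>(Basis::'a set). cis ((x \<bullet> b) * (z \<bullet> b)) * exp (- (x \<bullet> b)\<^sup>2 / 2)))"
    by (rule integral_ext)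
      (simp only: prod.distrib e of_real_prod euclidean_inner[of _ z] cis_sum[OF finite_Basis])
  also have "\<dots> = (\<Prod>b\<in>Basis. (LBINT x. cis (x * (z \<bullet> b)) * exp (- x\<^sup>2 / 2)))"
  proof (rule integral_lborel_prod)
    fix b :: 'a
    show "integrable lborel (\<lambda>x. cis (x * (z \<bullet> b)) * complex_of_real (exp (- x\<^sup>2 / 2)))"
      by (rule Bochner_Integration.integrable_bound[OF 1]) (auto simp: norm_mult)
  qed
  also have "\<dots> = of_real ((\<Prod>b\<in>(Basis::'a set). sqrt (2 * pi)) * (\<Prod>b\<in>Basis. exp (- (z \<bullet> b)\<^sup>2 / 2)))"
    by (simp only: 2 of_real_prod[symmetric] prod.distrib)
  also have "\<dots> = of_real (sqrt (2 * pi) ^ DIM('a) * exp (- (norm z)\<^sup>2 / 2))"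
    by (simp only: e prod_constant)
  also have "sqrt (2 * pi) ^ DIM('a) = (2 * pi) ^ DIM('a) * (2 * pi) powr (- real DIM('a) / 2)"
    using powr_neg_half_mult[of "2 * pi" "DIM('a)"] by (simp add: field_simps)
  finally show "(LBINT x. cis (x \<bullet> (z::'a)) * exp (- (norm x)\<^sup>2 / 2))
    = of_real ((2 * pi) ^ DIM('a) * gauss_kernel z)"
    by (simp add: gauss_kernel_def)
qed

lemma integrable_gauss_kernel: "integrable lborel gauss_kernel"
  unfolding gauss_kernel_def by (intro integrable_mult_right integrable_gauss)

lemma gauss_kernel_nonneg: "0 \<le> gauss_kernel z"
  by (simp add: gauss_kernel_def)

lemma continuous_on_gauss_kernel [continuous_intros]:
  "continuous_on A f \<Longrightarrow> continuous_on A (\<lambda>x. gauss_kernel (f x))"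
  unfolding gauss_kernel_def by (intro continuous_intros) auto

lemma borel_measurable_gauss_kernel [measurable]: "gauss_kernel \<in> borel_measurable borel"
  by (intro borel_measurable_continuous_onI continuous_intros)

lemma integral_cis_gauss_kernel:
  fixes x :: "'a::euclidean_space"
  shows "(LBINT z. cis (x \<bullet> z) * gauss_kernel z) = exp (- (norm x)\<^sup>2 / 2)"
proof -
  have "(LBINT z. cis (x \<bullet> z) * gauss_kernel z)
    = (LBINT z. of_real ((2 * pi) powr (- real DIM('a) / 2)) * (cis (z \<bullet> x) * exp (- (norm z)\<^sup>2 / 2)))"
    by (rule integral_ext) (simp add: gauss_kernel_def inner_commute)
  also have "\<dots> = complex_of_real ((2 * pi) powr (- real DIM('a) / 2)) * of_real ((2 * pi) ^ DIM('a) * gauss_kernel x)"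
    by (subst integral_mult_right_zero) (simp only: integral_cis_gauss)
  also have "\<dots> = of_real ((2 * pi) powr (- real DIM('a) / 2) * (2 * pi) ^ DIM('a) * (2 * pi) powr (- real DIM('a) / 2) * exp (- (norm x)\<^sup>2 / 2))"
    by (simp add: gauss_kernel_def)
  also have "(2 * pi) powr (- real DIM('a) / 2) * (2 * pi) ^ DIM('a) * (2 * pi) powr (- real DIM('a) / 2) = 1"
    by (rule powr_neg_half_mult) simp
  finally show ?thesis by simp
qed

lemma integral_gauss_kernel: "(LBINT z. gauss_kernel (z::'a::euclidean_space)) = 1"
  using integral_cis_gauss_kernel[of "0::'a"]
  by simp

section \<open>Inverse Fourier transforms of rapidly decreasing functions\<close>

text \<open>Continuity with rapid decrease but without derivatives. Unlike the Schwartz class, this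
  survives multiplication by \<open>cis (t * norm \<xi>)\<close>, which is not smooth at 0, so it is
  the natural class for data given on the Fourier side.\<close>

definition rapid :: "('a::euclidean_space \<Rightarrow> complex) \<Rightarrow> bool" where
  "rapid G \<longleftrightarrow> continuous_on UNIV G \<and> (\<forall>N::nat. \<exists>C. \<forall>\<xi>. (1 + norm \<xi>) ^ N * norm (G \<xi>) \<le> C)"

lemma rapid_measurable [measurable_dest]: "rapid G \<Longrightarrow> G \<in> borel_measurable borel"
  by (auto simp: rapid_def intro: borel_measurable_continuous_onI)

lemma rapid_continuous: "rapid G \<Longrightarrow> continuous_on UNIV G"
  by (simp add: rapid_def)

lemma rapidE:
  assumes "rapid G"
  obtains C where "0 \<le> C" "\<And>\<xi>. norm (G \<xi>) \<le> C * decay N \<xi>"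
proof -
  obtain C where C: "\<And>\<xi>. (1 + norm \<xi>) ^ N * norm (G \<xi>) \<le> C"
    using assms by (auto simp: rapid_def)
  have "0 \<le> C" using order_trans[OF _ C[of 0]] by simp
  moreover have "norm (G \<xi>) \<le> C * decay N \<xi>" for \<xi>
  proof -
    have "0 < (1 + norm \<xi>) ^ N" by (simp add: add_pos_nonneg)
    with C[of \<xi>] show ?thesis by (simp add: field_simps)
  qed
  ultimately show ?thesis by (rule that)
qed

lemma rapid_mult:
  assumes G: "rapid G" and h: "continuous_on UNIV h" and le: "\<And>\<xi>. norm (h \<xi>) \<le> B * (1 + norm \<xi>) ^ k"
  shows "rapid (\<lambda>\<xi>. h \<xi> * G \<xi>)"
  unfolding rapid_def
proof (intro conjI allI)
  show "continuous_on UNIV (\<lambda>\<xi>. h \<xi> * G \<xi>)"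
    by (intro continuous_intros h rapid_continuous[OF G])
  fix N
  obtain C where C: "\<And>\<xi>. (1 + norm \<xi>) ^ (N + k) * norm (G \<xi>) \<le> C"
    using G unfolding rapid_def by blast
  have B: "0 \<le> B" using order_trans[OF norm_ge_zero le[of 0]] by simp
  show "\<exists>C. \<forall>\<xi>. (1 + norm \<xi>) ^ N * norm (h \<xi> * G \<xi>) \<le> C"
  proof (intro exI allI)
    fix \<xi>
    have "(1 + norm \<xi>) ^ N * norm (h \<xi> * G \<xi>) \<le> (1 + norm \<xi>) ^ N * ((B * (1 + norm \<xi>) ^ k) * norm (G \<xi>))"
      unfolding norm_mult by (intro mult_left_mono mult_right_mono le) auto
    also have "\<dots> = B * ((1 + norm \<xi>) ^ (N + k) * norm (G \<xi>))" by (simp add: power_add)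
    also have "\<dots> \<le> B * C" by (intro mult_left_mono C B)
    finally show "(1 + norm \<xi>) ^ N * norm (h \<xi> * G \<xi>) \<le> B * C" .
  qed
qed

lemma rapid_integrable:
  assumes "rapid (G :: 'a::euclidean_space \<Rightarrow> complex)"
  shows "integrable lborel G"
proof -
  obtain C where C: "\<And>\<xi>. norm (G \<xi>) \<le> C * decay (2 * DIM('a)) \<xi>"
    by (rule rapidE[OF assms, of "2 * DIM('a)"]) blast
  show ?thesis
    by (rule Bochner_Integration.integrable_bound[OF integrable_mult_right[OF integrable_inverse_bracket, of C]])
      (use assms C in \<open>auto intro!: order_trans[OF C] intro: rapid_measurable\<close>)
qed

abbreviation phase :: "real \<Rightarrow> ('a::euclidean_space \<Rightarrow> complex) \<Rightarrow> 'a \<Rightarrow> complex" where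
  "phase t G \<equiv> \<lambda>\<xi>. cis (t * norm \<xi>) * G \<xi>"

lemma rapid_cis:
  "rapid G \<Longrightarrow> rapid (phase t G)"
  by (rule rapid_mult[of _ _ 1 0]) (auto intro!: continuous_intros)

lemma rapid_inner:
  fixes G :: "'a::euclidean_space \<Rightarrow> complex"
  shows "rapid G \<Longrightarrow> rapid (\<lambda>\<xi>. \<i> * of_real (h \<bullet> \<xi>) * G \<xi>)"
  by (rule rapid_mult[of _ _ "norm h" 1])
    (auto intro!: continuous_intros order_trans[OF Cauchy_Schwarz_ineq2] simp: norm_mult algebra_simps)

lemma bracket_powr_le:
  fixes \<xi> :: "'a::euclidean_space"
  assumes "0 \<le> s" "s \<le> real k"
  shows "(1 + (norm \<xi>)\<^sup>2) powr (s / 2) \<le> (1 + norm \<xi>) ^ k"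
proof -
  have "(1 + (norm \<xi>)\<^sup>2) powr (s / 2) \<le> ((1 + norm \<xi>)\<^sup>2) powr (s / 2)"
    using assms by (intro powr_mono2) (auto simp: power2_eq_square algebra_simps)
  also have "\<dots> = ((1 + norm \<xi>) powr 2) powr (s / 2)"
    by (subst powr_numeral) auto
  also have "\<dots> = (1 + norm \<xi>) powr s"
    by (simp only: powr_powr) simp
  also have "\<dots> \<le> (1 + norm \<xi>) powr real k"
    using assms by (intro powr_mono) auto
  also have "\<dots> = (1 + norm \<xi>) ^ k" by (rule powr_realpow) (auto simp: add_pos_nonneg)
  finally show ?thesis .
qed

lemma rapid_bessel:
  fixes G :: "'a::euclidean_space \<Rightarrow> complex"
  assumes "rapid G" "0 \<le> s"
  shows "rapid (\<lambda>\<xi>. of_real ((1 + (norm \<xi>)\<^sup>2) powr (s / 2)) * G \<xi>)"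
proof (rule rapid_mult[OF assms(1), of _ 1 "nat \<lceil>s\<rceil>"])
  show "norm (complex_of_real ((1 + (norm \<xi>)\<^sup>2) powr (s / 2))) \<le> 1 * (1 + norm \<xi>) ^ nat \<lceil>s\<rceil>" for \<xi> :: 'a
    using bracket_powr_le[of s "nat \<lceil>s\<rceil>" \<xi>] assms(2) by (auto simp: le_nat_iff of_nat_ceiling)
  have "1 + (norm \<xi>)\<^sup>2 \<noteq> 0" for \<xi> :: 'a by (smt (verit) zero_le_power2)
  then show "continuous_on UNIV (\<lambda>\<xi>::'a. complex_of_real ((1 + (norm \<xi>)\<^sup>2) powr (s / 2)))"
    by (intro continuous_intros) auto
qed

section \<open>The inverse Fourier transform and its derivative\<close>

definition ift :: "('a::euclidean_space \<Rightarrow> complex) \<Rightarrow> 'a \<Rightarrow> complex" where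
  "ift G x = (1 / (2 * pi) ^ DIM('a)) *\<^sub>R (LBINT \<xi>. cis (x \<bullet> \<xi>) * G \<xi>)"

lemma integrable_cis_mult:
  fixes G :: "'a::euclidean_space \<Rightarrow> complex"
  assumes "integrable lborel G"
  shows "integrable lborel (\<lambda>\<xi>. cis (x \<bullet> \<xi>) * G \<xi>)"
  by (rule Bochner_Integration.integrable_bound[OF assms])
    (use borel_measurable_integrable[OF assms] in \<open>auto simp: norm_mult\<close>)

lemma ift_add: "integrable lborel G \<Longrightarrow> integrable lborel H \<Longrightarrow> ift (\<lambda>\<xi>. G \<xi> + H \<xi>) x = ift G x + ift H x"
  by (simp add: ift_def integrable_cis_mult ring_distribs scaleR_add_right)

lemma ift_mult: "ift (\<lambda>\<xi>. c * G \<xi>) x = c * ift G x"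
proof -
  have "(LBINT \<xi>. cis (x \<bullet> \<xi>) * (c * G \<xi>)) = (LBINT \<xi>. c * (cis (x \<bullet> \<xi>) * G \<xi>))"
    by (simp add: mult_ac)
  also have "\<dots> = c * (LBINT \<xi>. cis (x \<bullet> \<xi>) * G \<xi>)" by (rule integral_mult_right_zero)
  finally show ?thesis by (simp add: ift_def)
qed

lemma norm_ift_le:
  fixes G :: "'a::euclidean_space \<Rightarrow> complex"
  shows "norm (ift G x) \<le> (1 / (2 * pi) ^ DIM('a)) * (LBINT \<xi>. norm (G \<xi>))"
proof -
  have "norm (LBINT \<xi>. cis (x \<bullet> \<xi>) * G \<xi>) \<le> (LBINT \<xi>. norm (cis (x \<bullet> \<xi>) * G \<xi>))"
    by (rule integral_norm_bound)
  then show ?thesis by (simp add: ift_def norm_mult divide_right_mono)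
qed

lemma cis_taylor1: "norm (cis (a + b) - cis a - \<i> * of_real b * cis a) \<le> b\<^sup>2 / 2"
proof -
  have "cis (a + b) - cis a - \<i> * of_real b * cis a = cis a * (cis b - 1 - \<i> * of_real b)"
    by (simp add: cis_mult[symmetric] algebra_simps)
  moreover have "norm (cis b - 1 - \<i> * of_real b) \<le> b\<^sup>2 / 2"
    using iexp_approx1[of b 1] by (simp add: cis_conv_exp diff_diff_eq power2_eq_square)
  ultimately show ?thesis by (simp add: norm_mult)
qed

text \<open>The first-order Taylor remainder of the character is bounded by |y - x|^2 |\<xi>|^2, and
  G has a finite second moment. The remainder of \<open>ift G\<close> is therefore quadratic in y -
  x, with the explicit constant \<open>K\<close>. The derivative is again the \<open>ift\<close> of
  a rapid function, so the argument can be iterated.\<close>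

lemma ift_has_derivative:
  fixes G :: "'a::euclidean_space \<Rightarrow> complex"
  assumes G: "rapid G"
  shows "(ift G has_derivative (\<lambda>h. ift (\<lambda>\<xi>. \<i> * of_real (h \<bullet> \<xi>) * G \<xi>) x)) (at x)"
proof -
  let ?L = "\<lambda>h \<xi>. \<i> * of_real (h \<bullet> \<xi>) * G \<xi>"
  define K where "K = (1 / (2 * pi) ^ DIM('a)) * (LBINT \<xi>. norm (of_real ((norm \<xi>)\<^sup>2) * G \<xi>))"
  have ri: "integrable lborel (?L h)" for h
    by (intro rapid_integrable rapid_inner G)
  have r2: "integrable lborel (\<lambda>\<xi>. of_real ((norm \<xi>)\<^sup>2) * G \<xi>)"
  proof (intro rapid_integrable rapid_mult[OF G, of _ 1 2])
    fix \<xi> :: 'a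
    show "norm (complex_of_real ((norm \<xi>)\<^sup>2)) \<le> 1 * (1 + norm \<xi>)\<^sup>2"
      by (simp add: norm_mult power2_eq_square algebra_simps)
  qed (auto intro!: continuous_intros)
  have lin: "bounded_linear (\<lambda>h. ift (?L h) x)"
  proof (rule bounded_linear_intro)
    fix h k :: 'a
    show "ift (\<lambda>\<xi>. \<i> * of_real ((h + k) \<bullet> \<xi>) * G \<xi>) x =
      ift (?L h) x + ift (\<lambda>\<xi>. \<i> * of_real (k \<bullet> \<xi>) * G \<xi>) x"
      by (subst ift_add[OF ri ri, symmetric]) (simp add: inner_add_left algebra_simps)
    show "ift (\<lambda>\<xi>. \<i> * of_real ((r *\<^sub>R h) \<bullet> \<xi>) * G \<xi>) x = r *\<^sub>R ift (?L h) x" for r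
      by (simp add: scaleR_conv_of_real ift_mult[symmetric] mult_ac)
    have "norm (ift (?L h) x)
       \<le> (1 / (2 * pi) ^ DIM('a)) * (LBINT \<xi>. norm (\<i> * of_real (h \<bullet> \<xi>) * G \<xi>))"
      by (rule norm_ift_le)
    also have "\<dots> \<le> (1 / (2 * pi) ^ DIM('a)) * (LBINT \<xi>. norm h * norm (of_real (norm \<xi>) * G \<xi>))"
    proof (intro mult_left_mono integral_mono integrable_norm ri integrable_mult_right)
      show "integrable lborel (\<lambda>\<xi>. of_real (norm \<xi>) * G \<xi>)"
        by (intro rapid_integrable rapid_mult[OF G, of _ 1 1]) (auto intro!: continuous_intros)
      fix \<xi>
      show "norm (\<i> * of_real (h \<bullet> \<xi>) * G \<xi>) \<le> norm h * norm (of_real (norm \<xi>) * G \<xi>)"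
        using mult_right_mono[OF Cauchy_Schwarz_ineq2[of h \<xi>], of "norm (G \<xi>)"] by (simp add: norm_mult mult_ac)
    qed auto
    finally show "norm (ift (?L h) x)
      \<le> norm h * ((1 / (2 * pi) ^ DIM('a)) * (LBINT \<xi>. norm (of_real (norm \<xi>) * G \<xi>)))"
      by (simp add: mult_ac)
  qed
  have est: "norm (ift G y - ift G x - ift (?L (y - x)) x) \<le> K * (norm (y - x))\<^sup>2" for y
  proof -
    let ?D = "\<lambda>\<xi>. cis (y \<bullet> \<xi>) * G \<xi> - cis (x \<bullet> \<xi>) * G \<xi> - cis (x \<bullet> \<xi>) * (\<i> * of_real ((y - x) \<bullet> \<xi>) * G \<xi>)"
    have iD: "integrable lborel ?D"
      by (intro Bochner_Integration.integrable_diff integrable_cis_mult ri rapid_integrable G)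
    have eq: "ift G y - ift G x - ift (?L (y - x)) x
       = (1 / (2 * pi) ^ DIM('a)) *\<^sub>R (LBINT \<xi>. ?D \<xi>)"
      unfolding ift_def scaleR_diff_right[symmetric]
      by (subst Bochner_Integration.integral_diff,
          (intro Bochner_Integration.integrable_diff integrable_cis_mult ri rapid_integrable G)+)+ simp
    have "norm (ift G y - ift G x - ift (?L (y - x)) x)
      \<le> (1 / (2 * pi) ^ DIM('a)) * (LBINT \<xi>. norm (?D \<xi>))"
      unfolding eq by (simp add: divide_right_mono)
    also have "\<dots> \<le> (1 / (2 * pi) ^ DIM('a)) * (LBINT \<xi>. (norm (y - x))\<^sup>2 * norm (of_real ((norm \<xi>)\<^sup>2) * G \<xi>))"
    proof (intro mult_left_mono integral_mono integrable_norm iD integrable_mult_right r2)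
      fix \<xi>
      have "norm (?D \<xi>) = norm ((cis (x \<bullet> \<xi> + (y - x) \<bullet> \<xi>) - cis (x \<bullet> \<xi>) - \<i> * of_real ((y - x) \<bullet> \<xi>) * cis (x \<bullet> \<xi>)) * G \<xi>)"
        by (intro arg_cong[where f=norm]) (simp add: inner_diff_left algebra_simps)
      also have "\<dots> \<le> (((y - x) \<bullet> \<xi>)\<^sup>2 / 2) * norm (G \<xi>)"
        unfolding norm_mult by (intro mult_right_mono cis_taylor1) auto
      also have "\<dots> \<le> ((norm (y - x) * norm \<xi>)\<^sup>2) * norm (G \<xi>)"
      proof (intro mult_right_mono)
        have "((y - x) \<bullet> \<xi>)\<^sup>2 \<le> (norm (y - x) * norm \<xi>)\<^sup>2"
          using Cauchy_Schwarz_ineq2[of "y - x" \<xi>] by (simp add: abs_le_square_iff[symmetric])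
        then show "((y - x) \<bullet> \<xi>)\<^sup>2 / 2 \<le> (norm (y - x) * norm \<xi>)\<^sup>2"
          using zero_le_power2[of "norm (y - x) * norm \<xi>"] by linarith
      qed auto
      finally show "norm (?D \<xi>) \<le> (norm (y - x))\<^sup>2 * norm (of_real ((norm \<xi>)\<^sup>2) * G \<xi>)"
        by (simp add: norm_mult norm_power power_mult_distrib mult_ac)
    qed auto
    finally show ?thesis by (simp add: K_def mult_ac)
  qed
  show ?thesis
  proof (rule has_derivativeI_sandwich[where e=1 and H="\<lambda>y. K * norm (y - x)"])
    show "((\<lambda>y. K * norm (y - x)) \<longlongrightarrow> 0) (at x)"
      by (auto intro!: tendsto_eq_intros)
    fix y assume "y \<noteq> x"
    with est[of y] show "norm (ift G y - ift G x - ift (?L (y - x)) x) / norm (y - x) \<le> K * norm (y - x)"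
      by (simp add: field_simps power2_eq_square)
  qed (auto intro: lin)
qed

section \<open>Gaussians times inverse Fourier transforms are Schwartz functions\<close>

lemma power_le_fact_exp:
  assumes "0 \<le> (x::real)"
  shows "x ^ n \<le> fact n * exp x"
proof -
  have "x ^ n /\<^sub>R fact n \<le> exp x"
  proof -
    have "(\<Sum>k\<in>{n}. x ^ k /\<^sub>R fact k) \<le> (\<Sum>k. x ^ k /\<^sub>R fact k)"
      by (rule sum_le_suminf) (use assms summable_exp_generic[of x] in auto)
    then show ?thesis by (simp add: exp_def)
  qed
  then show ?thesis by (simp add: field_simps)
qed

abbreviation gauss :: "real \<Rightarrow> 'a::real_normed_vector \<Rightarrow> real" where
  "gauss \<delta> x \<equiv> exp (- (norm (\<delta> *\<^sub>R x))\<^sup>2 / 2)"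

lemma gauss_bracket_bound:
  assumes "\<delta> \<noteq> 0"
  obtains C where "0 \<le> C" "\<And>x::'a::euclidean_space. gauss \<delta> x \<le> C * decay N x"
proof
  \<comment> \<open>The factorial and the exponential of 1 + |x| come from
    \<open>power_le_fact_exp\<close>; completing the square in |x| - \<delta>^2 |x|^2 / 2 gives the
    bound 1/(2 \<delta>^2).\<close>
  let ?C = "fact N * exp (1 + 1 / (2 * \<delta>\<^sup>2)) :: real"
  show "0 \<le> ?C" by simp
  fix x :: 'a
  have "(1 + norm x) ^ N * gauss \<delta> x \<le> fact N * exp (1 + norm x) * gauss \<delta> x"
    by (intro mult_right_mono power_le_fact_exp) auto
  also have "\<dots> = fact N * exp (1 + norm x - \<delta>\<^sup>2 * (norm x)\<^sup>2 / 2)"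
    by (simp add: mult_exp_exp power_mult_distrib mult.assoc)
  also have "1 + norm x - \<delta>\<^sup>2 * (norm x)\<^sup>2 / 2 \<le> 1 + 1 / (2 * \<delta>\<^sup>2)"
  proof -
    have "0 \<le> (\<delta> * norm x - 1 / \<delta>)\<^sup>2" by simp
    also have "\<dots> = \<delta>\<^sup>2 * (norm x)\<^sup>2 - 2 * norm x + 1 / \<delta>\<^sup>2"
      using assms by (simp add: power2_diff power_mult_distrib power_divide)
    finally show ?thesis by (simp add: field_simps)
  qed
  finally have "(1 + norm x) ^ N * gauss \<delta> x \<le> ?C" by simp
  moreover have "0 < (1 + norm x) ^ N" by (simp add: add_pos_nonneg)
  ultimately show "gauss \<delta> x \<le> ?C * decay N x"
    by (simp add: field_simps)
qed

text \<open>\<open>schwartz\<close> speaks of all iterated derivatives, so a class closed under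
  \<open>partial_deriv\<close> is required. A derivative of the Gaussian produces a coordinate
  factor, and a derivative of \<open>ift G\<close> is the \<open>ift\<close> of another rapid
  function. Hence sums of coordinate monomials times a Gaussian times an inverse transform
  suffice.\<close>

inductive gauss_poly :: "real \<Rightarrow> (real^'d::finite \<Rightarrow> complex) \<Rightarrow> bool" for \<delta> where
  base: "rapid G \<Longrightarrow> gauss_poly \<delta> (\<lambda>x. of_real (gauss \<delta> x) * ift G x)"
| coord: "gauss_poly \<delta> F \<Longrightarrow> gauss_poly \<delta> (\<lambda>x. of_real (x $ j) * F x)"
| add: "gauss_poly \<delta> F \<Longrightarrow> gauss_poly \<delta> F' \<Longrightarrow> gauss_poly \<delta> (\<lambda>x. F x + F' x)"
| scale: "gauss_poly \<delta> F \<Longrightarrow> gauss_poly \<delta> (\<lambda>x. c * F x)"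

lemma partial_deriv_eqI:
  "(\<And>x. (f has_derivative f' x) (at x)) \<Longrightarrow> partial_deriv j f = (\<lambda>x. f' x (axis j 1))"
  unfolding partial_deriv_def by (metis frechet_derivative_at)

lemma gauss_poly_deriv:
  assumes "gauss_poly \<delta> F"
  shows "(\<forall>x. F differentiable (at x)) \<and> (\<forall>j. gauss_poly \<delta> (partial_deriv j F))"
  using assms
proof induction
  case (base G)
  let ?g = "\<lambda>x::real^'a. gauss \<delta> x"
  have g: "?g x = exp (- (\<delta>\<^sup>2 * (x \<bullet> x)) / 2)" for x
    by (simp add: power_mult_distrib power2_norm_eq_inner)
  have "((\<lambda>x. of_real (?g x)) has_derivative (\<lambda>h. of_real (- (\<delta>\<^sup>2 * (x \<bullet> h)) * ?g x))) (at x)" for x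
    unfolding g by (rule has_derivative_of_real) (auto intro!: derivative_eq_intros simp: inner_commute)
  note D = has_derivative_mult[OF this ift_has_derivative[OF base]]
  have "partial_deriv j (\<lambda>x. of_real (?g x) * ift G x)
     = (\<lambda>x. (- of_real (\<delta>\<^sup>2)) * (of_real (x $ j) * (of_real (?g x) * ift G x))
       + of_real (?g x) * ift (\<lambda>\<xi>. \<i> * of_real (axis j 1 \<bullet> \<xi>) * G \<xi>) x)" for j
    by (subst partial_deriv_eqI[OF D]) (simp add: inner_axis mult_ac)
  moreover have "gauss_poly \<delta> (\<dots> j)" for j
    by (intro gauss_poly.intros base rapid_inner)
  ultimately show ?case using D by (auto simp: differentiable_def)
next
  case (coord F k)
  then have "(F has_derivative frechet_derivative F (at x)) (at x)" for x
    by (simp add: frechet_derivative_works)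
  moreover have "((\<lambda>x. complex_of_real (x $ k)) has_derivative (\<lambda>h. of_real (h $ k))) (at x)" for x
    by (intro has_derivative_of_real bounded_linear_imp_has_derivative bounded_linear_vec_nth)
  ultimately have D: "((\<lambda>x. of_real (x $ k) * F x) has_derivative
      (\<lambda>h. of_real (x $ k) * frechet_derivative F (at x) h + of_real (h $ k) * F x)) (at x)" for x
    by (rule has_derivative_mult[rotated])
  have "partial_deriv j (\<lambda>x. of_real (x $ k) * F x)
     = (\<lambda>x. of_real (x $ k) * partial_deriv j F x + of_real (axis j 1 $ k) * F x)" for j
    by (subst partial_deriv_eqI[OF D]) (simp add: partial_deriv_def)
  moreover have "gauss_poly \<delta> (\<dots> j)" for j
    using coord by (intro gauss_poly.intros) auto
  ultimately show ?case using D by (auto simp: differentiable_def)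
next
  case (add F F')
  then have "(F has_derivative frechet_derivative F (at x)) (at x)"
    "(F' has_derivative frechet_derivative F' (at x)) (at x)" for x
    by (simp_all add: frechet_derivative_works)
  note D = has_derivative_add[OF this]
  have "partial_deriv j (\<lambda>x. F x + F' x) = (\<lambda>x. partial_deriv j F x + partial_deriv j F' x)" for j
    by (subst partial_deriv_eqI[OF D]) (simp add: partial_deriv_def)
  moreover have "gauss_poly \<delta> (\<dots> j)" for j
    using add by (intro gauss_poly.intros) auto
  ultimately show ?case using D by (auto simp: differentiable_def)
next
  case (scale F c)
  then have "(F has_derivative frechet_derivative F (at x)) (at x)" for x
    by (simp_all add: frechet_derivative_works)
  note D = has_derivative_mult_right[OF this, of c]
  have "partial_deriv j (\<lambda>x. c * F x) = (\<lambda>x. c * partial_deriv j F x)" for j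
    by (subst partial_deriv_eqI[OF D]) (simp add: partial_deriv_def)
  moreover have "gauss_poly \<delta> (\<dots> j)" for j
    using scale by (intro gauss_poly.intros) auto
  ultimately show ?case using D by (auto simp: differentiable_def)
qed

text \<open>\<open>ift G\<close> is only known to be bounded, so all the decay comes from the
  Gaussian, which is where \<delta> \<noteq> 0 enters. Each coordinate factor costs one power, and
  therefore N varies in the induction.\<close>

lemma gauss_poly_decay:
  assumes "gauss_poly \<delta> F" "\<delta> \<noteq> 0"
  shows "\<exists>C. \<forall>x. (1 + norm x) ^ N * norm (F x) \<le> C"
  using assms(1)
proof (induction arbitrary: N)
  case (base G)
  obtain C where C: "0 \<le> C" "\<And>x::real^'a. gauss \<delta> x \<le> C * decay N x"
    by (rule gauss_bracket_bound[OF assms(2), of N]) blast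
  define K where "K = (1 / (2 * pi) ^ DIM(real^'a)) * (LBINT \<xi>. norm (G \<xi>))"
  have "(1 + norm x) ^ N * norm (of_real (gauss \<delta> x) * ift G x) \<le> C * K" for x
  proof -
    have "(1 + norm x) ^ N * norm (of_real (gauss \<delta> x) * ift G x)
       \<le> (1 + norm x) ^ N * ((C * decay N x) * K)"
      unfolding norm_mult K_def by (intro mult_left_mono mult_mono norm_ift_le) (use C in auto)
    also have "\<dots> = C * K" by (simp add: add_nonneg_eq_0_iff)
    finally show ?thesis .
  qed
  then show ?case by blast
next
  case (coord F j)
  obtain C where C: "\<And>x. (1 + norm x) ^ Suc N * norm (F x) \<le> C" using coord.IH by blast
  have "(1 + norm x) ^ N * norm (of_real (x $ j) * F x) \<le> C" for x
  proof -
    have "(1 + norm x) ^ N * norm (of_real (x $ j) * F x) \<le> (1 + norm x) ^ N * ((1 + norm x) * norm (F x))"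
      unfolding norm_mult using component_le_norm_cart[of x j]
      by (intro mult_left_mono mult_right_mono) auto
    also have "\<dots> \<le> C" using C[of x] by (simp add: mult_ac)
    finally show ?thesis .
  qed
  then show ?case by blast
next
  case (add F F')
  obtain C C' where C: "\<And>x. (1 + norm x) ^ N * norm (F x) \<le> C" "\<And>x. (1 + norm x) ^ N * norm (F' x) \<le> C'"
    using add.IH by meson
  have "(1 + norm x) ^ N * norm (F x + F' x) \<le> C + C'" for x
  proof -
    have "(1 + norm x) ^ N * norm (F x + F' x) \<le> (1 + norm x) ^ N * (norm (F x) + norm (F' x))"
      by (intro mult_left_mono norm_triangle_ineq) auto
    also have "\<dots> \<le> C + C'" using C[of x] by (simp add: algebra_simps)
    finally show ?thesis .
  qed
  then show ?case by blast
next
  case (scale F c)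
  obtain C where C: "\<And>x. (1 + norm x) ^ N * norm (F x) \<le> C" using scale.IH by blast
  have "(1 + norm x) ^ N * norm (c * F x) \<le> norm c * C" for x
    using mult_left_mono[OF C[of x], of "norm c"] by (simp add: norm_mult mult_ac)
  then show ?case by blast
qed

text \<open>These are the test functions for the hypothesis of the theorem. For G merely rapid,
  \<open>ift G\<close> is smooth but may decay slowly; the Gaussian factor restores the
  decay.\<close>

lemma schwartz_gauss_ift:
  assumes "rapid G" "\<delta> \<noteq> 0"
  shows "schwartz (\<lambda>x::real^'d::finite. of_real (gauss \<delta> x) * ift G x)"
proof -
  define F where "F = (\<lambda>x::real^'d::finite. of_real (gauss \<delta> x) * ift G x)"
  have "gauss_poly \<delta> (foldr partial_deriv js F)" for js :: "'d list"
  proof (induction js)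
    case Nil
    show ?case unfolding F_def foldr.simps id_apply by (rule gauss_poly.base[OF assms(1)])
  qed (auto simp: gauss_poly_deriv)
  then show ?thesis
    unfolding schwartz_def F_def[symmetric]
    using gauss_poly_deriv gauss_poly_decay[OF _ assms(2)]
    by (simp add: bounded_iff) blast
qed

section \<open>Gaussian regularisation and Plancherel\<close>

lemma borel_measurable_cnj [measurable]: "cnj \<in> borel_measurable borel"
  by (intro borel_measurable_continuous_onI continuous_intros)

lemma bracket_pos: "0 < (1 + norm (x::'a::real_normed_vector)) ^ N"
  by (simp add: add_pos_nonneg)

lemma norm_integral_le:
  fixes f :: "'a \<Rightarrow> 'b::{banach, second_countable_topology}"
  assumes le: "\<And>x. norm (f x) \<le> g x" and g: "integrable M g"
  shows "norm (integral\<^sup>L M f) \<le> integral\<^sup>L M g"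
proof (cases "integrable M f")
  case True
  show ?thesis by (rule order_trans[OF integral_norm_bound integral_mono[OF integrable_norm[OF True] g le]])
next
  case False
  \<comment> \<open>The Bochner integral of a non-integrable function is 0 by convention, so in this
    case only the sign of the right-hand side matters.\<close>
  have "0 \<le> integral\<^sup>L M g" by (intro integral_nonneg_AE AE_I2 order_trans[OF norm_ge_zero le])
  with False show ?thesis by (simp add: not_integrable_integral_eq)
qed

lemma continuous_on_integral_dominated:
  fixes k :: "'a::metric_space \<Rightarrow> 'b::euclidean_space \<Rightarrow> 'c::{banach, second_countable_topology}"
  assumes meas: "\<And>x. k x \<in> borel_measurable borel"
    and cont: "\<And>y. continuous_on UNIV (\<lambda>x. k x y)"
    and le: "\<And>x y. norm (k x y) \<le> w y" and w: "integrable lborel w"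
  shows "continuous_on UNIV (\<lambda>x. \<integral>y. k x y \<partial>lborel)"
  unfolding continuous_on_sequentially
proof (intro allI ballI impI)
  fix X and a :: 'a
  assume X: "(\<forall>n. X n \<in> UNIV) \<and> X \<longlonglongrightarrow> a"
  have "(\<lambda>n. \<integral>y. k (X n) y \<partial>lborel) \<longlonglongrightarrow> (LBINT y. k a y)"
  proof (rule integral_dominated_convergence[OF _ _ w])
    show "AE y in lborel. (\<lambda>n. k (X n) y) \<longlonglongrightarrow> k a y"
    proof (intro AE_I2)
      fix y show "(\<lambda>n. k (X n) y) \<longlonglongrightarrow> k a y"
        using cont[of y] X unfolding continuous_on_sequentially by (auto simp: o_def)
    qed
  qed (use meas le in auto)
  then show "((\<lambda>x. \<integral>y. k x y \<partial>lborel) \<circ> X) \<longlonglongrightarrow> (LBINT y. k a y)"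
    by (simp add: o_def)
qed

text \<open>Convolution of G with a Gaussian of width \<delta>, after rescaling. The kernel does not
  depend on \<delta>, so one majorant serves all \<delta> in the limit, and \<delta> = 0 gives back
  G.\<close>

definition gauss_conv :: "real \<Rightarrow> ('a::euclidean_space \<Rightarrow> complex) \<Rightarrow> 'a \<Rightarrow> complex" where
  "gauss_conv \<delta> G \<xi> = (LBINT z. of_real (gauss_kernel z) * G (\<xi> + \<delta> *\<^sub>R z))"

lemma gauss_kernel_bracket_bound:
  obtains C where "0 \<le> C" "\<And>z::'a::euclidean_space. gauss_kernel z \<le> C * decay N z"
proof -
  obtain C where C: "0 \<le> C" "\<And>x::'a. exp (- (norm (1 *\<^sub>R x))\<^sup>2 / 2) \<le> C * decay N x"
    by (rule gauss_bracket_bound[of 1 N]) auto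
  show ?thesis
  proof (rule that)
    show "0 \<le> (2 * pi) powr (- real DIM('a) / 2) * C" using C by simp
    show "gauss_kernel z \<le> (2 * pi) powr (- real DIM('a) / 2) * C * decay N z" for z :: 'a
      using mult_left_mono[OF C(2)[of z], of "(2 * pi) powr (- real DIM('a) / 2)"]
      by (simp add: gauss_kernel_def mult_ac)
  qed
qed

lemma integrable_gauss_kernel_bracket:
  "integrable lborel (\<lambda>z::'a::euclidean_space. gauss_kernel z * (1 + norm z) ^ N)"
proof -
  obtain C where C: "0 \<le> C" "\<And>z::'a. gauss_kernel z \<le> C * decay (2 * DIM('a) + N) z"
    by (rule gauss_kernel_bracket_bound[of "2 * DIM('a) + N"]) blast
  have "gauss_kernel z * (1 + norm z) ^ N \<le> C * decay (2 * DIM('a)) z" for z :: 'a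
  proof -
    have "gauss_kernel z * (1 + norm z) ^ N \<le> C * decay (2 * DIM('a) + N) z * (1 + norm z) ^ N"
      by (intro mult_right_mono C) auto
    also have "\<dots> = C * decay (2 * DIM('a)) z"
      using bracket_pos[of z N] by (simp add: power_add field_simps)
    finally show ?thesis .
  qed
  then show ?thesis
    by (intro Bochner_Integration.integrable_bound[OF integrable_mult_right[OF integrable_inverse_bracket, of C]] AE_I2)
      (auto intro!: order_trans[OF _ abs_ge_self] simp: gauss_kernel_nonneg)
qed

text \<open>Peetre's inequality, obtained by writing x as (x + y) + (-y).\<close>

lemma inverse_bracket_shift_le:
  "decay N (x + y) \<le> (1 + norm y) ^ N * decay N x"
proof -
  have "(1 + norm x) ^ N \<le> ((1 + norm (x + y)) * (1 + norm y)) ^ N"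
    using bracket_add_le[of "x + y" "- y"] by (intro power_mono) auto
  then show ?thesis
    unfolding power_mult_distrib
    using bracket_pos[of x N] bracket_pos[of "x + y" N] by (simp add: field_simps)
qed

text \<open>By Peetre's inequality the shift by \<delta> z costs at most (1 + |z|)^N when \<delta>
  <= 1, and all moments of the Gaussian are finite. Uniformity in \<delta> is what the later limits
  rest on.\<close>

lemma gauss_conv_bound:
  fixes G :: "'a::euclidean_space \<Rightarrow> complex"
  assumes "rapid G"
  obtains C where "0 \<le> C" "\<And>\<delta> \<xi>. 0 \<le> \<delta> \<Longrightarrow> \<delta> \<le> 1 \<Longrightarrow> norm (gauss_conv \<delta> G \<xi>) \<le> C * decay N \<xi>"
proof -
  obtain C where C: "0 \<le> C" "\<And>\<xi>. norm (G \<xi>) \<le> C * decay N \<xi>"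
    by (rule rapidE[OF assms, of N]) blast
  let ?I = "\<integral>z. gauss_kernel (z::'a) * (1 + norm z) ^ N \<partial>lborel"
  have "norm (gauss_conv \<delta> G \<xi>) \<le> C * ?I * decay N \<xi>" if d: "0 \<le> \<delta>" "\<delta> \<le> 1" for \<delta> \<xi>
  proof -
    have "norm (gauss_conv \<delta> G \<xi>) \<le> (LBINT z. C * decay N \<xi> * (gauss_kernel (z::'a) * (1 + norm z) ^ N))"
      unfolding gauss_conv_def
    proof (rule norm_integral_le)
      fix z :: 'a
      have "norm (G (\<xi> + \<delta> *\<^sub>R z)) \<le> C * decay N (\<xi> + \<delta> *\<^sub>R z)" by (rule C)
      also have "\<dots> \<le> C * ((1 + norm (\<delta> *\<^sub>R z)) ^ N * decay N \<xi>)"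
        by (intro mult_left_mono inverse_bracket_shift_le C)
      also have "\<dots> \<le> C * ((1 + norm z) ^ N * decay N \<xi>)"
        using d by (intro mult_left_mono mult_right_mono power_mono C) (auto simp: mult_left_le_one_le)
      finally have "norm (G (\<xi> + \<delta> *\<^sub>R z)) \<le> C * ((1 + norm z) ^ N * decay N \<xi>)" .
      from mult_left_mono[OF this gauss_kernel_nonneg[of z]]
      show "norm (of_real (gauss_kernel z) * G (\<xi> + \<delta> *\<^sub>R z)) \<le> C * decay N \<xi> * (gauss_kernel z * (1 + norm z) ^ N)"
        by (simp add: norm_mult gauss_kernel_nonneg mult_ac)
    qed (intro integrable_mult_right integrable_gauss_kernel_bracket)
    also have "\<dots> = C * ?I * decay N \<xi>" by simp
    finally show ?thesis .
  qed
  moreover have "0 \<le> C * ?I" using C by (simp add: gauss_kernel_nonneg)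
  ultimately show ?thesis using that by blast
qed

lemma rapid_bounded:
  assumes "rapid G"
  obtains B where "0 \<le> B" "\<And>\<xi>. norm (G \<xi>) \<le> B"
  using rapidE[OF assms, of 0] by auto

lemma rapid_gauss_conv:
  fixes G :: "'a::euclidean_space \<Rightarrow> complex"
  assumes G: "rapid G" and d: "0 \<le> \<delta>" "\<delta> \<le> 1"
  shows "rapid (gauss_conv \<delta> G)"
  unfolding rapid_def
proof (intro conjI allI)
  note [measurable] = rapid_measurable[OF G]
  obtain B where B: "0 \<le> B" "\<And>\<xi>. norm (G \<xi>) \<le> B" by (rule rapid_bounded[OF G]) blast
  show "continuous_on UNIV (gauss_conv \<delta> G)"
    unfolding gauss_conv_def
  proof (rule continuous_on_integral_dominated)
    show "integrable lborel (\<lambda>z::'a. B * gauss_kernel z)" by (intro integrable_mult_right integrable_gauss_kernel)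
    show "norm (of_real (gauss_kernel z) * G (x + \<delta> *\<^sub>R z)) \<le> B * gauss_kernel z" for x z
      using mult_left_mono[OF B(2) gauss_kernel_nonneg[of z]] by (simp add: norm_mult gauss_kernel_nonneg mult_ac)
    show "continuous_on UNIV (\<lambda>x. of_real (gauss_kernel z) * G (x + \<delta> *\<^sub>R z))" for z
      by (intro continuous_intros continuous_on_compose2[OF rapid_continuous[OF G]]) auto
  qed measurable
  fix N
  obtain C where C: "\<And>\<xi>. norm (gauss_conv \<delta> G \<xi>) \<le> C * decay N \<xi>"
    using gauss_conv_bound[OF G, of N] d by metis
  show "\<exists>C. \<forall>\<xi>. (1 + norm \<xi>) ^ N * norm (gauss_conv \<delta> G \<xi>) \<le> C"
  proof (intro exI allI)
    fix \<xi> :: 'a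
    show "(1 + norm \<xi>) ^ N * norm (gauss_conv \<delta> G \<xi>) \<le> C"
      using C[of \<xi>] bracket_pos[of \<xi> N] by (simp add: field_simps)
  qed
qed

lemma gauss_conv_tendsto:
  fixes G :: "'a::euclidean_space \<Rightarrow> complex"
  assumes G: "rapid G" and d: "d \<longlonglongrightarrow> 0"
  shows "(\<lambda>n. gauss_conv (d n) G \<xi>) \<longlonglongrightarrow> G \<xi>"
proof -
  note [measurable] = rapid_measurable[OF G]
  obtain B where B: "0 \<le> B" "\<And>\<xi>. norm (G \<xi>) \<le> B" by (rule rapid_bounded[OF G]) blast
  have "(\<lambda>n. gauss_conv (d n) G \<xi>) \<longlonglongrightarrow> (LBINT z. of_real (gauss_kernel (z::'a)) * G \<xi>)"
    unfolding gauss_conv_def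
  proof (rule integral_dominated_convergence)
    show "integrable lborel (\<lambda>z::'a. B * gauss_kernel z)" by (intro integrable_mult_right integrable_gauss_kernel)
    show "AE z in lborel. norm (of_real (gauss_kernel z) * G (\<xi> + d n *\<^sub>R z)) \<le> B * gauss_kernel z" for n
      using mult_left_mono[OF B(2) gauss_kernel_nonneg] by (intro AE_I2) (simp add: norm_mult gauss_kernel_nonneg mult_ac)
    show "AE z in lborel. (\<lambda>n. of_real (gauss_kernel z) * G (\<xi> + d n *\<^sub>R z)) \<longlonglongrightarrow> of_real (gauss_kernel z) * G \<xi>"
    proof (intro AE_I2 tendsto_mult tendsto_const)
      fix z :: 'a
      have "isCont G \<xi>" using rapid_continuous[OF G] by (simp add: continuous_on_eq_continuous_at)
      moreover have "(\<lambda>n. \<xi> + d n *\<^sub>R z) \<longlonglongrightarrow> \<xi>" by (rule tendsto_eq_intros d refl | simp)+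
      ultimately show "(\<lambda>n. G (\<xi> + d n *\<^sub>R z)) \<longlonglongrightarrow> G \<xi>" by (rule isCont_tendsto_compose)
    qed
  qed measurable
  also have "(LBINT z. of_real (gauss_kernel (z::'a)) * G \<xi>) = G \<xi>"
    using integral_gauss_kernel[where 'a='a] by (simp only: integral_mult_left_zero integral_complex_of_real) simp
  finally show ?thesis .
qed

lemma integrable_gauss_scaled:
  assumes "\<delta> \<noteq> 0"
  shows "integrable lborel (\<lambda>x::'a::euclidean_space. gauss \<delta> x)"
proof -
  obtain C where C: "0 \<le> C" "\<And>x::'a. gauss \<delta> x \<le> C * decay (2 * DIM('a)) x"
    by (rule gauss_bracket_bound[OF assms, of "2 * DIM('a)"]) blast
  show ?thesis
    by (intro Bochner_Integration.integrable_bound[OF integrable_mult_right[OF integrable_inverse_bracket, of C]] AE_I2)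
      (use order_trans[OF C(2) abs_ge_self] in auto)
qed

text \<open>A regularised form of Fourier inversion. Fubini brings the x-integral inside, where it
  is the explicit transform of a Gaussian concentrated near \<xi>, and the substitution \<eta> =
  \<xi> + \<delta> z makes the kernel independent of \<delta>. As \<delta> tends to 0 the result
  tends to G, so G is a limit of transforms of Schwartz functions.\<close>

lemma fourier_gauss_ift:
  fixes G :: "real^'d::finite \<Rightarrow> complex"
  assumes G: "rapid G" and d: "0 < \<delta>"
  shows "fourier (\<lambda>x. of_real (gauss \<delta> x) * ift G x) = gauss_conv \<delta> G"
proof
  fix \<xi> :: "real^'d"
  note [measurable] = rapid_measurable[OF G]
  let ?D = "DIM(real^'d)"
  let ?e = "\<lambda>x::real^'d. gauss \<delta> x"
  define c where "c = 1 / (2 * pi) ^ ?D"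
  have inner: "\<delta> ^ ?D *\<^sub>R (LBINT x. cis (x \<bullet> (\<delta> *\<^sub>R z)) * ?e x) = of_real ((2 * pi) ^ ?D * gauss_kernel z)" for z
    using integral_lborel_affine[of "\<lambda>x. cis (x \<bullet> z) * exp (- (norm x)\<^sup>2 / 2)" \<delta> 0] d
    unfolding integral_cis_gauss by simp
  have "fourier (\<lambda>x. of_real (?e x) * ift G x) \<xi>
      = (LBINT x. c *\<^sub>R (LBINT \<eta>. cis (- (x \<bullet> \<xi>)) * of_real (?e x) * (cis (x \<bullet> \<eta>) * G \<eta>)))"
    unfolding fourier_def ift_def c_def by (simp add: mult.assoc)
  also have "\<dots> = c *\<^sub>R (LBINT x. (LBINT \<eta>. cis (- (x \<bullet> \<xi>)) * of_real (?e x) * (cis (x \<bullet> \<eta>) * G \<eta>)))"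
    by (rule integral_scaleR_right)
  also have "(LBINT x. (LBINT \<eta>. cis (- (x \<bullet> \<xi>)) * of_real (?e x) * (cis (x \<bullet> \<eta>) * G \<eta>)))
     = (LBINT \<eta>. (LBINT x. cis (- (x \<bullet> \<xi>)) * of_real (?e x) * (cis (x \<bullet> \<eta>) * G \<eta>)))"
  proof (rule Fubini_dominated)
    show "integrable lborel ?e" using d by (intro integrable_gauss_scaled) auto
    show "integrable lborel (\<lambda>\<eta>. norm (G \<eta>))" by (intro integrable_norm rapid_integrable G)
  qed (auto simp: norm_mult)
  also have "\<dots> = (LBINT \<eta>. G \<eta> * (LBINT x. cis (x \<bullet> (\<eta> - \<xi>)) * ?e x))"
  proof (rule integral_ext)
    fix \<eta>
    have "cis (- (x \<bullet> \<xi>)) * of_real (?e x) * (cis (x \<bullet> \<eta>) * G \<eta>) = G \<eta> * (cis (x \<bullet> (\<eta> - \<xi>)) * ?e x)" for x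
      using cis_mult[of "x \<bullet> \<eta>" "- (x \<bullet> \<xi>)"] by (simp add: inner_diff_right mult_ac)
    then show "(LBINT x. cis (- (x \<bullet> \<xi>)) * of_real (?e x) * (cis (x \<bullet> \<eta>) * G \<eta>))
      = G \<eta> * (LBINT x. cis (x \<bullet> (\<eta> - \<xi>)) * ?e x)"
      by (simp only: integral_mult_right_zero)
  qed
  also have "\<dots> = \<delta> ^ ?D *\<^sub>R (LBINT z. G (\<xi> + \<delta> *\<^sub>R z) * (LBINT x. cis (x \<bullet> (\<delta> *\<^sub>R z)) * ?e x))"
  proof -
    let ?h = "\<lambda>\<eta>. G \<eta> * (LBINT x. cis (x \<bullet> (\<eta> - \<xi>)) * ?e x)"
    have "?h \<in> borel_measurable borel" by measurable
    from integral_lborel_affine[OF this, of \<delta> \<xi>] d show ?thesis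
      by (simp only: add_diff_cancel_left' abs_of_pos)
  qed
  also have "\<dots> = (LBINT z. G (\<xi> + \<delta> *\<^sub>R z) * of_real ((2 * pi) ^ ?D * gauss_kernel z))"
    unfolding inner[symmetric] mult_scaleR_right integral_scaleR_right ..
  also have "\<dots> = (LBINT z. of_real ((2 * pi) ^ ?D) * (of_real (gauss_kernel z) * G (\<xi> + \<delta> *\<^sub>R z)))"
    by (rule integral_ext) simp
  also have "\<dots> = of_real ((2 * pi) ^ ?D) * gauss_conv \<delta> G \<xi>"
    unfolding gauss_conv_def by (rule integral_mult_right_zero)
  also have "c *\<^sub>R \<dots> = gauss_conv \<delta> G \<xi>"
    by (simp add: c_def scaleR_conv_of_real)
  finally show "fourier (\<lambda>x. of_real (?e x) * ift G x) \<xi> = gauss_conv \<delta> G \<xi>" .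
qed

lemma ift_continuous:
  fixes G :: "'a::euclidean_space \<Rightarrow> complex"
  shows "rapid G \<Longrightarrow> continuous_on UNIV (ift G)"
  by (auto intro!: continuous_at_imp_continuous_on has_derivative_continuous ift_has_derivative)

text \<open>Integrability of |ift G|^2 is not known beforehand, so a Gaussian cut-off
  \<open>e n\<close> is inserted. Expanding one factor and applying Fubini turns the cut-off
  integral \<open>A n\<close> into the pairing of G with its Gaussian mollification. As n grows, the
  cut-off increases to 1 and monotone convergence applies on the space side, while dominated
  convergence applies on the frequency side.\<close>

lemma plancherel:
  fixes G :: "real^'d::finite \<Rightarrow> complex"
  assumes G: "rapid G"
  shows "(\<integral>\<^sup>+x. ennreal ((norm (ift G x))\<^sup>2) \<partial>lborel) = ennreal ((1 / (2 * pi) ^ CARD('d)) * (LBINT \<xi>. (norm (G \<xi>))\<^sup>2))"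
proof -
  note [measurable] = rapid_measurable[OF G]
  have [measurable]: "ift G \<in> borel_measurable borel"
    by (intro borel_measurable_continuous_onI ift_continuous G)
  define c where "c = 1 / (2 * pi) ^ CARD('d)"
  define e where "e = (\<lambda>n (x::real^'d). exp (- (norm (inverse (real (Suc n)) *\<^sub>R x))\<^sup>2 / 2))"
  define A where "A n = (LBINT x. e n x * (norm (ift G x))\<^sup>2)" for n
  have [measurable]: "e n \<in> borel_measurable borel" for n unfolding e_def by measurable
  obtain B where B: "0 \<le> B" "\<And>\<xi>. norm (G \<xi>) \<le> B" by (rule rapid_bounded[OF G]) blast
  define K where "K = c * (LBINT \<xi>. norm (G \<xi>))"
  have K: "norm (ift G x) \<le> K" for x using norm_ift_le[of G x] by (simp add: K_def c_def)
  have K0: "0 \<le> K" using order_trans[OF norm_ge_zero K] .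
  have ie: "integrable lborel (e n)" for n
    unfolding e_def by (rule integrable_gauss_scaled) simp
  have e0: "0 \<le> e n x" for n x by (simp add: e_def)
  have iA: "integrable lborel (\<lambda>x. e n x * (norm (ift G x))\<^sup>2)" for n
  proof (rule Bochner_Integration.integrable_bound[OF integrable_mult_left[OF ie, of n "K\<^sup>2"]])
    show "AE x in lborel. norm (e n x * (norm (ift G x))\<^sup>2) \<le> norm (e n x * K\<^sup>2)"
      using K by (auto simp: e0 abs_mult intro!: mult_left_mono power_mono)
  qed measurable
  have iG: "integrable lborel G" by (rule rapid_integrable[OF G])
  have A_eq: "complex_of_real (A n) = of_real c * (LBINT \<eta>. cnj (G \<eta>) * gauss_conv (inverse (real (Suc n))) G \<eta>)" for n
  proof -
    let ?f = "\<lambda>x. of_real (e n x) * ift G x"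
    have "complex_of_real (A n) = (LBINT x. ?f x * cnj (ift G x))"
      unfolding A_def integral_complex_of_real[symmetric]
      by (rule integral_ext) (simp add: complex_norm_square mult.assoc del: of_real_power)
    also have "\<dots> = (LBINT x. of_real c * (LBINT \<eta>. ?f x * (cis (- (x \<bullet> \<eta>)) * cnj (G \<eta>))))"
    proof (rule integral_ext)
      fix x
      have "cnj (ift G x) = of_real c * (LBINT \<eta>. cis (- (x \<bullet> \<eta>)) * cnj (G \<eta>))"
        using Bochner_Integration.integral_cnj[of lborel "\<lambda>\<xi>. cis (x \<bullet> \<xi>) * G \<xi>"]
        by (simp add: ift_def c_def scaleR_conv_of_real cis_cnj)
      then show "?f x * cnj (ift G x) = of_real c * (LBINT \<eta>. ?f x * (cis (- (x \<bullet> \<eta>)) * cnj (G \<eta>)))"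
        by (simp only: integral_mult_right_zero) (simp add: mult_ac)
    qed
    also have "\<dots> = of_real c * (LBINT x. (LBINT \<eta>. ?f x * (cis (- (x \<bullet> \<eta>)) * cnj (G \<eta>))))"
      by (rule integral_mult_right_zero)
    also have "(LBINT x. (LBINT \<eta>. ?f x * (cis (- (x \<bullet> \<eta>)) * cnj (G \<eta>))))
      = (LBINT \<eta>. (LBINT x. ?f x * (cis (- (x \<bullet> \<eta>)) * cnj (G \<eta>))))"
    proof (rule Fubini_dominated)
      show "integrable lborel (\<lambda>x. e n x * K)" by (intro integrable_mult_left ie)
      show "integrable lborel (\<lambda>\<eta>. norm (G \<eta>))" by (intro integrable_norm iG)
      show "norm (?f x * (cis (- (x \<bullet> \<eta>)) * cnj (G \<eta>))) \<le> e n x * K * norm (G \<eta>)" for x \<eta>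
        using K by (simp add: norm_mult e0 mult_left_mono mult_right_mono)
      show "(\<lambda>(x, \<eta>). ?f x * (cis (- (x \<bullet> \<eta>)) * cnj (G \<eta>))) \<in> borel_measurable (lborel \<Otimes>\<^sub>M lborel)"
        by measurable
    qed
    also have "\<dots> = (LBINT \<eta>. cnj (G \<eta>) * fourier ?f \<eta>)"
      unfolding fourier_def integral_mult_right_zero[symmetric] by (simp add: mult_ac)
    also have "fourier ?f = gauss_conv (inverse (real (Suc n))) G"
      unfolding e_def by (rule fourier_gauss_ift[OF G]) simp
    finally show ?thesis .
  qed
  have d0: "(\<lambda>n. inverse (real (Suc n))) \<longlonglongrightarrow> 0" by (rule LIMSEQ_inverse_real_of_nat)
  obtain C where C: "0 \<le> C" "\<And>\<delta> \<xi>. 0 \<le> \<delta> \<Longrightarrow> \<delta> \<le> 1 \<Longrightarrow> norm (gauss_conv \<delta> G \<xi>) \<le> C * decay 0 \<xi>"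
    by (rule gauss_conv_bound[OF G, of 0]) blast
  have "(\<lambda>n. complex_of_real (A n)) \<longlonglongrightarrow> of_real c * (LBINT \<eta>. cnj (G \<eta>) * G \<eta>)"
    unfolding A_eq
  proof (intro tendsto_mult tendsto_const integral_dominated_convergence)
    show "integrable lborel (\<lambda>\<eta>. norm (G \<eta>) * C)" by (intro integrable_mult_left integrable_norm iG)
    show "AE \<eta> in lborel. (\<lambda>n. cnj (G \<eta>) * gauss_conv (inverse (real (Suc n))) G \<eta>) \<longlonglongrightarrow> cnj (G \<eta>) * G \<eta>"
      by (intro AE_I2 tendsto_mult tendsto_const gauss_conv_tendsto G d0)
    show "AE \<eta> in lborel. norm (cnj (G \<eta>) * gauss_conv (inverse (real (Suc n))) G \<eta>) \<le> norm (G \<eta>) * C" for n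
      using C(2)[of "inverse (real (Suc n))"] by (auto simp: norm_mult inverse_le_1_iff intro!: mult_left_mono)
    have [measurable]: "gauss_conv (inverse (real (Suc n))) G \<in> borel_measurable borel" for n
      by (intro rapid_measurable rapid_gauss_conv G) (auto simp: inverse_le_1_iff)
    show "(\<lambda>\<eta>. cnj (G \<eta>) * gauss_conv (inverse (real (Suc n))) G \<eta>) \<in> borel_measurable lborel" for n
      by measurable
  qed measurable
  moreover have "(LBINT \<eta>. cnj (G \<eta>) * G \<eta>) = of_real (LBINT \<xi>. (norm (G \<xi>))\<^sup>2)"
    unfolding integral_complex_of_real[symmetric]
    by (rule integral_ext) (simp add: complex_norm_square mult.commute del: of_real_power)
  ultimately have "(\<lambda>n. complex_of_real (A n)) \<longlonglongrightarrow> complex_of_real (c * (LBINT \<xi>. (norm (G \<xi>))\<^sup>2))"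
    by simp
  then have "A \<longlonglongrightarrow> c * (LBINT \<xi>. (norm (G \<xi>))\<^sup>2)"
    by (simp only: tendsto_of_real_iff)
  then have 1: "(\<lambda>n. ennreal (A n)) \<longlonglongrightarrow> ennreal (c * (LBINT \<xi>. (norm (G \<xi>))\<^sup>2))"
    by (rule tendsto_ennrealI)
  have "(\<lambda>n. \<integral>\<^sup>+x. ennreal (e n x * (norm (ift G x))\<^sup>2) \<partial>lborel) \<longlonglongrightarrow> (\<integral>\<^sup>+x. ennreal ((norm (ift G x))\<^sup>2) \<partial>lborel)"
  proof (rule nn_integral_LIMSEQ)
    show "incseq (\<lambda>n x. ennreal (e n x * (norm (ift G x))\<^sup>2))"
    proof (intro incseq_SucI le_funI ennreal_leI mult_right_mono)
      fix n and x :: "real^'d"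
      have "inverse (real (Suc (Suc n))) * norm x \<le> inverse (real (Suc n)) * norm x"
        by (intro mult_right_mono) auto
      then show "e n x \<le> e (Suc n) x"
        unfolding e_def norm_scaleR by (simp add: power_mono)
    qed auto
    fix x :: "real^'d"
    have "(\<lambda>n. e n x) \<longlonglongrightarrow> exp (- (norm (0 *\<^sub>R x))\<^sup>2 / 2)"
      unfolding e_def by (intro tendsto_intros d0) auto
    then show "(\<lambda>n. ennreal (e n x * (norm (ift G x))\<^sup>2)) \<longlonglongrightarrow> ennreal ((norm (ift G x))\<^sup>2)"
      by (intro tendsto_ennrealI) (auto intro!: tendsto_eq_intros)
  qed measurable
  moreover have "(\<integral>\<^sup>+x. ennreal (e n x * (norm (ift G x))\<^sup>2) \<partial>lborel) = ennreal (A n)" for n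
    unfolding A_def by (rule nn_integral_eq_integral[OF iA]) (auto simp: e0)
  ultimately have "(\<lambda>n. ennreal (A n)) \<longlonglongrightarrow> (\<integral>\<^sup>+x. ennreal ((norm (ift G x))\<^sup>2) \<partial>lborel)" by simp
  from LIMSEQ_unique[OF this 1] show ?thesis by (simp add: c_def)
qed

section \<open>Basic properties of Schwartz functions\<close>

lemma schwartz_bound:
  fixes f :: "real^'d::finite \<Rightarrow> complex"
  assumes "schwartz f"
  obtains C where "0 \<le> C" "\<And>x. norm (f x) \<le> C * decay N x"
proof -
  have "bounded (range (\<lambda>x. (1 + norm x) ^ N *\<^sub>R f x))"
    using assms[unfolded schwartz_def, rule_format, of "[]"] by auto
  then obtain C where C: "\<And>x. norm ((1 + norm x) ^ N *\<^sub>R f x) \<le> C" by (auto simp: bounded_iff)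
  have "norm (f x) \<le> C * decay N x" for x
    using C[of x] bracket_pos[of x N] by (simp add: field_simps)
  moreover have "0 \<le> C" using order_trans[OF norm_ge_zero C[of 0]] .
  ultimately show ?thesis using that by blast
qed

lemma schwartz_differentiable: "schwartz f \<Longrightarrow> f differentiable (at x)"
  by (auto simp: schwartz_def dest: spec[of _ "[]"])

lemma schwartz_partial_deriv: "schwartz f \<Longrightarrow> schwartz (partial_deriv j f)"
proof -
  \<comment> \<open>The fold runs from the right, so the derivative that is taken first is the last
    entry of the list.\<close>
  have "foldr partial_deriv js (partial_deriv j f) = foldr partial_deriv (js @ [j]) f" for js by simp
  then show "schwartz f \<Longrightarrow> schwartz (partial_deriv j f)" unfolding schwartz_def by presburger
qed

lemma schwartz_continuous: "schwartz f \<Longrightarrow> continuous_on UNIV f"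
  by (auto intro!: continuous_at_imp_continuous_on differentiable_imp_continuous_within schwartz_differentiable)

lemma schwartz_integrable:
  fixes f :: "real^'d::finite \<Rightarrow> complex"
  assumes "schwartz f" shows "integrable lborel f"
proof (rule rapid_integrable)
  show "rapid f" unfolding rapid_def
  proof (intro conjI allI schwartz_continuous assms)
    fix N
    obtain C where C: "\<And>x. norm (f x) \<le> C * decay N x" by (rule schwartz_bound[OF assms, of N]) blast
    have "(1 + norm x) ^ N * norm (f x) \<le> C" for x
      using C[of x] bracket_pos[of x N] by (simp add: field_simps)
    then show "\<exists>C. \<forall>x. (1 + norm x) ^ N * norm (f x) \<le> C" by blast
  qed
qed

section \<open>Fourier transforms of Schwartz functions\<close>

lemma fourier_continuous:
  fixes f :: "real^'d::finite \<Rightarrow> complex"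
  assumes "integrable lborel f"
  shows "continuous_on UNIV (fourier f)"
proof -
  have [measurable]: "f \<in> borel_measurable borel" using borel_measurable_integrable[OF assms] by simp
  show ?thesis
    unfolding fourier_def
  proof (rule continuous_on_integral_dominated)
    show "integrable lborel (\<lambda>x. norm (f x))" using assms by (rule integrable_norm)
    show "continuous_on UNIV (\<lambda>\<xi>. cis (- (x \<bullet> \<xi>)) * f x)" for x
      by (intro continuous_intros)
  qed (auto simp: norm_mult)
qed

lemma schwartz_has_vector_derivative:
  fixes f :: "real^'d::finite \<Rightarrow> complex"
  assumes f: "schwartz f"
  shows "((\<lambda>t. f (x + t *\<^sub>R axis j 1)) has_vector_derivative partial_deriv j f (x + t *\<^sub>R axis j 1)) (at t within A)"
proof -
  let ?e = "axis j 1 :: real^'d"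
  have 1: "(f has_derivative frechet_derivative f (at (x + t *\<^sub>R ?e))) (at (x + t *\<^sub>R ?e))"
    using schwartz_differentiable[OF f] by (simp add: frechet_derivative_works)
  have 2: "((\<lambda>t. x + t *\<^sub>R ?e) has_derivative (\<lambda>s. s *\<^sub>R ?e)) (at t within A)"
    by (auto intro!: derivative_eq_intros)
  have "((\<lambda>t. f (x + t *\<^sub>R ?e)) has_derivative (\<lambda>s. frechet_derivative f (at (x + t *\<^sub>R ?e)) (s *\<^sub>R ?e))) (at t within A)"
    using has_derivative_compose[OF 2 1] .
  moreover have "linear (frechet_derivative f (at (x + t *\<^sub>R ?e)))"
    using 1 by (rule has_derivative_linear)
  ultimately show ?thesis
    by (simp add: has_vector_derivative_def partial_deriv_def linear_scale)
qed

text \<open>The mean value theorem bounds the difference by the derivative at an intermediate point;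
  for |h| <= 1, Peetre's inequality moves the weight back to x at the cost 2^N. The outcome is an
  integrable majorant for difference quotients.\<close>

lemma schwartz_diff_bound:
  fixes f :: "real^'d::finite \<Rightarrow> complex"
  assumes f: "schwartz f"
  obtains C where "0 \<le> C"
    "\<And>x h. \<bar>h\<bar> \<le> 1 \<Longrightarrow> norm (f (x + h *\<^sub>R axis j 1) - f x) \<le> \<bar>h\<bar> * (C * decay N x)"
proof -
  obtain C where C: "0 \<le> C" "\<And>x. norm (partial_deriv j f x) \<le> C * decay N x"
    by (rule schwartz_bound[OF schwartz_partial_deriv[OF f, of j], of N]) blast
  have "norm (f (x + h *\<^sub>R axis j 1) - f x) \<le> \<bar>h\<bar> * (C * 2 ^ N * decay N x)"
    if h: "\<bar>h\<bar> \<le> 1" for x h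
  proof -
    let ?e = "axis j 1 :: real^'d"
    have "norm (f (x + h *\<^sub>R ?e) - f (x + 0 *\<^sub>R ?e)) \<le> (C * 2 ^ N * decay N x) * norm (h - 0)"
    proof (rule differentiable_bound[where S="{-1..1}"])
      fix t :: real assume t: "t \<in> {-1..1}"
      show "((\<lambda>t. f (x + t *\<^sub>R ?e)) has_derivative (\<lambda>s. s *\<^sub>R partial_deriv j f (x + t *\<^sub>R ?e))) (at t within {-1..1})"
        using schwartz_has_vector_derivative[OF f] by (simp add: has_vector_derivative_def)
      have "norm (partial_deriv j f (x + t *\<^sub>R ?e)) \<le> C * decay N (x + t *\<^sub>R ?e)" by (rule C)
      also have "\<dots> \<le> C * ((1 + norm (t *\<^sub>R ?e)) ^ N * decay N x)"
        by (intro mult_left_mono inverse_bracket_shift_le C)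
      also have "\<dots> \<le> C * (2 ^ N * decay N x)"
        using t by (intro mult_left_mono mult_right_mono power_mono C) (auto simp: norm_axis_1)
      finally have "norm (partial_deriv j f (x + t *\<^sub>R ?e)) \<le> C * 2 ^ N * decay N x"
        by (simp add: mult_ac)
      then show "onorm (\<lambda>s. s *\<^sub>R partial_deriv j f (x + t *\<^sub>R ?e)) \<le> C * 2 ^ N * decay N x"
        by (intro onorm_le) (simp add: mult_left_mono mult.commute)
    qed (use h in auto)
    then show ?thesis by (simp add: mult_ac)
  qed
  then show ?thesis using that[of "C * 2 ^ N"] C by simp
qed

text \<open>Integration by parts in the form of difference quotients: translation invariance turns
  the transform of a quotient of step h into (exp(i h \<xi>_j) - 1)/h times the transform of f. Both
  sides of this identity have a limit as h tends to 0.\<close>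

lemma fourier_partial_deriv:
  fixes f :: "real^'d::finite \<Rightarrow> complex"
  assumes f: "schwartz f"
  shows "fourier (partial_deriv j f) \<xi> = \<i> * of_real (\<xi> $ j) * fourier f \<xi>"
proof -
  let ?e = "axis j 1 :: real^'d"
  have [measurable]: "f \<in> borel_measurable borel" "partial_deriv j f \<in> borel_measurable borel"
    using schwartz_continuous[OF f] schwartz_continuous[OF schwartz_partial_deriv[OF f]]
    by (auto intro: borel_measurable_continuous_onI)
  define h where "h n = inverse (real (Suc n))" for n
  have h: "h \<longlonglongrightarrow> 0" "0 < h n" "h n \<le> 1" for n
    unfolding h_def using LIMSEQ_inverse_real_of_nat by (auto simp: inverse_le_1_iff)
  define Q where "Q n x = cis (- (x \<bullet> \<xi>)) * (inverse (h n) *\<^sub>R (f (x + h n *\<^sub>R ?e) - f x))" for n x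
  obtain C where C: "0 \<le> C" "\<And>x t. \<bar>t\<bar> \<le> 1 \<Longrightarrow> norm (f (x + t *\<^sub>R ?e) - f x) \<le> \<bar>t\<bar> * (C * decay (2 * DIM(real^'d)) x)"
    by (rule schwartz_diff_bound[OF f, of j "2 * DIM(real^'d)"]) blast
  have "(\<lambda>n. \<integral>x. Q n x \<partial>lborel) \<longlonglongrightarrow> (LBINT x. cis (- (x \<bullet> \<xi>)) * partial_deriv j f x)"
  proof (rule integral_dominated_convergence)
    show "integrable lborel (\<lambda>x::real^'d. C * decay (2 * DIM(real^'d)) x)"
      by (intro integrable_mult_right integrable_inverse_bracket)
    show "AE x in lborel. norm (Q n x) \<le> C * decay (2 * DIM(real^'d)) x" for n
    proof (intro AE_I2)
      fix x :: "real^'d"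
      have "norm (Q n x) = inverse (h n) * norm (f (x + h n *\<^sub>R ?e) - f x)"
        using h(2)[of n] by (simp add: Q_def norm_mult)
      also have "\<dots> \<le> inverse (h n) * (\<bar>h n\<bar> * (C * decay (2 * DIM(real^'d)) x))"
        using h(2,3)[of n] by (intro mult_left_mono C) auto
      also have "\<dots> = C * decay (2 * DIM(real^'d)) x"
        using h(2)[of n] by simp
      finally show "norm (Q n x) \<le> C * decay (2 * DIM(real^'d)) x" .
    qed
    show "AE x in lborel. (\<lambda>n. Q n x) \<longlonglongrightarrow> cis (- (x \<bullet> \<xi>)) * partial_deriv j f x"
      unfolding Q_def
    proof (intro AE_I2 tendsto_mult tendsto_const)
      fix x :: "real^'d"
      have "((\<lambda>t. f (x + t *\<^sub>R ?e)) has_derivative (\<lambda>t. t *\<^sub>R partial_deriv j f x)) (at 0)"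
        using schwartz_has_vector_derivative[OF f, where x=x and j=j and t=0 and A=UNIV] by (simp add: has_vector_derivative_def)
      then have "(\<lambda>t. norm (f (x + t *\<^sub>R ?e) - f x - t *\<^sub>R partial_deriv j f x) / norm t) \<midarrow>0\<rightarrow> 0"
        by (simp add: has_derivative_at)
      then have "(\<lambda>n. norm (f (x + h n *\<^sub>R ?e) - f x - h n *\<^sub>R partial_deriv j f x) / norm (h n)) \<longlonglongrightarrow> 0"
        by (rule filterlim_compose) (use h in \<open>auto simp: filterlim_at less_imp_neq[symmetric]\<close>)
      moreover have "norm (f (x + h n *\<^sub>R ?e) - f x - h n *\<^sub>R partial_deriv j f x) / norm (h n)
        = norm (inverse (h n) *\<^sub>R (f (x + h n *\<^sub>R ?e) - f x) - partial_deriv j f x)" for n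
      proof -
        have "inverse (h n) *\<^sub>R (f (x + h n *\<^sub>R ?e) - f x) - partial_deriv j f x
          = inverse (h n) *\<^sub>R (f (x + h n *\<^sub>R ?e) - f x - h n *\<^sub>R partial_deriv j f x)"
          using h(2)[of n] by (simp add: scaleR_diff_right)
        then show ?thesis using h(2)[of n] by (simp add: divide_inverse mult.commute)
      qed
      ultimately have "(\<lambda>n. norm (inverse (h n) *\<^sub>R (f (x + h n *\<^sub>R ?e) - f x) - partial_deriv j f x)) \<longlonglongrightarrow> 0"
        by simp
      then show "(\<lambda>n. inverse (h n) *\<^sub>R (f (x + h n *\<^sub>R ?e) - f x)) \<longlonglongrightarrow> partial_deriv j f x"
        using LIM_zero_iff tendsto_norm_zero_iff by blast
    qed
    show "Q n \<in> borel_measurable lborel" for n unfolding Q_def by measurable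
  qed measurable
  moreover have "(\<lambda>n. \<integral>x. Q n x \<partial>lborel) \<longlonglongrightarrow> \<i> * of_real (\<xi> $ j) * fourier f \<xi>"
  proof -
    have eq: "(LBINT x. Q n x) = (inverse (h n) *\<^sub>R (cis (h n * \<xi> $ j) - 1)) * fourier f \<xi>" for n
    proof -
      have i: "integrable lborel (\<lambda>x. cis (- (x \<bullet> \<xi>)) * f x)"
        by (rule Bochner_Integration.integrable_bound[OF schwartz_integrable[OF f]]) (auto simp: norm_mult)
      have sh: "cis (- (x \<bullet> \<xi>)) * f (x + h n *\<^sub>R ?e) = cis (h n * \<xi> $ j) * (cis (- ((h n *\<^sub>R ?e + x) \<bullet> \<xi>)) * f (h n *\<^sub>R ?e + x))" for x
        by (simp add: inner_add_left inner_axis inner_axis' cis_mult mult.assoc[symmetric] add.commute)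
      have i2: "integrable lborel (\<lambda>x. cis (- (x \<bullet> \<xi>)) * f (x + h n *\<^sub>R ?e))"
        using integrable_lborel_translate[OF schwartz_integrable[OF f], of "h n *\<^sub>R ?e"]
        by (rule Bochner_Integration.integrable_bound) (auto simp: norm_mult add.commute)
      have "(LBINT x. Q n x) = inverse (h n) *\<^sub>R (LBINT x. cis (- (x \<bullet> \<xi>)) * f (x + h n *\<^sub>R ?e) - cis (- (x \<bullet> \<xi>)) * f x)"
        unfolding Q_def mult_scaleR_right right_diff_distrib by (rule integral_scaleR_right)
      also have "(LBINT x. cis (- (x \<bullet> \<xi>)) * f (x + h n *\<^sub>R ?e) - cis (- (x \<bullet> \<xi>)) * f x)
        = (LBINT x. cis (- (x \<bullet> \<xi>)) * f (x + h n *\<^sub>R ?e)) - fourier f \<xi>"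
        unfolding fourier_def by (rule Bochner_Integration.integral_diff[OF i2 i])
      also have "(LBINT x. cis (- (x \<bullet> \<xi>)) * f (x + h n *\<^sub>R ?e))
         = cis (h n * \<xi> $ j) * (LBINT x. cis (- ((h n *\<^sub>R ?e + x) \<bullet> \<xi>)) * f (h n *\<^sub>R ?e + x))"
        unfolding sh by (rule integral_mult_right_zero)
      also have "(LBINT x. cis (- ((h n *\<^sub>R ?e + x) \<bullet> \<xi>)) * f (h n *\<^sub>R ?e + x)) = fourier f \<xi>"
        unfolding fourier_def by (rule integral_lborel_translate) measurable
      finally show ?thesis by (simp add: algebra_simps)
    qed
    have "(\<lambda>n. inverse (h n) *\<^sub>R (cis (h n * \<xi> $ j) - 1) - \<i> * of_real (\<xi> $ j)) \<longlonglongrightarrow> 0"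
    proof (rule Lim_null_comparison)
      show "\<forall>\<^sub>F n in sequentially. norm (inverse (h n) *\<^sub>R (cis (h n * \<xi> $ j) - 1) - \<i> * of_real (\<xi> $ j)) \<le> h n * (\<xi> $ j)\<^sup>2"
      proof (intro always_eventually allI)
        fix n
        have "inverse (h n) *\<^sub>R (cis (h n * \<xi> $ j) - 1) - \<i> * of_real (\<xi> $ j)
          = inverse (h n) *\<^sub>R (cis (0 + h n * \<xi> $ j) - cis 0 - \<i> * of_real (h n * \<xi> $ j) * cis 0)"
          using h(2)[of n] by (simp add: scaleR_conv_of_real field_simps)
        then have "norm (inverse (h n) *\<^sub>R (cis (h n * \<xi> $ j) - 1) - \<i> * of_real (\<xi> $ j))
          = inverse (h n) * norm (cis (0 + h n * \<xi> $ j) - cis 0 - \<i> * of_real (h n * \<xi> $ j) * cis 0)"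
          using h(2)[of n] by (simp only: norm_scaleR) simp
        also have "\<dots> \<le> inverse (h n) * ((h n * \<xi> $ j)\<^sup>2 / 2)"
          using h(2)[of n] by (intro mult_left_mono cis_taylor1) auto
        also have "\<dots> = h n * (\<xi> $ j)\<^sup>2 / 2"
          using h(2)[of n] by (simp add: power2_eq_square field_simps)
        also have "\<dots> \<le> h n * (\<xi> $ j)\<^sup>2"
          using mult_nonneg_nonneg[of "h n" "(\<xi> $ j)\<^sup>2"] h(2)[of n] by simp
        finally show "norm (inverse (h n) *\<^sub>R (cis (h n * \<xi> $ j) - 1) - \<i> * of_real (\<xi> $ j)) \<le> h n * (\<xi> $ j)\<^sup>2" .
      qed
      show "(\<lambda>n. h n * (\<xi> $ j)\<^sup>2) \<longlonglongrightarrow> 0" by (auto intro!: tendsto_eq_intros h)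
    qed
    then have "(\<lambda>n. inverse (h n) *\<^sub>R (cis (h n * \<xi> $ j) - 1)) \<longlonglongrightarrow> \<i> * of_real (\<xi> $ j)"
      by (simp add: LIM_zero_iff)
    then show ?thesis unfolding eq by (intro tendsto_mult tendsto_const)
  qed
  ultimately show ?thesis
    unfolding fourier_def by (rule LIMSEQ_unique)
qed

text \<open>One more power of 1 + |\<xi>| is split as 1 + |\<xi>| <= 1 + \<Sum>_j |\<xi>_j|, and
  each factor \<xi>_j is traded for a derivative of f. The induction hypothesis is thus applied to
  the partial derivatives as well, so f is generalised.\<close>

lemma rapid_fourier:
  fixes f :: "real^'d::finite \<Rightarrow> complex"
  assumes f: "schwartz f"
  shows "rapid (fourier f)"
proof -
  have "\<exists>C. \<forall>\<xi>. (1 + norm \<xi>) ^ N * norm (fourier f \<xi>) \<le> C" for N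
    using f
  proof (induction N arbitrary: f)
    case 0
    have "norm (fourier f \<xi>) \<le> (LBINT x. norm (f x))" for \<xi>
      unfolding fourier_def
      by (rule norm_integral_le) (auto simp: norm_mult intro!: integrable_norm schwartz_integrable 0)
    then show ?case by auto
  next
    case (Suc N)
    obtain C0 where C0: "\<And>\<xi>. (1 + norm \<xi>) ^ N * norm (fourier f \<xi>) \<le> C0"
      using Suc.IH[OF Suc.prems] by blast
    have "\<exists>C. \<forall>\<xi>. (1 + norm \<xi>) ^ N * norm (fourier (partial_deriv j f) \<xi>) \<le> C" for j
      by (rule Suc.IH[OF schwartz_partial_deriv[OF Suc.prems]])
    then obtain C where C: "\<And>j \<xi>. (1 + norm \<xi>) ^ N * norm (fourier (partial_deriv j f) \<xi>) \<le> C j"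
      by metis
    have "(1 + norm \<xi>) ^ Suc N * norm (fourier f \<xi>) \<le> C0 + (\<Sum>j\<in>UNIV. C j)" for \<xi>
    proof -
      have "(1 + norm \<xi>) ^ Suc N * norm (fourier f \<xi>) = (1 + norm \<xi>) ^ N * norm (fourier f \<xi>) + norm \<xi> * ((1 + norm \<xi>) ^ N * norm (fourier f \<xi>))"
        by (simp add: algebra_simps)
      also have "\<dots> \<le> (1 + norm \<xi>) ^ N * norm (fourier f \<xi>) + (\<Sum>j\<in>UNIV. \<bar>\<xi> $ j\<bar>) * ((1 + norm \<xi>) ^ N * norm (fourier f \<xi>))"
        by (intro add_left_mono mult_right_mono norm_le_l1_cart) auto
      also have "\<dots> = (1 + norm \<xi>) ^ N * norm (fourier f \<xi>) + (\<Sum>j\<in>UNIV. (1 + norm \<xi>) ^ N * norm (fourier (partial_deriv j f) \<xi>))"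
        by (simp add: fourier_partial_deriv[OF Suc.prems] norm_mult sum_distrib_right sum_distrib_left mult_ac)
      also have "\<dots> \<le> C0 + (\<Sum>j\<in>UNIV. C j)"
        by (intro add_mono sum_mono C0 C)
      finally show ?thesis .
    qed
    then show ?case by blast
  qed
  then show ?thesis
    unfolding rapid_def using fourier_continuous[OF schwartz_integrable[OF f]] by simp
qed

section \<open>The maximal estimate on the Fourier side\<close>

lemma ennpowr_ennreal: "0 \<le> r \<Longrightarrow> ennpowr (ennreal r) p = ennreal (r powr p)"
  by (simp add: ennpowr_def)

lemma ennpowr_le_iff:
  assumes "0 < p"
  shows "ennpowr a (1 / p) \<le> b \<longleftrightarrow> a \<le> ennpowr b p"
proof (cases a; cases b)
  fix r s assume a: "0 \<le> r" "a = ennreal r" and b: "0 \<le> s" "b = ennreal s"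
  have "r powr (1 / p) \<le> s \<longleftrightarrow> r \<le> s powr p"
  proof
    assume "r powr (1 / p) \<le> s"
    then have "(r powr (1 / p)) powr p \<le> s powr p" using assms by (intro powr_mono2) auto
    then show "r \<le> s powr p" using assms a by (simp add: powr_powr)
  next
    assume "r \<le> s powr p"
    then have "r powr (1 / p) \<le> (s powr p) powr (1 / p)" using assms a by (intro powr_mono2) auto
    then show "r powr (1 / p) \<le> s" using assms b by (simp add: powr_powr)
  qed
  then show ?thesis using a b by (simp add: ennpowr_ennreal)
qed (auto simp: ennpowr_def top_unique)

text \<open>By \<open>ennpowr_le_iff\<close> the powers p and 1/p are adjoint to each other as
  monotone maps, and a map with an upper adjoint commutes with suprema.\<close>

lemma ennpowr_SUP:
  assumes "0 < p"
  shows "ennpowr (SUP i\<in>I. f i) p = (SUP i\<in>I. ennpowr (f i) p)"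
proof -
  have iff: "ennpowr a p \<le> b \<longleftrightarrow> a \<le> ennpowr b (1 / p)" for a b
    using ennpowr_le_iff[of "1 / p" a b] assms by simp
  have "ennpowr (SUP i\<in>I. f i) p \<le> b \<longleftrightarrow> (SUP i\<in>I. ennpowr (f i) p) \<le> b" for b
    by (simp only: iff SUP_le_iff)
  then show ?thesis by (meson antisym order_refl)
qed

text \<open>The power q sits inside the supremum, so the L^q norm of the maximal function becomes a
  plain integral. The argument is the transform of the data, which admits data outside the Schwartz
  class.\<close>

definition wave_sup :: "real \<Rightarrow> real set \<Rightarrow> ('a::euclidean_space \<Rightarrow> complex) \<Rightarrow> 'a \<Rightarrow> ennreal" where
  "wave_sup q I G x = (SUP t\<in>I. ennreal (norm (ift (phase t G) x) powr q))"

text \<open>By Plancherel this is (2 pi)^d times the square of the H^s norm of \<open>ift G\<close>;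
  hence the power q / 2 in \<open>sup_bound\<close>.\<close>

definition energy :: "real \<Rightarrow> ('a::euclidean_space \<Rightarrow> complex) \<Rightarrow> real" where
  "energy s G = (LBINT \<xi>. (1 + (norm \<xi>)\<^sup>2) powr s * (norm (G \<xi>))\<^sup>2)"

abbreviation sup_bound :: "real \<Rightarrow> real \<Rightarrow> 'a::euclidean_space set \<Rightarrow> real set \<Rightarrow> real \<Rightarrow> ('a \<Rightarrow> complex) \<Rightarrow> bool" where
  "sup_bound q s A I K G \<equiv>
    (\<integral>\<^sup>+x\<in>A. wave_sup q I G x \<partial>lborel) \<le> ennreal (K * energy s G powr (q / 2))"

lemma energy_nonneg: "0 \<le> energy s G"
  by (simp add: energy_def)

lemma wave_eq_ift: "wave t f = ift (phase t (fourier f))"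
  by (rule ext) (simp add: wave_def ift_def cis_mult[symmetric] mult.assoc)

lemma wave_maximal_powr:
  "0 < q \<Longrightarrow> ennpowr (wave_maximal I f x) q = wave_sup q I (fourier f) x"
  by (simp add: wave_maximal_def wave_sup_def ennpowr_SUP ennpowr_ennreal wave_eq_ift)

lemma sobolev_norm_eq:
  fixes f :: "real^'d::finite \<Rightarrow> complex"
  assumes f: "schwartz f" and s: "0 \<le> s"
  shows "sobolev_norm s f = ennreal (sqrt ((1 / (2 * pi) ^ CARD('d)) * energy s (fourier f)))"
proof -
  let ?G = "\<lambda>\<xi>. of_real ((1 + (norm \<xi>)\<^sup>2) powr (s / 2)) * fourier f \<xi>"
  have b: "bessel s f = ift ?G"
    by (rule ext) (simp add: bessel_def ift_def mult.assoc)
  have "(\<integral>\<^sup>+x\<in>UNIV. ennpowr (ennreal (norm (bessel s f x))) 2 \<partial>lborel) = (\<integral>\<^sup>+x. ennreal ((norm (ift ?G x))\<^sup>2) \<partial>lborel)"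
    by (simp add: ennpowr_ennreal b)
  also have "\<dots> = ennreal ((1 / (2 * pi) ^ CARD('d)) * (LBINT \<xi>. (norm (?G \<xi>))\<^sup>2))"
    by (rule plancherel[OF rapid_bessel[OF rapid_fourier[OF f] s]])
  also have "(LBINT \<xi>. (norm (?G \<xi>))\<^sup>2) = energy s (fourier f)"
    unfolding energy_def
    by (rule integral_ext)
      (simp add: norm_mult power_mult_distrib powr_power del: powr_half_sqrt, simp add: power2_eq_square flip: powr_add)
  finally show ?thesis
    by (simp add: sobolev_norm_def Lp_norm_def ennpowr_ennreal energy_nonneg powr_half_sqrt)
qed

lemma Lp_wave_maximal_le_iff:
  fixes f :: "real^'d::finite \<Rightarrow> complex"
  assumes f: "schwartz f" and s: "0 \<le> s" and q: "0 < q" and C: "0 \<le> C"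
  shows "Lp_norm q A (wave_maximal I f) \<le> ennreal C * sobolev_norm s f \<longleftrightarrow>
    (\<integral>\<^sup>+x\<in>A. wave_sup q I (fourier f) x \<partial>lborel)
      \<le> ennreal ((C powr q * (1 / (2 * pi) ^ CARD('d)) powr (q / 2)) * energy s (fourier f) powr (q / 2))"
proof -
  let ?c = "1 / (2 * pi) ^ CARD('d) :: real"
  have "(C * sqrt (?c * energy s (fourier f))) powr q = C powr q * ((?c * energy s (fourier f)) powr (1 / 2)) powr q"
    using C by (simp add: powr_mult powr_half_sqrt energy_nonneg)
  also have "\<dots> = C powr q * (?c * energy s (fourier f)) powr (q / 2)"
    by (simp only: powr_powr) simp
  also have "\<dots> = (C powr q * ?c powr (q / 2)) * energy s (fourier f) powr (q / 2)"
    by (subst powr_mult) (auto simp: energy_nonneg)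
  finally have "ennpowr (ennreal C * sobolev_norm s f) q = ennreal ((C powr q * ?c powr (q / 2)) * energy s (fourier f) powr (q / 2))"
    using C by (simp add: sobolev_norm_eq[OF f s] ennreal_mult[symmetric] energy_nonneg ennpowr_ennreal)
  then show ?thesis
    unfolding Lp_norm_def ennpowr_le_iff[OF q] using q by (simp add: wave_maximal_powr)
qed

lemma maximal_estimate_iff:
  fixes s q :: real
  assumes s: "0 \<le> s" and q: "0 < q"
  shows "(\<exists>C::real. \<forall>f :: real^'d::finite \<Rightarrow> complex. schwartz f \<longrightarrow>
      Lp_norm q A (wave_maximal I f) \<le> ennreal C * sobolev_norm s f) \<longleftrightarrow>
    (\<exists>K\<ge>0. \<forall>f :: real^'d \<Rightarrow> complex. schwartz f \<longrightarrow>
      sup_bound q s A I K (fourier f))"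
    (is "?L \<longleftrightarrow> ?R")
proof
  let ?c = "(1 / (2 * pi) ^ CARD('d)) powr (q / 2) :: real"
  have c: "0 < ?c" by simp
  {
    assume ?L
    then obtain C where C: "\<And>f :: real^'d \<Rightarrow> complex. schwartz f \<Longrightarrow>
        Lp_norm q A (wave_maximal I f) \<le> ennreal C * sobolev_norm s f" by blast
    show ?R
    proof (intro exI[of _ "max C 0 powr q * ?c"] conjI allI impI)
      fix f :: "real^'d \<Rightarrow> complex" assume f: "schwartz f"
      \<comment> \<open>\<open>ennreal\<close> sends a negative C to 0, so C can be replaced by
        \<open>max C 0\<close>, whose real power behaves well.\<close>
      have "Lp_norm q A (wave_maximal I f) \<le> ennreal (max C 0) * sobolev_norm s f"
        using C[OF f] by (auto simp: max_def ennreal_neg)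
      then show "(\<integral>\<^sup>+x\<in>A. wave_sup q I (fourier f) x \<partial>lborel) \<le> ennreal (max C 0 powr q * ?c * energy s (fourier f) powr (q / 2))"
        by (subst (asm) Lp_wave_maximal_le_iff[OF f s q]) auto
    qed auto
  }
  {
    assume ?R
    then obtain K where K: "0 \<le> K" "\<And>f :: real^'d \<Rightarrow> complex. schwartz f \<Longrightarrow>
      sup_bound q s A I K (fourier f)" by blast
    have eq: "((K / ?c) powr (1 / q)) powr q * ?c = K"
      using q K(1) c by (simp add: powr_powr)
    show ?L
    proof (intro exI[of _ "(K / ?c) powr (1 / q)"] allI impI)
      fix f :: "real^'d \<Rightarrow> complex" assume f: "schwartz f"
      show "Lp_norm q A (wave_maximal I f) \<le> ennreal ((K / ?c) powr (1 / q)) * sobolev_norm s f"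
        by (subst Lp_wave_maximal_le_iff[OF f s q powr_ge_zero]) (use K(2)[OF f] in \<open>simp only: eq\<close>)
    qed
  }
qed

text \<open>A supremum of continuous functions is lower semicontinuous: its strict superlevel sets
  are unions of open sets. This is how uncountable suprema over time remain measurable.\<close>

lemma borel_measurable_SUP_continuous:
  fixes f :: "'i \<Rightarrow> 'a::topological_space \<Rightarrow> ennreal"
  assumes "\<And>i. i \<in> I \<Longrightarrow> continuous_on UNIV (f i)"
  shows "(\<lambda>x. SUP i\<in>I. f i x) \<in> borel_measurable borel"
proof (rule borel_measurableI_greater)
  fix y
  have "{x \<in> space borel. y < (SUP i\<in>I. f i x)} = (\<Union>i\<in>I. {x. y < f i x})"
    by (auto simp: less_SUP_iff)
  moreover have "open (\<Union>i\<in>I. {x. y < f i x})"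
    using assms by (intro open_UN ballI open_Collect_less) auto
  ultimately show "{x \<in> space borel. y < (SUP i\<in>I. f i x)} \<in> sets borel" by simp
qed

lemma continuous_on_ift_norm_powr:
  fixes G :: "'a::euclidean_space \<Rightarrow> complex"
  assumes "rapid G" "0 < q"
  shows "continuous_on UNIV (\<lambda>x. ennreal (norm (ift G x) powr q))"
  using assms by (intro continuous_on_ennreal continuous_on_powr' continuous_intros ift_continuous) auto

lemma borel_measurable_wave_sup:
  assumes "rapid G" "0 < q"
  shows "wave_sup q I G \<in> borel_measurable borel"
  unfolding wave_sup_def
  by (intro borel_measurable_SUP_continuous continuous_on_ift_norm_powr rapid_cis assms)

text \<open>After squaring, 2 \<lceil>s\<rceil> of the powers of decay cancel the Sobolev weight,
  and \<open>2 * DIM('a)\<close> are left for integrability.\<close>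

lemma energy_integrand_bound:
  fixes \<xi> :: "'a::euclidean_space"
  assumes s: "0 \<le> s" and le: "norm z \<le> C * decay (nat \<lceil>s\<rceil> + DIM('a)) \<xi>"
  shows "(1 + (norm \<xi>)\<^sup>2) powr s * (norm z)\<^sup>2 \<le> C\<^sup>2 * decay (2 * DIM('a)) \<xi>"
proof -
  have "(1 + (norm \<xi>)\<^sup>2) powr s \<le> (1 + norm \<xi>) ^ (2 * nat \<lceil>s\<rceil>)"
    using bracket_powr_le[of "2 * s" "2 * nat \<lceil>s\<rceil>" \<xi>] s real_nat_ceiling_ge[of s] by simp
  then have "(1 + (norm \<xi>)\<^sup>2) powr s * (norm z)\<^sup>2
    \<le> (1 + norm \<xi>) ^ (2 * nat \<lceil>s\<rceil>) * (C * decay (nat \<lceil>s\<rceil> + DIM('a)) \<xi>)\<^sup>2"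
    by (intro mult_mono power_mono le) auto
  also have "\<dots> = C\<^sup>2 * decay (2 * DIM('a)) \<xi>"
  proof -
    have "b ^ (2 * k) * (C * inverse (b ^ (k + m)))\<^sup>2 = C\<^sup>2 * inverse (b ^ (2 * m))" if "0 < b" for b :: real and k m
    proof -
      have "(b ^ (k + m))\<^sup>2 = b ^ (2 * k) * b ^ (2 * m)"
        by (simp only: power_mult[symmetric] power_add[symmetric]) (simp add: algebra_simps)
      then show ?thesis using that by (simp add: power_mult_distrib power_inverse)
    qed
    from this[of "1 + norm \<xi>"] show ?thesis by (simp add: add_pos_nonneg)
  qed
  finally show ?thesis .
qed

lemma energy_gauss_conv_tendsto:
  fixes G :: "'a::euclidean_space \<Rightarrow> complex"
  assumes G: "rapid G" and s: "0 \<le> s" and d: "d \<longlonglongrightarrow> 0" "\<And>n. 0 \<le> d n" "\<And>n. d n \<le> 1"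
  shows "(\<lambda>n. energy s (gauss_conv (d n) G)) \<longlonglongrightarrow> energy s G"
proof -
  note [measurable] = rapid_measurable[OF G]
  have [measurable]: "gauss_conv (d n) G \<in> borel_measurable borel" for n
    by (intro rapid_measurable rapid_gauss_conv G d)
  obtain C where C: "\<And>\<delta> \<xi>. 0 \<le> \<delta> \<Longrightarrow> \<delta> \<le> 1 \<Longrightarrow> norm (gauss_conv \<delta> G \<xi>) \<le> C * decay (nat \<lceil>s\<rceil> + DIM('a)) \<xi>"
    by (rule gauss_conv_bound[OF G, of "nat \<lceil>s\<rceil> + DIM('a)"]) blast
  show ?thesis
    unfolding energy_def
  proof (rule integral_dominated_convergence)
    show "integrable lborel (\<lambda>\<xi>::'a. C\<^sup>2 * decay (2 * DIM('a)) \<xi>)"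
      by (intro integrable_mult_right integrable_inverse_bracket)
    show "AE \<xi> in lborel. norm ((1 + (norm \<xi>)\<^sup>2) powr s * (norm (gauss_conv (d n) G \<xi>))\<^sup>2) \<le> C\<^sup>2 * decay (2 * DIM('a)) \<xi>" for n
      using energy_integrand_bound[OF s C[OF d(2,3)]] by (intro AE_I2) (simp add: abs_mult)
    show "AE \<xi> in lborel. (\<lambda>n. (1 + (norm \<xi>)\<^sup>2) powr s * (norm (gauss_conv (d n) G \<xi>))\<^sup>2) \<longlonglongrightarrow> (1 + (norm \<xi>)\<^sup>2) powr s * (norm (G \<xi>))\<^sup>2"
      by (intro AE_I2 tendsto_intros gauss_conv_tendsto G d)
  qed measurable
qed

lemma ift_gauss_conv_tendsto:
  fixes G :: "'a::euclidean_space \<Rightarrow> complex"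
  assumes G: "rapid G" and d: "d \<longlonglongrightarrow> 0" "\<And>n. 0 \<le> d n" "\<And>n. d n \<le> 1"
  shows "(\<lambda>n. ift (phase t (gauss_conv (d n) G)) x) \<longlonglongrightarrow> ift (phase t G) x"
proof -
  note [measurable] = rapid_measurable[OF G]
  have [measurable]: "gauss_conv (d n) G \<in> borel_measurable borel" for n
    by (intro rapid_measurable rapid_gauss_conv G d)
  obtain C where C: "\<And>\<delta> \<xi>. 0 \<le> \<delta> \<Longrightarrow> \<delta> \<le> 1 \<Longrightarrow> norm (gauss_conv \<delta> G \<xi>) \<le> C * decay (2 * DIM('a)) \<xi>"
    by (rule gauss_conv_bound[OF G, of "2 * DIM('a)"]) blast
  show ?thesis
    unfolding ift_def
  proof (intro tendsto_scaleR tendsto_const integral_dominated_convergence)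
    show "integrable lborel (\<lambda>\<xi>::'a. C * decay (2 * DIM('a)) \<xi>)"
      by (intro integrable_mult_right integrable_inverse_bracket)
    show "AE \<xi> in lborel. norm (cis (x \<bullet> \<xi>) * (cis (t * norm \<xi>) * gauss_conv (d n) G \<xi>)) \<le> C * decay (2 * DIM('a)) \<xi>" for n
      using C[OF d(2,3)] by (intro AE_I2) (simp add: norm_mult)
    show "AE \<xi> in lborel. (\<lambda>n. cis (x \<bullet> \<xi>) * (cis (t * norm \<xi>) * gauss_conv (d n) G \<xi>)) \<longlonglongrightarrow> cis (x \<bullet> \<xi>) * (cis (t * norm \<xi>) * G \<xi>)"
      by (intro AE_I2 tendsto_intros gauss_conv_tendsto G d)
  qed measurable
qed

text \<open>The estimate is stable under Gaussian regularisation: the maximal function is a supremum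
  of quantities that converge pointwise, so Fatou's lemma bounds the left side, and the energies on
  the right converge.\<close>

lemma maximal_estimate_rapid:
  fixes G :: "real^'d::finite \<Rightarrow> complex"
  assumes est: "\<And>f :: real^'d \<Rightarrow> complex. schwartz f \<Longrightarrow>
      sup_bound q s A I K (fourier f)"
    and A: "A \<in> sets borel" and s: "0 \<le> s" and q: "0 < q" and G: "rapid G"
  shows "sup_bound q s A I K G"
proof -
  note [measurable] = A
  define d where "d n = inverse (real (Suc n))" for n
  have d: "d \<longlonglongrightarrow> 0" "0 < d n" "0 \<le> d n" "d n \<le> 1" for n
    unfolding d_def using LIMSEQ_inverse_real_of_nat by (auto simp: inverse_le_1_iff)
  let ?G = "\<lambda>n. gauss_conv (d n) G"
  have rG: "rapid (?G n)" for n by (intro rapid_gauss_conv G d)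
  have [measurable]: "wave_sup q I (?G n) \<in> borel_measurable borel" for n
    by (intro borel_measurable_wave_sup rG q)
  have le: "(\<integral>\<^sup>+x\<in>A. wave_sup q I (?G n) x \<partial>lborel) \<le> ennreal (K * energy s (?G n) powr (q / 2))" for n
  proof -
    have "d n \<noteq> 0" using d(2)[of n] by simp
    from est[OF schwartz_gauss_ift[OF G this]] show ?thesis
      unfolding fourier_gauss_ift[OF G d(2)] .
  qed
  have "(\<integral>\<^sup>+x\<in>A. wave_sup q I G x \<partial>lborel) \<le> (\<integral>\<^sup>+x. liminf (\<lambda>n. wave_sup q I (?G n) x * indicator A x) \<partial>lborel)"
  proof (intro nn_integral_mono)
    fix x
    have "wave_sup q I G x \<le> liminf (\<lambda>n. wave_sup q I (?G n) x)"
      unfolding wave_sup_def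
    proof (rule SUP_least)
      fix t assume t: "t \<in> I"
      have "(\<lambda>n. ennreal (norm (ift (phase t (?G n)) x) powr q))
         \<longlonglongrightarrow> ennreal (norm (ift (phase t G) x) powr q)"
        using q by (intro tendsto_ennrealI tendsto_powr' tendsto_norm tendsto_const ift_gauss_conv_tendsto G d) auto
      then have "ennreal (norm (ift (phase t G) x) powr q)
        = liminf (\<lambda>n. ennreal (norm (ift (phase t (?G n)) x) powr q))"
        by (rule lim_imp_Liminf[OF sequentially_bot, symmetric])
      also have "\<dots> \<le> liminf (\<lambda>n. SUP t\<in>I. ennreal (norm (ift (phase t (?G n)) x) powr q))"
        by (intro Liminf_mono always_eventually allI SUP_upper t)
      finally show "ennreal (norm (ift (phase t G) x) powr q)
        \<le> liminf (\<lambda>n. SUP t\<in>I. ennreal (norm (ift (phase t (?G n)) x) powr q))" .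
    qed
    then show "wave_sup q I G x * indicator A x \<le> liminf (\<lambda>n. wave_sup q I (?G n) x * indicator A x)"
      by (simp split: split_indicator)
  qed
  also have "\<dots> \<le> liminf (\<lambda>n. \<integral>\<^sup>+x\<in>A. wave_sup q I (?G n) x \<partial>lborel)"
    by (rule nn_integral_liminf) measurable
  also have "\<dots> \<le> liminf (\<lambda>n. ennreal (K * energy s (?G n) powr (q / 2)))"
    by (intro Liminf_mono always_eventually allI le)
  also have "\<dots> = ennreal (K * energy s G powr (q / 2))"
  proof (intro lim_imp_Liminf tendsto_ennrealI tendsto_mult tendsto_const tendsto_powr')
    show "(\<lambda>n. energy s (?G n)) \<longlonglongrightarrow> energy s G"
      by (intro energy_gauss_conv_tendsto G s d)
    \<comment> \<open>The limit energy may be 0; there \<open>powr\<close> is still continuous along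
      nonnegative bases because the exponent q / 2 is positive.\<close>
    show "energy s G \<noteq> 0 \<or> 0 < q / 2 \<and> (\<forall>\<^sub>F n in sequentially. 0 \<le> energy s (?G n))"
      using q by (simp add: energy_nonneg)
  qed simp_all
  finally show ?thesis .
qed

section \<open>Local smoothing\<close>

text \<open>Cauchy-Schwarz against v: moving by h along e increases the component in the direction
  of v by h (e \<bullet> v)/|v|, which is at least h / c on the cone.\<close>

lemma norm_add_scaled_ge:
  fixes v e :: "'a::real_inner"
  assumes e: "norm e = 1" and c: "1 \<le> c" and v: "norm v \<le> c * (e \<bullet> v)" and h: "0 \<le> h"
  shows "norm v + h / c \<le> norm (v + h *\<^sub>R e)"
proof (cases "v = 0")
  case True
  then show ?thesis using e c h by (simp add: divide_le_eq mult_le_cancel_left1)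
next
  case False
  have "norm v * (norm v + h / c) \<le> norm v * norm v + h * (e \<bullet> v)"
    using v c h mult_left_mono[OF v h] by (simp add: algebra_simps divide_le_eq)
  also have "\<dots> = v \<bullet> (v + h *\<^sub>R e)"
    by (simp add: inner_add_right inner_commute dot_square_norm power2_eq_square)
  also have "\<dots> \<le> norm v * norm (v + h *\<^sub>R e)"
    by (rule norm_cauchy_schwarz)
  finally show ?thesis using False by simp
qed

text \<open>On the cone \<open>norm v \<le> c * (e \<bullet> v)\<close> the map \<open>u \<mapsto> norm (x + u *\<^sub>R e)\<close> expands
  distances by at least \<open>1 / c\<close>, so it can be compared with an affine map through the point at
  which it is closest to \<open>r\<close>.\<close>

lemma nn_integral_cone_line_le:
  fixes x e :: "'a::euclidean_space" and g :: "real \<Rightarrow> real"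
  assumes e: "norm e = 1" and c: "1 \<le> c"
    and g: "\<And>u v. \<bar>u\<bar> \<le> \<bar>v\<bar> \<Longrightarrow> g v \<le> g u" and g_nonneg: "\<And>v. 0 \<le> g v"
    and [measurable]: "g \<in> borel_measurable borel"
  shows "(\<integral>\<^sup>+u\<in>{0..1}. indicator {v. norm v \<le> c * (e \<bullet> v)} (x + u *\<^sub>R e) * ennreal (g (r - norm (x + u *\<^sub>R e))) \<partial>lborel)
    \<le> ennreal (2 * c) * (\<integral>\<^sup>+v. ennreal (g v) \<partial>lborel)"
proof -
  define T where "T = {u \<in> {0..1}. norm (x + u *\<^sub>R e) \<le> c * (e \<bullet> (x + u *\<^sub>R e))}"
  let ?n = "\<lambda>u. norm (x + u *\<^sub>R e)"
  have expand: "\<bar>u - v\<bar> / c \<le> \<bar>?n u - ?n v\<bar>" if "u \<in> T" "v \<in> T" for u v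
  proof -
    have *: "?n u + (v - u) / c \<le> ?n v" if "u \<in> T" "u \<le> v" for u v
      using norm_add_scaled_ge[OF e c, of "x + u *\<^sub>R e" "v - u"] that
      by (simp add: T_def scaleR_diff_left)
    show ?thesis using *[OF that(1), of v] *[OF that(2), of u]
      by (cases "u \<le> v") (auto simp: abs_if diff_divide_distrib split: if_splits)
  qed
  show ?thesis
  proof (cases "T = {}")
    case True
    then have "indicator {v. norm v \<le> c * (e \<bullet> v)} (x + u *\<^sub>R e) * ennreal (g (r - ?n u)) * indicator {0..1} u = 0" for u
      by (auto simp: T_def split: split_indicator)
    then show ?thesis by (simp only:) simp
  next
    case False
    have "closed T"
      unfolding T_def Collect_conj_eq Collect_mem_eq
      by (intro closed_Int closed_Collect_le continuous_intros)
    then have "compact ({0..1} \<inter> T)" by (intro compact_Int_closed compact_Icc)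
    moreover have "{0..1} \<inter> T = T" by (auto simp: T_def)
    ultimately have "compact T" by simp
    then obtain u0 where u0: "u0 \<in> T" "\<And>u. u \<in> T \<Longrightarrow> \<bar>r - ?n u0\<bar> \<le> \<bar>r - ?n u\<bar>"
    proof -
      have "continuous_on T (\<lambda>u. \<bar>r - ?n u\<bar>)" by (intro continuous_intros)
      from continuous_attains_inf[OF \<open>compact T\<close> False this] show thesis using that by blast
    qed
    \<comment> \<open>As u0 is at least as close to r as u is, the triangle inequality through r
      costs a factor 2; hence the slope 1/(2c) of the comparison map.\<close>
    have "g (r - ?n u) \<le> g (- (u0 / (2 * c)) + 1 / (2 * c) * u)" if u: "u \<in> T" for u
    proof (rule g)
      have "\<bar>u - u0\<bar> / c \<le> \<bar>?n u - ?n u0\<bar>" by (rule expand[OF u u0(1)])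
      also have "\<dots> \<le> \<bar>r - ?n u\<bar> + \<bar>r - ?n u0\<bar>" by linarith
      also have "\<dots> \<le> 2 * \<bar>r - ?n u\<bar>" using u0(2)[OF u] by simp
      finally have "\<bar>u - u0\<bar> / (2 * c) \<le> \<bar>r - ?n u\<bar>" using c by (simp add: field_simps)
      moreover have "- (u0 / (2 * c)) + 1 / (2 * c) * u = (u - u0) / (2 * c)" using c by (simp add: field_simps)
      ultimately show "\<bar>- (u0 / (2 * c)) + 1 / (2 * c) * u\<bar> \<le> \<bar>r - ?n u\<bar>" using c by (simp add: abs_divide)
    qed
    then have "(\<integral>\<^sup>+u\<in>{0..1}. indicator {v. norm v \<le> c * (e \<bullet> v)} (x + u *\<^sub>R e) * ennreal (g (r - ?n u)) \<partial>lborel)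
      \<le> (\<integral>\<^sup>+u. ennreal (g (- (u0 / (2 * c)) + 1 / (2 * c) * u)) \<partial>lborel)"
      by (intro nn_integral_mono) (auto simp: T_def ennreal_leI split: split_indicator)
    also have "\<dots> = ennreal (2 * c) * (\<integral>\<^sup>+v. ennreal (g v) \<partial>lborel)"
    proof -
      have "(\<integral>\<^sup>+v. ennreal (g v) \<partial>lborel) = ennreal \<bar>1 / (2 * c)\<bar> * (\<integral>\<^sup>+u. ennreal (g (- (u0 / (2 * c)) + 1 / (2 * c) * u)) \<partial>lborel)"
        by (rule nn_integral_real_affine) (use c in auto)
      then show ?thesis
        using c by (simp add: mult.assoc[symmetric] ennreal_mult[symmetric])
    qed
    finally show ?thesis .
  qed
qed

text \<open>Taking g concentrated near 0, this says that a weighted shell has mass comparable to its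
  thickness, for all radii and centres. Space is covered by finitely many cones; in each cone the
  integral is averaged over unit translations along the axis, which changes the weight by a bounded
  factor only, and the estimate on lines applies to the inner integral.\<close>

lemma shell_bound:
  obtains C where "0 \<le> C"
    "\<And>(g :: real \<Rightarrow> real) r (\<xi>::'a::euclidean_space). \<lbrakk>\<And>u v. \<bar>u\<bar> \<le> \<bar>v\<bar> \<Longrightarrow> g v \<le> g u; \<And>v. 0 \<le> g v; g \<in> borel_measurable borel\<rbrakk> \<Longrightarrow>
      (\<integral>\<^sup>+\<eta>. ennreal (decay (2 * DIM('a)) (\<xi> - \<eta>)) * ennreal (g (r - norm \<eta>)) \<partial>lborel)
      \<le> ennreal C * (\<integral>\<^sup>+v. ennreal (g v) \<partial>lborel)"
proof -
  define w where "w = (\<lambda>z::'a. decay (2 * DIM('a)) z)"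
  have [measurable]: "w \<in> borel_measurable borel" unfolding w_def by measurable
  have w_nonneg: "0 \<le> w z" for z by (simp add: w_def)
  define W where "W = (LBINT z. w z)"
  have W: "(\<integral>\<^sup>+z. ennreal (w z) \<partial>lborel) = ennreal W"
    unfolding W_def using integrable_inverse_bracket[where 'a='a] w_nonneg
    by (intro nn_integral_eq_integral) (auto simp: w_def)
  have W_nonneg: "0 \<le> W" unfolding W_def by (simp add: w_nonneg)
  define E where "E = (Basis :: 'a set) \<union> uminus ` Basis"
  have E: "finite E" "\<And>e. e \<in> E \<Longrightarrow> norm e = 1" by (auto simp: E_def)
  \<comment> \<open>Some coordinate of v is at least |v| / d in absolute value, because the sum of
    the absolute coordinates is at least |v|. So the cones of aperture c = d about the signed basis
    vectors cover the space.\<close>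
  define c where "c = real DIM('a)"
  have c: "1 \<le> c" using DIM_positive[where 'a='a] by (simp add: c_def Suc_le_eq)
  define S where "S e = {v::'a. norm v \<le> c * (e \<bullet> v)}" for e
  have [measurable]: "S e \<in> sets borel" for e
    unfolding S_def by measurable
  have cover: "\<exists>e\<in>E. v \<in> S e" for v
  proof (rule ccontr)
    assume "\<not> ?thesis"
    then have n: "\<And>e. e \<in> E \<Longrightarrow> c * (e \<bullet> v) < norm v" by (auto simp: S_def not_le)
    have "c * \<bar>v \<bullet> b\<bar> < norm v" if "b \<in> Basis" for b
      using n[of b] n[of "- b"] that by (auto simp: E_def abs_if inner_commute)
    then have "(\<Sum>b\<in>(Basis::'a set). c * \<bar>v \<bullet> b\<bar>) < (\<Sum>b\<in>(Basis::'a set). norm v)"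
      by (intro sum_strict_mono) auto
    moreover have "c * norm v \<le> (\<Sum>b\<in>(Basis::'a set). c * \<bar>v \<bullet> b\<bar>)"
      unfolding sum_distrib_left[symmetric] using c by (intro mult_left_mono norm_le_l1) auto
    ultimately show False by (simp add: c_def)
  qed
  define C where "C = (\<Sum>e\<in>E. 2 ^ (2 * DIM('a)) * W * (2 * c))"
  show ?thesis
  proof (rule that)
    show "0 \<le> C" unfolding C_def using W_nonneg c by (intro sum_nonneg mult_nonneg_nonneg) auto
    fix g :: "real \<Rightarrow> real" and r and \<xi> :: 'a
    assume g: "\<And>u v. \<bar>u\<bar> \<le> \<bar>v\<bar> \<Longrightarrow> g v \<le> g u" "\<And>v. 0 \<le> g v" and [measurable]: "g \<in> borel_measurable borel"
    let ?I = "\<integral>\<^sup>+v. ennreal (g v) \<partial>lborel"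
    have one: "(\<integral>\<^sup>+\<eta>. indicator (S e) \<eta> * (ennreal (w (\<xi> - \<eta>)) * ennreal (g (r - norm \<eta>))) \<partial>lborel)
      \<le> ennreal (2 ^ (2 * DIM('a)) * W * (2 * c)) * ?I" if e: "e \<in> E" for e
    proof -
      \<comment> \<open>By translation invariance the integral of \<open>?F\<close> equals its
        average over shifts by u e with 0 <= u <= 1. Shifts of length at most 1 alter the weight by
        a factor of at most 2^(2d).\<close>
      let ?F = "\<lambda>\<eta>. indicator (S e) \<eta> * (ennreal (w (\<xi> - \<eta>)) * ennreal (g (r - norm \<eta>)))"
      have "(\<integral>\<^sup>+\<eta>. ?F \<eta> \<partial>lborel) = (\<integral>\<^sup>+u\<in>{0..1::real}. (\<integral>\<^sup>+\<eta>. ?F \<eta> \<partial>lborel) \<partial>lborel)"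
        by (simp add: nn_integral_cmult_indicator)
      also have "\<dots> = (\<integral>\<^sup>+u\<in>{0..1::real}. (\<integral>\<^sup>+\<eta>. ?F (u *\<^sub>R e + \<eta>) \<partial>lborel) \<partial>lborel)"
        by (subst nn_integral_lborel_translate) (simp_all, measurable)
      also have "\<dots> = (\<integral>\<^sup>+u. (\<integral>\<^sup>+\<eta>. ?F (u *\<^sub>R e + \<eta>) * indicator {0..1} u \<partial>lborel) \<partial>lborel)"
        by (intro nn_integral_cong nn_integral_multc[symmetric]) measurable
      also have "\<dots> = (\<integral>\<^sup>+\<eta>. (\<integral>\<^sup>+u. ?F (u *\<^sub>R e + \<eta>) * indicator {0..1} u \<partial>lborel) \<partial>lborel)"
        by (rule lborel_pair.Fubini') measurable
      also have "\<dots> \<le> (\<integral>\<^sup>+\<eta>. ennreal (2 ^ (2 * DIM('a)) * w (\<xi> - \<eta>)) *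
          (\<integral>\<^sup>+u\<in>{0..1}. indicator (S e) (\<eta> + u *\<^sub>R e) * ennreal (g (r - norm (\<eta> + u *\<^sub>R e))) \<partial>lborel) \<partial>lborel)"
      proof (intro nn_integral_mono)
        fix \<eta> :: 'a
        have "(\<integral>\<^sup>+u. ?F (u *\<^sub>R e + \<eta>) * indicator {0..1} u \<partial>lborel)
          \<le> (\<integral>\<^sup>+u. ennreal (2 ^ (2 * DIM('a)) * w (\<xi> - \<eta>)) *
            (indicator (S e) (\<eta> + u *\<^sub>R e) * ennreal (g (r - norm (\<eta> + u *\<^sub>R e))) * indicator {0..1} u) \<partial>lborel)"
        proof (intro nn_integral_mono)
          fix u :: real
          have "w (\<xi> - (u *\<^sub>R e + \<eta>)) \<le> 2 ^ (2 * DIM('a)) * w (\<xi> - \<eta>)" if u: "u \<in> {0..1}"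
          proof -
            have "w (\<xi> - \<eta> + (- u) *\<^sub>R e) \<le> (1 + norm ((- u) *\<^sub>R e)) ^ (2 * DIM('a)) * w (\<xi> - \<eta>)"
              unfolding w_def by (rule inverse_bracket_shift_le)
            also have "\<dots> \<le> 2 ^ (2 * DIM('a)) * w (\<xi> - \<eta>)"
              using u E(2)[OF e] by (intro mult_right_mono power_mono w_nonneg) auto
            finally show ?thesis by (simp add: algebra_simps)
          qed
          then show "?F (u *\<^sub>R e + \<eta>) * indicator {0..1} u
            \<le> ennreal (2 ^ (2 * DIM('a)) * w (\<xi> - \<eta>)) *
            (indicator (S e) (\<eta> + u *\<^sub>R e) * ennreal (g (r - norm (\<eta> + u *\<^sub>R e))) * indicator {0..1} u)"
            by (auto simp: add.commute intro!: mult_right_mono ennreal_leI split: split_indicator)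
        qed
        also have "\<dots> = ennreal (2 ^ (2 * DIM('a)) * w (\<xi> - \<eta>)) *
          (\<integral>\<^sup>+u\<in>{0..1}. indicator (S e) (\<eta> + u *\<^sub>R e) * ennreal (g (r - norm (\<eta> + u *\<^sub>R e))) \<partial>lborel)"
          by (rule nn_integral_cmult) measurable
        finally show "(\<integral>\<^sup>+u. ?F (u *\<^sub>R e + \<eta>) * indicator {0..1} u \<partial>lborel) \<le> \<dots>" .
      qed
      also have "\<dots> \<le> (\<integral>\<^sup>+\<eta>. ennreal (2 ^ (2 * DIM('a)) * w (\<xi> - \<eta>)) * (ennreal (2 * c) * ?I) \<partial>lborel)"
        unfolding S_def
        by (intro nn_integral_mono mult_left_mono nn_integral_cone_line_le E(2)[OF e] c g) auto
      also have "\<dots> = (\<integral>\<^sup>+\<eta>. ennreal (w (\<xi> - \<eta>)) \<partial>lborel) * (ennreal (2 ^ (2 * DIM('a))) * (ennreal (2 * c) * ?I))"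
        by (subst nn_integral_multc[symmetric]) (auto simp: ennreal_mult w_nonneg mult_ac)
      also have "(\<integral>\<^sup>+\<eta>. ennreal (w (\<xi> - \<eta>)) \<partial>lborel) = ennreal W"
        unfolding W[symmetric] by (rule nn_integral_lborel_reflect) measurable
      also have "ennreal W * (ennreal (2 ^ (2 * DIM('a))) * (ennreal (2 * c) * ?I)) = ennreal (2 ^ (2 * DIM('a)) * W * (2 * c)) * ?I"
        using W_nonneg c by (simp add: ennreal_mult mult_ac)
      finally show ?thesis .
    qed
    have "(\<integral>\<^sup>+\<eta>. ennreal (w (\<xi> - \<eta>)) * ennreal (g (r - norm \<eta>)) \<partial>lborel)
      \<le> (\<integral>\<^sup>+\<eta>. (\<Sum>e\<in>E. indicator (S e) \<eta> * (ennreal (w (\<xi> - \<eta>)) * ennreal (g (r - norm \<eta>)))) \<partial>lborel)"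
    proof (intro nn_integral_mono)
      fix \<eta>
      obtain e where e: "e \<in> E" "\<eta> \<in> S e" using cover by blast
      then have "ennreal (w (\<xi> - \<eta>)) * ennreal (g (r - norm \<eta>)) = indicator (S e) \<eta> * (ennreal (w (\<xi> - \<eta>)) * ennreal (g (r - norm \<eta>)))"
        by simp
      also have "\<dots> \<le> (\<Sum>e\<in>E. indicator (S e) \<eta> * (ennreal (w (\<xi> - \<eta>)) * ennreal (g (r - norm \<eta>))))"
        by (rule member_le_sum) (use e E in auto)
      finally show "ennreal (w (\<xi> - \<eta>)) * ennreal (g (r - norm \<eta>)) \<le> \<dots>" .
    qed
    also have "\<dots> = (\<Sum>e\<in>E. \<integral>\<^sup>+\<eta>. indicator (S e) \<eta> * (ennreal (w (\<xi> - \<eta>)) * ennreal (g (r - norm \<eta>))) \<partial>lborel)"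
      by (rule nn_integral_sum) measurable
    also have "\<dots> \<le> (\<Sum>e\<in>E. ennreal (2 ^ (2 * DIM('a)) * W * (2 * c)) * ?I)"
      by (intro sum_mono one)
    also have "\<dots> = ennreal C * ?I"
      unfolding C_def sum_distrib_right[symmetric] using W_nonneg c by (subst sum_ennreal) (auto simp: mult.assoc)
    finally show "(\<integral>\<^sup>+\<eta>. ennreal (decay (2 * DIM('a)) (\<xi> - \<eta>)) * ennreal (g (r - norm \<eta>)) \<partial>lborel)
      \<le> ennreal C * ?I" by (simp add: w_def)
  qed
qed

section \<open>Square integrals in time\<close>

lemma ennreal_norm_integral_le:
  fixes f :: "'a \<Rightarrow> 'b::{banach, second_countable_topology}"
  shows "ennreal (norm (integral\<^sup>L M f)) \<le> (\<integral>\<^sup>+x. ennreal (norm (f x)) \<partial>M)"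
  by (cases "integrable M f") (auto simp: not_integrable_integral_eq intro: integral_norm_bound_ennreal)

lemma integral_cis_gauss_real:
  assumes e: "0 < \<epsilon>"
  shows "(LBINT t. cis (t * v) * of_real (exp (- (norm (\<epsilon> *\<^sub>R t))\<^sup>2 / 2)))
    = of_real (2 * pi / \<epsilon> * gauss_kernel (v / \<epsilon>))"
proof -
  have "of_real (2 * pi * gauss_kernel (v / \<epsilon>)) = (LBINT t. cis (t \<bullet> (v / \<epsilon>)) * of_real (exp (- (norm t)\<^sup>2 / 2)))"
    by (simp only: integral_cis_gauss) simp
  also have "\<dots> = \<bar>\<epsilon>\<bar> ^ DIM(real) *\<^sub>R (LBINT t. cis ((0 + \<epsilon> *\<^sub>R t) \<bullet> (v / \<epsilon>)) * of_real (exp (- (norm (0 + \<epsilon> *\<^sub>R t))\<^sup>2 / 2)))"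
    by (rule integral_lborel_affine) (use e in auto)
  finally show ?thesis
    using e by (simp add: scaleR_conv_of_real field_simps)
qed

text \<open>The Gaussian weight in t makes the square of the oscillatory integral integrable, so it
  can be expanded into a double frequency integral. The t-integration then yields a Gaussian of
  width \<epsilon> in |\<eta>| - |\<eta>'|, an approximation of 2 pi times the delta function.
  Passing to absolute values afterwards loses nothing essential, since this kernel is
  nonnegative.\<close>

lemma gauss_weighted_time_integral_le:
  fixes a :: "'a::euclidean_space \<Rightarrow> complex"
  assumes a: "integrable lborel a" and e: "0 < \<epsilon>"
  shows "(\<integral>\<^sup>+t. ennreal (exp (- (norm (\<epsilon> *\<^sub>R t))\<^sup>2 / 2) * (norm (LBINT \<eta>. cis (t * norm \<eta>) * a \<eta>))\<^sup>2) \<partial>lborel)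
    \<le> (\<integral>\<^sup>+\<eta>. (\<integral>\<^sup>+\<eta>'. ennreal (norm (a \<eta>) * norm (a \<eta>') * (2 * pi / \<epsilon> * gauss_kernel ((norm \<eta> - norm \<eta>') / \<epsilon>))) \<partial>lborel) \<partial>lborel)"
proof -
  have [measurable]: "a \<in> borel_measurable borel" using borel_measurable_integrable[OF a] by simp
  define J where "J t = (LBINT \<eta>. cis (t * norm \<eta>) * a \<eta>)" for t
  have [measurable]: "J \<in> borel_measurable borel" unfolding J_def by measurable
  define B where "B = (LBINT \<eta>. norm (a \<eta>))"
  have J: "norm (J t) \<le> B" for t
    unfolding J_def B_def by (rule norm_integral_le) (auto simp: norm_mult intro: integrable_norm a)
  have B: "0 \<le> B" unfolding B_def by simp
  define \<rho> where "\<rho> t = exp (- (norm (\<epsilon> *\<^sub>R t))\<^sup>2 / 2)" for t :: real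
  have [measurable]: "\<rho> \<in> borel_measurable borel" unfolding \<rho>_def by measurable
  have \<rho>: "integrable lborel \<rho>" "0 \<le> \<rho> t" for t
    unfolding \<rho>_def using integrable_gauss_scaled[of \<epsilon>, where 'a=real] e by auto
  define k where "k v = 2 * pi / \<epsilon> * gauss_kernel (v / \<epsilon>)" for v :: real
  have k: "0 \<le> k v" for v using e by (simp add: k_def gauss_kernel_nonneg)
  let ?Q = "\<lambda>\<eta>. LBINT \<eta>'. cnj (a \<eta>') * of_real (k (norm \<eta> - norm \<eta>'))"
  let ?R = "\<lambda>\<eta>. \<integral>\<^sup>+\<eta>'. ennreal (norm (a \<eta>) * norm (a \<eta>') * k (norm \<eta> - norm \<eta>')) \<partial>lborel"
  have inner: "(LBINT t. of_real (\<rho> t) * cnj (J t) * cis (t * r)) = (LBINT \<eta>'. cnj (a \<eta>') * of_real (k (r - norm \<eta>')))" for r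
  proof -
    have "of_real (\<rho> t) * cnj (J t) * cis (t * r) = (LBINT \<eta>'. of_real (\<rho> t) * cis (t * (r - norm \<eta>')) * cnj (a \<eta>'))" for t
    proof -
      have "cnj (J t) = (LBINT \<eta>'. cis (- (t * norm \<eta>')) * cnj (a \<eta>'))"
        using Bochner_Integration.integral_cnj[of lborel "\<lambda>\<eta>'. cis (t * norm \<eta>') * a \<eta>'"]
        by (simp add: J_def cis_cnj)
      then have "of_real (\<rho> t) * cnj (J t) * cis (t * r)
        = (of_real (\<rho> t) * cis (t * r)) * (LBINT \<eta>'. cis (- (t * norm \<eta>')) * cnj (a \<eta>'))"
        by (simp add: mult_ac)
      also have "\<dots> = (LBINT \<eta>'. (of_real (\<rho> t) * cis (t * r)) * (cis (- (t * norm \<eta>')) * cnj (a \<eta>')))"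
        by (rule integral_mult_right_zero[symmetric])
      also have "\<dots> = (LBINT \<eta>'. of_real (\<rho> t) * cis (t * (r - norm \<eta>')) * cnj (a \<eta>'))"
        by (rule integral_ext) (simp add: right_diff_distrib mult.assoc[symmetric] cis_mult)
      finally show ?thesis .
    qed
    then have "(LBINT t. of_real (\<rho> t) * cnj (J t) * cis (t * r))
      = (LBINT t. (LBINT \<eta>'. of_real (\<rho> t) * cis (t * (r - norm \<eta>')) * cnj (a \<eta>')))" by simp
    also have "\<dots> = (LBINT \<eta>'. (LBINT t. of_real (\<rho> t) * cis (t * (r - norm \<eta>')) * cnj (a \<eta>')))"
      by (rule Fubini_dominated[OF _ \<rho>(1) integrable_norm[OF a]]) (auto simp: norm_mult \<rho>)
    also have "\<dots> = (LBINT \<eta>'. cnj (a \<eta>') * of_real (k (r - norm \<eta>')))"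
    proof (rule integral_ext)
      fix \<eta>'
      have "(LBINT t. of_real (\<rho> t) * cis (t * (r - norm \<eta>')) * cnj (a \<eta>'))
        = (LBINT t. cnj (a \<eta>') * (cis (t * (r - norm \<eta>')) * of_real (\<rho> t)))"
        by (simp add: mult_ac)
      also have "\<dots> = cnj (a \<eta>') * (LBINT t. cis (t * (r - norm \<eta>')) * of_real (\<rho> t))"
        by (rule integral_mult_right_zero)
      finally show "(LBINT t. of_real (\<rho> t) * cis (t * (r - norm \<eta>')) * cnj (a \<eta>')) = cnj (a \<eta>') * of_real (k (r - norm \<eta>'))"
        unfolding \<rho>_def integral_cis_gauss_real[OF e] k_def .
    qed
    finally show ?thesis .
  qed
  have "complex_of_real (LBINT t. \<rho> t * (norm (J t))\<^sup>2) = (LBINT t. of_real (\<rho> t) * cnj (J t) * J t)"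
    unfolding integral_complex_of_real[symmetric]
    by (rule integral_ext) (simp add: complex_norm_square mult_ac del: of_real_power)
  also have "\<dots> = (LBINT t. (LBINT \<eta>. of_real (\<rho> t) * cnj (J t) * (cis (t * norm \<eta>) * a \<eta>)))"
    unfolding integral_mult_right_zero J_def[symmetric] ..
  also have "\<dots> = (LBINT \<eta>. (LBINT t. of_real (\<rho> t) * cnj (J t) * (cis (t * norm \<eta>) * a \<eta>)))"
  proof (rule Fubini_dominated)
    show "integrable lborel (\<lambda>t. \<rho> t * B)" by (intro integrable_mult_left \<rho>)
    show "integrable lborel (\<lambda>\<eta>. norm (a \<eta>))" by (rule integrable_norm[OF a])
    show "norm (of_real (\<rho> t) * cnj (J t) * (cis (t * norm \<eta>) * a \<eta>)) \<le> \<rho> t * B * norm (a \<eta>)" for t \<eta>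
      using J[of t] by (simp add: norm_mult \<rho> mult_left_mono mult_right_mono)
  qed measurable
  also have "\<dots> = (LBINT \<eta>. a \<eta> * (?Q \<eta>))"
  proof (rule integral_ext)
    fix \<eta>
    have "(LBINT t. of_real (\<rho> t) * cnj (J t) * (cis (t * norm \<eta>) * a \<eta>))
      = (LBINT t. a \<eta> * (of_real (\<rho> t) * cnj (J t) * cis (t * norm \<eta>)))"
      by (simp add: mult_ac)
    also have "\<dots> = a \<eta> * (LBINT t. of_real (\<rho> t) * cnj (J t) * cis (t * norm \<eta>))"
      by (rule integral_mult_right_zero)
    finally show "(LBINT t. of_real (\<rho> t) * cnj (J t) * (cis (t * norm \<eta>) * a \<eta>))
      = a \<eta> * (?Q \<eta>)"
      unfolding inner .
  qed
  finally have eq: "complex_of_real (LBINT t. \<rho> t * (norm (J t))\<^sup>2)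
    = (LBINT \<eta>. a \<eta> * (?Q \<eta>))" .
  have i: "integrable lborel (\<lambda>t. \<rho> t * (norm (J t))\<^sup>2)"
  proof (rule Bochner_Integration.integrable_bound[OF integrable_mult_left[OF \<rho>(1), of "B\<^sup>2"]])
    show "AE t in lborel. norm (\<rho> t * (norm (J t))\<^sup>2) \<le> norm (\<rho> t * B\<^sup>2)"
      using J by (auto simp: \<rho> abs_mult intro!: mult_left_mono power_mono)
  qed measurable
  have "(\<integral>\<^sup>+t. ennreal (\<rho> t * (norm (J t))\<^sup>2) \<partial>lborel) = ennreal (LBINT t. \<rho> t * (norm (J t))\<^sup>2)"
    by (rule nn_integral_eq_integral[OF i]) (auto simp: \<rho>)
  also have "\<dots> \<le> ennreal (norm (complex_of_real (LBINT t. \<rho> t * (norm (J t))\<^sup>2)))"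
    by (intro ennreal_leI) simp
  also have "\<dots> \<le> (\<integral>\<^sup>+\<eta>. ennreal (norm (a \<eta> * (?Q \<eta>))) \<partial>lborel)"
    unfolding eq by (rule ennreal_norm_integral_le)
  also have "\<dots> \<le> (\<integral>\<^sup>+\<eta>. (?R \<eta>) \<partial>lborel)"
  proof (intro nn_integral_mono)
    fix \<eta>
    have "ennreal (norm (a \<eta> * (?Q \<eta>)))
      \<le> ennreal (norm (a \<eta>)) * (\<integral>\<^sup>+\<eta>'. ennreal (norm (cnj (a \<eta>') * of_real (k (norm \<eta> - norm \<eta>')))) \<partial>lborel)"
      unfolding norm_mult by (subst ennreal_mult) (auto intro!: mult_left_mono ennreal_norm_integral_le[THEN order_trans] simp: norm_mult)
    also have "\<dots> = (\<integral>\<^sup>+\<eta>'. ennreal (norm (a \<eta>)) * ennreal (norm (cnj (a \<eta>') * of_real (k (norm \<eta> - norm \<eta>')))) \<partial>lborel)"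
      unfolding k_def by (rule nn_integral_cmult[symmetric]) measurable
    also have "\<dots> = (?R \<eta>)"
      by (intro nn_integral_cong) (simp add: norm_mult k ennreal_mult[symmetric] mult.assoc)
    finally show "ennreal (norm (a \<eta> * (?Q \<eta>)))
      \<le> (?R \<eta>)" .
  qed
  finally show ?thesis unfolding \<rho>_def J_def k_def .
qed

lemma gauss_kernel_antimono: "\<bar>u\<bar> \<le> \<bar>v\<bar> \<Longrightarrow> gauss_kernel (v::real) \<le> gauss_kernel u"
  unfolding gauss_kernel_def by (intro mult_left_mono) (auto simp: abs_le_square_iff)

text \<open>The mass 2 pi is the same for every \<epsilon>, which keeps the time estimates uniform
  while the cut-off is removed.\<close>

lemma nn_integral_gauss_kernel_scaled:
  assumes "0 < \<epsilon>"
  shows "(\<integral>\<^sup>+v. ennreal (2 * pi / \<epsilon> * gauss_kernel ((v::real) / \<epsilon>)) \<partial>lborel) = ennreal (2 * pi)"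
proof -
  have "(\<integral>\<^sup>+v. ennreal (2 * pi / \<epsilon> * gauss_kernel (v / \<epsilon>)) \<partial>lborel)
     = ennreal \<bar>\<epsilon>\<bar> * (\<integral>\<^sup>+v. ennreal (2 * pi / \<epsilon> * gauss_kernel ((0 + \<epsilon> * v) / \<epsilon>)) \<partial>lborel)"
    by (rule nn_integral_real_affine) (use assms in auto)
  also have "\<dots> = (\<integral>\<^sup>+v. ennreal (2 * pi) * ennreal (gauss_kernel (v::real)) \<partial>lborel)"
    using assms by (subst nn_integral_cmult[symmetric])
      (auto simp: ennreal_mult[symmetric] gauss_kernel_nonneg intro!: nn_integral_cong)
  also have "\<dots> = ennreal (2 * pi) * ennreal (LBINT v. gauss_kernel (v::real))"
    by (subst nn_integral_cmult) (auto simp: nn_integral_eq_integral integrable_gauss_kernel gauss_kernel_nonneg)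
  finally show ?thesis by (simp add: integral_gauss_kernel)
qed

text \<open>The bilinear form of the previous estimate is treated by Schur's test: the norms of the
  frequencies \<open>\<eta>\<close> and \<open>\<eta>'\<close> are localised to a common shell of width \<open>\<epsilon>\<close>, whose weighted
  mass is \<open>O(\<epsilon>)\<close> uniformly in its radius.\<close>

lemma time_integral_le:
  obtains C where "0 \<le> C"
    "\<And>(a :: 'a::euclidean_space \<Rightarrow> complex) w b \<xi>.
      \<lbrakk>integrable lborel a; w \<in> borel_measurable borel; b \<in> borel_measurable borel;
       \<And>z. 0 \<le> w z; \<And>z. w z \<le> decay (2 * DIM('a)) z; \<And>\<eta>. 0 \<le> b \<eta>;
       \<And>\<eta>. norm (a \<eta>) \<le> w (\<xi> - \<eta>) * b \<eta>\<rbrakk> \<Longrightarrow>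
      (\<integral>\<^sup>+t. ennreal ((norm (LBINT \<eta>. cis (t * norm \<eta>) * a \<eta>))\<^sup>2) \<partial>lborel)
      \<le> ennreal C * (\<integral>\<^sup>+\<eta>. ennreal (w (\<xi> - \<eta>) * (b \<eta>)\<^sup>2) \<partial>lborel)"
proof -
  obtain C where C: "0 \<le> C"
    "\<And>(g :: real \<Rightarrow> real) r (\<xi>::'a). \<lbrakk>\<And>u v. \<bar>u\<bar> \<le> \<bar>v\<bar> \<Longrightarrow> g v \<le> g u; \<And>v. 0 \<le> g v; g \<in> borel_measurable borel\<rbrakk> \<Longrightarrow>
      (\<integral>\<^sup>+\<eta>. ennreal (decay (2 * DIM('a)) (\<xi> - \<eta>)) * ennreal (g (r - norm \<eta>)) \<partial>lborel)
      \<le> ennreal C * (\<integral>\<^sup>+v. ennreal (g v) \<partial>lborel)"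
    by (rule shell_bound) blast
  show ?thesis
  proof (rule that)
    show "0 \<le> C * (2 * pi)" using C by simp
    fix a :: "'a \<Rightarrow> complex" and w b :: "'a \<Rightarrow> real" and \<xi> :: 'a
    assume a: "integrable lborel a" and [measurable]: "w \<in> borel_measurable borel" "b \<in> borel_measurable borel"
      and w: "\<And>z. 0 \<le> w z" "\<And>z. w z \<le> decay (2 * DIM('a)) z" and b: "\<And>\<eta>. 0 \<le> b \<eta>"
      and le: "\<And>\<eta>. norm (a \<eta>) \<le> w (\<xi> - \<eta>) * b \<eta>"
    have [measurable]: "a \<in> borel_measurable borel" using borel_measurable_integrable[OF a] by simp
    define J where "J t = (LBINT \<eta>. cis (t * norm \<eta>) * a \<eta>)" for t
    have [measurable]: "J \<in> borel_measurable borel" unfolding J_def by measurable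
    let ?S = "\<integral>\<^sup>+\<eta>. ennreal (w (\<xi> - \<eta>) * (b \<eta>)\<^sup>2) \<partial>lborel"
    have weighted: "(\<integral>\<^sup>+t. ennreal (exp (- (norm (\<epsilon> *\<^sub>R t))\<^sup>2 / 2) * (norm (J t))\<^sup>2) \<partial>lborel) \<le> ennreal (C * (2 * pi)) * ?S"
      if e: "0 < \<epsilon>" for \<epsilon>
    proof -
      define k where "k v = 2 * pi / \<epsilon> * gauss_kernel (v / \<epsilon>)" for v :: real
      have [measurable]: "k \<in> borel_measurable borel" unfolding k_def by measurable
      have k: "0 \<le> k v" for v using e by (simp add: k_def gauss_kernel_nonneg)
      have k_anti: "k v \<le> k u" if "\<bar>u\<bar> \<le> \<bar>v\<bar>" for u v
        unfolding k_def using that e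
        by (intro mult_left_mono gauss_kernel_antimono) (auto simp: abs_divide divide_right_mono)
      have shell: "(\<integral>\<^sup>+\<eta>'. ennreal (w (\<xi> - \<eta>')) * ennreal (k (r - norm \<eta>')) \<partial>lborel) \<le> ennreal (C * (2 * pi))" for r
      proof -
        have "(\<integral>\<^sup>+\<eta>'. ennreal (w (\<xi> - \<eta>')) * ennreal (k (r - norm \<eta>')) \<partial>lborel)
          \<le> (\<integral>\<^sup>+\<eta>'. ennreal (decay (2 * DIM('a)) (\<xi> - \<eta>')) * ennreal (k (r - norm \<eta>')) \<partial>lborel)"
          by (intro nn_integral_mono mult_right_mono ennreal_leI w) auto
        also have "\<dots> \<le> ennreal C * (\<integral>\<^sup>+v. ennreal (k v) \<partial>lborel)"
          by (rule C(2)[OF k_anti k]) auto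
        also have "\<dots> = ennreal (C * (2 * pi))"
          unfolding k_def nn_integral_gauss_kernel_scaled[OF e] using C(1) by (simp add: ennreal_mult)
        finally show ?thesis .
      qed
      \<comment> \<open>\<open>P\<close> carries the square of b on its first variable only. From b
        b' <= (b^2 + b'^2)/2 the bilinear form is at most the mean of \<open>P\<close> and its
        transpose, and in either one the free variable is integrated by
        \<open>shell\<close>.\<close>
      define P where "P \<eta> \<eta>' = ennreal (w (\<xi> - \<eta>) * (b \<eta>)\<^sup>2) * (ennreal (w (\<xi> - \<eta>')) * ennreal (k (norm \<eta> - norm \<eta>')))" for \<eta> \<eta>'
      have [measurable]: "(\<lambda>(\<eta>, \<eta>'). P \<eta> \<eta>') \<in> borel_measurable (borel \<Otimes>\<^sub>M borel)" unfolding P_def by measurable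
      have PS: "(\<integral>\<^sup>+\<eta>. (\<integral>\<^sup>+\<eta>'. P \<eta> \<eta>' \<partial>lborel) \<partial>lborel) \<le> ennreal (C * (2 * pi)) * ?S"
      proof -
        have "(\<integral>\<^sup>+\<eta>. (\<integral>\<^sup>+\<eta>'. P \<eta> \<eta>' \<partial>lborel) \<partial>lborel)
           = (\<integral>\<^sup>+\<eta>. ennreal (w (\<xi> - \<eta>) * (b \<eta>)\<^sup>2) * (\<integral>\<^sup>+\<eta>'. ennreal (w (\<xi> - \<eta>')) * ennreal (k (norm \<eta> - norm \<eta>')) \<partial>lborel) \<partial>lborel)"
          unfolding P_def by (intro nn_integral_cong nn_integral_cmult) measurable
        also have "\<dots> \<le> (\<integral>\<^sup>+\<eta>. ennreal (w (\<xi> - \<eta>) * (b \<eta>)\<^sup>2) * ennreal (C * (2 * pi)) \<partial>lborel)"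
          by (intro nn_integral_mono mult_left_mono shell) auto
        also have "\<dots> = ?S * ennreal (C * (2 * pi))"
          by (rule nn_integral_multc) measurable
        finally show ?thesis by (simp add: mult.commute)
      qed
      have "(\<integral>\<^sup>+t. ennreal (exp (- (norm (\<epsilon> *\<^sub>R t))\<^sup>2 / 2) * (norm (J t))\<^sup>2) \<partial>lborel)
        \<le> (\<integral>\<^sup>+\<eta>. (\<integral>\<^sup>+\<eta>'. ennreal (norm (a \<eta>) * norm (a \<eta>') * k (norm \<eta> - norm \<eta>')) \<partial>lborel) \<partial>lborel)"
        unfolding J_def k_def by (rule gauss_weighted_time_integral_le[OF a e])
      also have "\<dots> \<le> (\<integral>\<^sup>+\<eta>. (\<integral>\<^sup>+\<eta>'. ennreal (1 / 2) * (P \<eta> \<eta>' + P \<eta>' \<eta>) \<partial>lborel) \<partial>lborel)"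
      proof (intro nn_integral_mono)
        fix \<eta> \<eta>' :: 'a
        have kc: "k (norm \<eta>' - norm \<eta>) = k (norm \<eta> - norm \<eta>')"
          by (intro antisym k_anti) auto
        let ?k = "k (norm \<eta> - norm \<eta>')"
        have "norm (a \<eta>) * norm (a \<eta>') * ?k \<le> (w (\<xi> - \<eta>) * b \<eta>) * (w (\<xi> - \<eta>') * b \<eta>') * ?k"
          by (intro mult_right_mono mult_mono le k) (auto simp: w b)
        also have "\<dots> = (w (\<xi> - \<eta>) * w (\<xi> - \<eta>') * ?k) * (b \<eta> * b \<eta>')" by (simp add: mult_ac)
        also have "\<dots> \<le> (w (\<xi> - \<eta>) * w (\<xi> - \<eta>') * ?k) * (1 / 2 * ((b \<eta>)\<^sup>2 + (b \<eta>')\<^sup>2))"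
          using sum_squares_bound[of "b \<eta>" "b \<eta>'"] by (intro mult_left_mono) (auto simp: w k)
        also have "\<dots> = 1 / 2 * (w (\<xi> - \<eta>) * (b \<eta>)\<^sup>2 * (w (\<xi> - \<eta>') * ?k) + w (\<xi> - \<eta>') * (b \<eta>')\<^sup>2 * (w (\<xi> - \<eta>) * ?k))"
          by (simp add: algebra_simps)
        finally have "ennreal (norm (a \<eta>) * norm (a \<eta>') * ?k) \<le> ennreal \<dots>" by (rule ennreal_leI)
        also have "\<dots> = ennreal (1 / 2) * (P \<eta> \<eta>' + P \<eta>' \<eta>)"
        proof -
          have half: "ennreal (1 / 2 * (x + y)) = ennreal (1 / 2) * (ennreal x + ennreal y)" if "0 \<le> x" "0 \<le> y" for x y
            using that by (simp only: ennreal_plus[symmetric]) (rule ennreal_mult, auto)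
          show ?thesis
            unfolding P_def kc by (subst half) (auto simp: ennreal_mult w k)
        qed
        finally show "ennreal (norm (a \<eta>) * norm (a \<eta>') * ?k) \<le> ennreal (1 / 2) * (P \<eta> \<eta>' + P \<eta>' \<eta>)" .
      qed
      also have "\<dots> = ennreal (1 / 2) * ((\<integral>\<^sup>+\<eta>. (\<integral>\<^sup>+\<eta>'. P \<eta> \<eta>' \<partial>lborel) \<partial>lborel) + (\<integral>\<^sup>+\<eta>. (\<integral>\<^sup>+\<eta>'. P \<eta>' \<eta> \<partial>lborel) \<partial>lborel))"
        by (simp add: nn_integral_cmult nn_integral_add)
      also have "(\<integral>\<^sup>+\<eta>. (\<integral>\<^sup>+\<eta>'. P \<eta>' \<eta> \<partial>lborel) \<partial>lborel) = (\<integral>\<^sup>+\<eta>. (\<integral>\<^sup>+\<eta>'. P \<eta> \<eta>' \<partial>lborel) \<partial>lborel)"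
        by (rule lborel_pair.Fubini') measurable
      also have "ennreal (1 / 2) * (z + z) = z" for z
      proof -
        have "ennreal (1 / 2) * ennreal 2 = 1"
          by (subst ennreal_mult[symmetric]) auto
        then show ?thesis
          unfolding mult_2[symmetric] mult.assoc[symmetric] by (simp only: ennreal_numeral mult_1)
      qed
      also note PS
      finally show ?thesis .
    qed
    \<comment> \<open>The time cut-off is removed by Fatou's lemma; the bound
      \<open>weighted\<close> does not depend on \<epsilon>.\<close>
    define e where "e = (\<lambda>n (t::real). exp (- (norm (inverse (real (Suc n)) *\<^sub>R t))\<^sup>2 / 2))"
    have [measurable]: "e n \<in> borel_measurable borel" for n unfolding e_def by measurable
    have "(\<integral>\<^sup>+t. ennreal ((norm (J t))\<^sup>2) \<partial>lborel) = (\<integral>\<^sup>+t. liminf (\<lambda>n. ennreal (e n t * (norm (J t))\<^sup>2)) \<partial>lborel)"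
    proof (intro nn_integral_cong lim_imp_Liminf[symmetric] sequentially_bot tendsto_ennrealI)
      fix t
      have "(\<lambda>n. e n t) \<longlonglongrightarrow> exp (- (norm (0 *\<^sub>R t))\<^sup>2 / 2)"
        unfolding e_def by (intro tendsto_intros LIMSEQ_inverse_real_of_nat) auto
      then show "(\<lambda>n. e n t * (norm (J t))\<^sup>2) \<longlonglongrightarrow> (norm (J t))\<^sup>2"
        by (auto intro!: tendsto_eq_intros)
    qed
    also have "\<dots> \<le> liminf (\<lambda>n. \<integral>\<^sup>+t. ennreal (e n t * (norm (J t))\<^sup>2) \<partial>lborel)"
      by (rule nn_integral_liminf) measurable
    also have "\<dots> \<le> liminf (\<lambda>n. ennreal (C * (2 * pi)) * ?S)"
      unfolding e_def by (intro Liminf_mono always_eventually allI weighted) auto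
    also have "\<dots> = ennreal (C * (2 * pi)) * ?S" by (intro Liminf_const) auto
    finally show "(\<integral>\<^sup>+t. ennreal ((norm (LBINT \<eta>. cis (t * norm \<eta>) * a \<eta>))\<^sup>2) \<partial>lborel) \<le> ennreal (C * (2 * pi)) * ?S"
      unfolding J_def .
  qed
qed

section \<open>Energy of propagated data in time\<close>

lemma energy_integrable:
  fixes G :: "'a::euclidean_space \<Rightarrow> complex"
  assumes G: "rapid G" and s: "0 \<le> s"
  shows "integrable lborel (\<lambda>\<xi>. (1 + (norm \<xi>)\<^sup>2) powr s * (norm (G \<xi>))\<^sup>2)"
proof -
  note [measurable] = rapid_measurable[OF G]
  obtain C where C: "\<And>\<xi>. norm (G \<xi>) \<le> C * decay (nat \<lceil>s\<rceil> + DIM('a)) \<xi>"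
    by (rule rapidE[OF G, of "nat \<lceil>s\<rceil> + DIM('a)"]) blast
  show ?thesis
  proof (rule Bochner_Integration.integrable_bound)
    show "integrable lborel (\<lambda>\<xi>::'a. C\<^sup>2 * decay (2 * DIM('a)) \<xi>)"
      by (intro integrable_mult_right integrable_inverse_bracket)
    show "AE \<xi> in lborel. norm ((1 + (norm \<xi>)\<^sup>2) powr s * (norm (G \<xi>))\<^sup>2) \<le> norm (C\<^sup>2 * decay (2 * DIM('a)) \<xi>)"
      using energy_integrand_bound[OF s C] by (intro AE_I2) (simp add: abs_mult)
  qed measurable
qed

lemma nn_integral_energy:
  fixes G :: "'a::euclidean_space \<Rightarrow> complex"
  assumes G: "rapid G" and s: "0 \<le> s"
  shows "(\<integral>\<^sup>+\<xi>. ennreal ((1 + (norm \<xi>)\<^sup>2) powr s * (norm (G \<xi>))\<^sup>2) \<partial>lborel) = ennreal (energy s G)"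
  unfolding energy_def by (rule nn_integral_eq_integral[OF energy_integrable[OF assms]]) simp

text \<open>The frequency side of evolving F to time t and then applying the operator with frequency
  kernel K. With \<open>wave_kernel k\<close> it is the transform of h_k(t).\<close>

definition propagate :: "('a::euclidean_space \<Rightarrow> 'a \<Rightarrow> complex) \<Rightarrow> ('a \<Rightarrow> complex) \<Rightarrow> real \<Rightarrow> 'a \<Rightarrow> complex" where
  "propagate K F t \<xi> = (LBINT \<eta>. cis (t * norm \<eta>) * (K \<xi> \<eta> * F \<eta>))"

lemma integrable_bracket_rapid:
  fixes F :: "'a::euclidean_space \<Rightarrow> complex"
  assumes "rapid F"
  shows "integrable lborel (\<lambda>\<eta>. (1 + norm \<eta>) ^ N * norm (F \<eta>))"
proof -
  have "rapid (\<lambda>\<eta>. of_real ((1 + norm \<eta>) ^ N) * F \<eta>)"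
    by (rule rapid_mult[OF assms, of _ 1 N]) (auto intro!: continuous_intros simp: norm_power simp flip: of_real_add of_real_power)
  from integrable_norm[OF rapid_integrable[OF this]] show ?thesis
    by (simp add: norm_mult norm_power abs_mult flip: of_real_add of_real_power)
qed

lemma bracket_convolution_le:
  "decay N (\<xi> - \<eta>) \<le> (1 + norm \<eta>) ^ N * decay N \<xi>"
  using inverse_bracket_shift_le[of \<xi> "- \<eta>" N] by simp

lemma norm_propagate_le:
  fixes F :: "'a::euclidean_space \<Rightarrow> complex"
  assumes F: "rapid F" and A: "0 \<le> A" and le: "\<And>\<xi> \<eta>. norm (K \<xi> \<eta>) \<le> A * decay N (\<xi> - \<eta>)"
  shows "norm (propagate K F t \<xi>) \<le> A * (LBINT \<eta>. (1 + norm \<eta>) ^ N * norm (F \<eta>)) * decay N \<xi>"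
proof -
  have "norm (propagate K F t \<xi>) \<le> (LBINT \<eta>. A * decay N \<xi> * ((1 + norm \<eta>) ^ N * norm (F \<eta>)))"
    unfolding propagate_def
  proof (rule norm_integral_le)
    fix \<eta>
    have "norm (K \<xi> \<eta>) \<le> A * ((1 + norm \<eta>) ^ N * decay N \<xi>)"
      by (rule order_trans[OF le mult_left_mono[OF bracket_convolution_le A]])
    from mult_right_mono[OF this, of "norm (F \<eta>)"]
    show "norm (cis (t * norm \<eta>) * (K \<xi> \<eta> * F \<eta>)) \<le> A * decay N \<xi> * ((1 + norm \<eta>) ^ N * norm (F \<eta>))"
      by (simp add: norm_mult mult_ac)
  qed (intro integrable_mult_right integrable_bracket_rapid F)
  also have "\<dots> = A * decay N \<xi> * (LBINT \<eta>. (1 + norm \<eta>) ^ N * norm (F \<eta>))"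
    by (rule integral_mult_right_zero)
  finally show ?thesis by (simp add: mult_ac)
qed

lemma rapid_propagate:
  fixes F :: "'a::euclidean_space \<Rightarrow> complex"
  assumes F: "rapid F" and cont: "\<And>\<eta>. continuous_on UNIV (\<lambda>\<xi>. K \<xi> \<eta>)"
    and meas: "\<And>\<xi>. K \<xi> \<in> borel_measurable borel"
    and le: "\<And>N. \<exists>A\<ge>0. \<forall>\<xi> \<eta>. norm (K \<xi> \<eta>) \<le> A * decay N (\<xi> - \<eta>)"
  shows "rapid (propagate K F t)"
  unfolding rapid_def
proof (intro conjI allI)
  note [measurable] = rapid_measurable[OF F] meas
  obtain A where A: "0 \<le> A" "\<And>\<xi> \<eta>. norm (K \<xi> \<eta>) \<le> A" using le[of 0] by auto
  show "continuous_on UNIV (propagate K F t)"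
    unfolding propagate_def
  proof (rule continuous_on_integral_dominated)
    show "integrable lborel (\<lambda>\<eta>. A * norm (F \<eta>))" by (intro integrable_mult_right integrable_norm rapid_integrable F)
    show "norm (cis (t * norm \<eta>) * (K \<xi> \<eta> * F \<eta>)) \<le> A * norm (F \<eta>)" for \<xi> \<eta>
      using A by (simp add: norm_mult mult_right_mono)
    show "continuous_on UNIV (\<lambda>\<xi>. cis (t * norm \<eta>) * (K \<xi> \<eta> * F \<eta>))" for \<eta>
      by (intro continuous_intros cont)
  qed measurable
  fix N
  obtain A where A: "0 \<le> A" "\<And>\<xi> \<eta>. norm (K \<xi> \<eta>) \<le> A * decay N (\<xi> - \<eta>)" using le[of N] by auto
  show "\<exists>C. \<forall>\<xi>. (1 + norm \<xi>) ^ N * norm (propagate K F t \<xi>) \<le> C"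
  proof (intro exI allI)
    fix \<xi>
    show "(1 + norm \<xi>) ^ N * norm (propagate K F t \<xi>) \<le> A * (LBINT \<eta>. (1 + norm \<eta>) ^ N * norm (F \<eta>))"
      using norm_propagate_le[OF F A, of t \<xi>] bracket_pos[of \<xi> N] by (simp add: field_simps)
  qed
qed

text \<open>Peetre's inequality for the Sobolev weight. The power of 1 + |\<xi> - \<eta>| is rounded
  up to an integer so that \<open>decay\<close> can absorb it.\<close>

lemma energy_weight_le:
  fixes \<xi> \<eta> :: "'a::real_normed_vector"
  assumes s: "0 \<le> s"
  shows "(1 + (norm \<xi>)\<^sup>2) powr s \<le> 2 powr s * (1 + (norm \<eta>)\<^sup>2) powr s * (1 + norm (\<xi> - \<eta>)) ^ (2 * nat \<lceil>s\<rceil>)"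
proof -
  let ?z = "norm (\<xi> - \<eta>)"
  have "norm \<xi> \<le> norm \<eta> + ?z" using norm_triangle_sub by blast
  then have "(norm \<xi>)\<^sup>2 \<le> (norm \<eta> + ?z)\<^sup>2" by (intro power_mono) auto
  also have "\<dots> \<le> 2 * (norm \<eta>)\<^sup>2 + 2 * ?z\<^sup>2" using sum_squares_bound[of "norm \<eta>" ?z] by (simp add: power2_sum)
  finally have "1 + (norm \<xi>)\<^sup>2 \<le> 2 * (1 + (norm \<eta>)\<^sup>2) * (1 + ?z)\<^sup>2"
    by (simp add: algebra_simps power2_sum) (smt (verit, ccfv_SIG) mult_nonneg_nonneg norm_ge_zero zero_le_power2)
  then have "(1 + (norm \<xi>)\<^sup>2) powr s \<le> (2 * (1 + (norm \<eta>)\<^sup>2) * (1 + ?z)\<^sup>2) powr s"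
    using s by (intro powr_mono2) auto
  also have "\<dots> = 2 powr s * (1 + (norm \<eta>)\<^sup>2) powr s * ((1 + ?z)\<^sup>2) powr s"
    by (simp only: powr_mult)
  also have "((1 + ?z)\<^sup>2) powr s \<le> ((1 + ?z)\<^sup>2) powr real (nat \<lceil>s\<rceil>)"
    using s by (intro powr_mono) (auto simp: real_nat_ceiling_ge one_le_power)
  also have "\<dots> = (1 + ?z) ^ (2 * nat \<lceil>s\<rceil>)"
    by (subst powr_realpow) (auto simp: power_mult add_pos_nonneg add_nonneg_eq_0_iff)
  finally show ?thesis by (simp add: mult_left_mono)
qed

text \<open>For fixed \<xi>, both the square of \<open>propagate K F t \<xi>\<close> and its
  integral over t are bounded by a multiple of the same quantity, the b^2-mass seen through the
  weight w: the former by Cauchy-Schwarz, the latter by \<open>time_integral_le\<close>. Integrating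
  in \<xi> against the Sobolev weight then treats both cases at once. Of the decay of K, 2
  \<lceil>s\<rceil> powers move the Sobolev weight from \<xi> to \<eta>, and the remaining
  \<open>2 * DIM('a)\<close> serve integrability.\<close>

lemma propagate_energy_le:
  assumes s: "0 \<le> s"
  obtains C where "0 \<le> C"
    "\<And>K (F :: 'a::euclidean_space \<Rightarrow> complex) A t.
      \<lbrakk>(\<lambda>(\<xi>, \<eta>). K \<xi> \<eta>) \<in> borel_measurable (borel \<Otimes>\<^sub>M borel); rapid F; \<And>t. rapid (propagate K F t); 0 \<le> A;
       \<And>\<xi> \<eta>. norm (K \<xi> \<eta>) \<le> A * decay (2 * DIM('a) + 2 * nat \<lceil>s\<rceil>) (\<xi> - \<eta>)\<rbrakk> \<Longrightarrow>
      energy s (propagate K F t) \<le> C * A\<^sup>2 * energy s F \<and>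
      (\<integral>\<^sup>+t. ennreal (energy s (propagate K F t)) \<partial>lborel) \<le> ennreal (C * A\<^sup>2 * energy s F)"
proof -
  define w where "w = (\<lambda>z::'a. decay (2 * DIM('a) + 2 * nat \<lceil>s\<rceil>) z)"
  define w0 where "w0 = (\<lambda>z::'a. decay (2 * DIM('a)) z)"
  define m where "m \<xi> = (1 + (norm \<xi>)\<^sup>2) powr s" for \<xi> :: 'a
  have [measurable]: "w \<in> borel_measurable borel" "w0 \<in> borel_measurable borel" "m \<in> borel_measurable borel"
    unfolding w_def w0_def m_def by measurable
  have w: "0 \<le> w z" "w z \<le> w0 z" "0 \<le> m z" for z
  proof -
    show "0 \<le> w z" "0 \<le> m z" by (simp_all add: w_def m_def)
    have "1 \<le> (1 + norm z) ^ (2 * nat \<lceil>s\<rceil>)" by (rule one_le_power) simp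
    then have "decay (2 * nat \<lceil>s\<rceil>) z \<le> 1" by (rule inverse_le_1_iff[THEN iffD2, OF disjI2])
    then show "w z \<le> w0 z" by (simp add: w_def w0_def power_add mult_left_le)
  qed
  define W where "W = (LBINT z. w0 z)"
  have W: "(\<integral>\<^sup>+z. ennreal (w0 z) \<partial>lborel) = ennreal W" "0 \<le> W"
    unfolding W_def using integrable_inverse_bracket[where 'a='a]
    by (auto simp: w0_def intro!: nn_integral_eq_integral)
  have weight: "(\<integral>\<^sup>+\<xi>. ennreal (m \<xi>) * (\<integral>\<^sup>+\<eta>. ennreal (w (\<xi> - \<eta>) * (b \<eta>)\<^sup>2) \<partial>lborel) \<partial>lborel)
      \<le> ennreal (2 powr s * W) * (\<integral>\<^sup>+\<eta>. ennreal (m \<eta> * (b \<eta>)\<^sup>2) \<partial>lborel)"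
    if [measurable]: "b \<in> borel_measurable borel" for b :: "'a \<Rightarrow> real"
  proof -
    have "(\<integral>\<^sup>+\<xi>. ennreal (m \<xi>) * (\<integral>\<^sup>+\<eta>. ennreal (w (\<xi> - \<eta>) * (b \<eta>)\<^sup>2) \<partial>lborel) \<partial>lborel)
      = (\<integral>\<^sup>+\<xi>. (\<integral>\<^sup>+\<eta>. ennreal (m \<xi>) * ennreal (w (\<xi> - \<eta>) * (b \<eta>)\<^sup>2) \<partial>lborel) \<partial>lborel)"
      by (intro nn_integral_cong nn_integral_cmult[symmetric]) measurable
    also have "\<dots> = (\<integral>\<^sup>+\<eta>. (\<integral>\<^sup>+\<xi>. ennreal (m \<xi>) * ennreal (w (\<xi> - \<eta>) * (b \<eta>)\<^sup>2) \<partial>lborel) \<partial>lborel)"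
      by (rule lborel_pair.Fubini') measurable
    also have "\<dots> \<le> (\<integral>\<^sup>+\<eta>. (\<integral>\<^sup>+\<xi>. ennreal (2 powr s) * ennreal (m \<eta> * (b \<eta>)\<^sup>2) * ennreal (w0 (- \<eta> + \<xi>)) \<partial>lborel) \<partial>lborel)"
    proof (intro nn_integral_mono)
      fix \<xi> \<eta> :: 'a
      have "m \<xi> * w (\<xi> - \<eta>) \<le> (2 powr s * m \<eta> * (1 + norm (\<xi> - \<eta>)) ^ (2 * nat \<lceil>s\<rceil>)) * w (\<xi> - \<eta>)"
        unfolding m_def by (intro mult_right_mono energy_weight_le s w)
      also have "\<dots> = 2 powr s * m \<eta> * w0 (- \<eta> + \<xi>)"
        using bracket_pos[of "\<xi> - \<eta>" "2 * nat \<lceil>s\<rceil>"] by (simp add: w_def w0_def power_add field_simps)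
      finally have "m \<xi> * w (\<xi> - \<eta>) * (b \<eta>)\<^sup>2 \<le> 2 powr s * m \<eta> * w0 (- \<eta> + \<xi>) * (b \<eta>)\<^sup>2"
        by (rule mult_right_mono) simp
      then show "ennreal (m \<xi>) * ennreal (w (\<xi> - \<eta>) * (b \<eta>)\<^sup>2) \<le> ennreal (2 powr s) * ennreal (m \<eta> * (b \<eta>)\<^sup>2) * ennreal (w0 (- \<eta> + \<xi>))"
        using order_trans[OF w(1,2), of "- \<eta> + \<xi>"]
        by (simp add: ennreal_mult[symmetric] w mult_ac ennreal_leI)
    qed
    also have "\<dots> = (\<integral>\<^sup>+\<eta>. ennreal (2 powr s) * ennreal (m \<eta> * (b \<eta>)\<^sup>2) * (\<integral>\<^sup>+\<xi>. ennreal (w0 (- \<eta> + \<xi>)) \<partial>lborel) \<partial>lborel)"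
      by (intro nn_integral_cong nn_integral_cmult) measurable
    also have "\<dots> = (\<integral>\<^sup>+\<eta>. ennreal (2 powr s * W) * ennreal (m \<eta> * (b \<eta>)\<^sup>2) \<partial>lborel)"
      by (intro nn_integral_cong, subst nn_integral_lborel_translate[of "\<lambda>z. ennreal (w0 z)"])
        (auto simp: W ennreal_mult mult_ac)
    also have "\<dots> = ennreal (2 powr s * W) * (\<integral>\<^sup>+\<eta>. ennreal (m \<eta> * (b \<eta>)\<^sup>2) \<partial>lborel)"
      by (rule nn_integral_cmult) measurable
    finally show ?thesis .
  qed
  obtain C1 where C1: "0 \<le> C1"
    "\<And>(a :: 'a \<Rightarrow> complex) w b \<xi>.
      \<lbrakk>integrable lborel a; w \<in> borel_measurable borel; b \<in> borel_measurable borel;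
       \<And>z. 0 \<le> w z; \<And>z. w z \<le> decay (2 * DIM('a)) z; \<And>\<eta>. 0 \<le> b \<eta>;
       \<And>\<eta>. norm (a \<eta>) \<le> w (\<xi> - \<eta>) * b \<eta>\<rbrakk> \<Longrightarrow>
      (\<integral>\<^sup>+t. ennreal ((norm (LBINT \<eta>. cis (t * norm \<eta>) * a \<eta>))\<^sup>2) \<partial>lborel)
      \<le> ennreal C1 * (\<integral>\<^sup>+\<eta>. ennreal (w (\<xi> - \<eta>) * (b \<eta>)\<^sup>2) \<partial>lborel)"
    by (rule time_integral_le) blast
  \<comment> \<open>\<open>C1\<close> belongs to the time integral and \<open>W\<close> to the
    pointwise bound; 2^s W is the cost of the Sobolev weight in \<open>weight\<close>.\<close>
  define C where "C = max C1 W * (2 powr s * W)"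
  have C: "0 \<le> C" using W C1(1) by (simp add: C_def)
  show ?thesis
  proof (rule that[OF C])
    fix K and F :: "'a \<Rightarrow> complex" and A :: real
    assume [measurable]: "(\<lambda>(\<xi>, \<eta>). K \<xi> \<eta>) \<in> borel_measurable (borel \<Otimes>\<^sub>M borel)"
      and F: "rapid F" and H: "\<And>t. rapid (propagate K F t)" and A: "0 \<le> A"
      and le: "\<And>\<xi> \<eta>. norm (K \<xi> \<eta>) \<le> A * decay (2 * DIM('a) + 2 * nat \<lceil>s\<rceil>) (\<xi> - \<eta>)"
    note [measurable] = rapid_measurable[OF F]
    define b where "b \<eta> = A * norm (F \<eta>)" for \<eta>
    have [measurable]: "b \<in> borel_measurable borel" unfolding b_def by measurable
    have b: "0 \<le> b \<eta>" for \<eta> using A by (simp add: b_def)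
    have le': "norm (K \<xi> \<eta> * F \<eta>) \<le> w (\<xi> - \<eta>) * b \<eta>" for \<xi> \<eta>
      using mult_right_mono[OF le[of \<xi> \<eta>], of "norm (F \<eta>)"] by (simp add: norm_mult w_def b_def mult_ac)
    let ?S = "\<lambda>\<xi>. \<integral>\<^sup>+\<eta>. ennreal (w (\<xi> - \<eta>) * (b \<eta>)\<^sup>2) \<partial>lborel"
    have final: "(\<integral>\<^sup>+\<xi>. ennreal (m \<xi>) * (ennreal (max C1 W) * ?S \<xi>) \<partial>lborel) \<le> ennreal (C * A\<^sup>2 * energy s F)"
    proof -
      have "(\<integral>\<^sup>+\<xi>. ennreal (m \<xi>) * (ennreal (max C1 W) * ?S \<xi>) \<partial>lborel)
        = ennreal (max C1 W) * (\<integral>\<^sup>+\<xi>. ennreal (m \<xi>) * ?S \<xi> \<partial>lborel)"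
        by (subst nn_integral_cmult[symmetric]) (auto simp: mult_ac)
      also have "\<dots> \<le> ennreal (max C1 W) * (ennreal (2 powr s * W) * (\<integral>\<^sup>+\<eta>. ennreal (m \<eta> * (b \<eta>)\<^sup>2) \<partial>lborel))"
        by (intro mult_left_mono weight) auto
      also have "(\<integral>\<^sup>+\<eta>. ennreal (m \<eta> * (b \<eta>)\<^sup>2) \<partial>lborel) = ennreal (A\<^sup>2) * (\<integral>\<^sup>+\<eta>. ennreal (m \<eta> * (norm (F \<eta>))\<^sup>2) \<partial>lborel)"
        by (subst nn_integral_cmult[symmetric])
          (auto simp: b_def ennreal_mult[symmetric] w power_mult_distrib mult_ac)
      also have "(\<integral>\<^sup>+\<eta>. ennreal (m \<eta> * (norm (F \<eta>))\<^sup>2) \<partial>lborel) = ennreal (energy s F)"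
        unfolding m_def by (rule nn_integral_energy[OF F s])
      also have "ennreal (max C1 W) * (ennreal (2 powr s * W) * (ennreal (A\<^sup>2) * ennreal (energy s F))) = ennreal (C * A\<^sup>2 * energy s F)"
        using C1(1) W(2) by (simp add: C_def ennreal_mult[symmetric] energy_nonneg mult.assoc)
      finally show ?thesis .
    qed
    have E: "ennreal (energy s (propagate K F t)) = (\<integral>\<^sup>+\<xi>. ennreal (m \<xi>) * ennreal ((norm (propagate K F t \<xi>))\<^sup>2) \<partial>lborel)" for t
      unfolding nn_integral_energy[OF H s, symmetric] m_def by (simp add: ennreal_mult)
    have pointwise: "energy s (propagate K F t) \<le> C * A\<^sup>2 * energy s F" for t
    proof -
      have "ennreal ((norm (propagate K F t \<xi>))\<^sup>2) \<le> ennreal (max C1 W) * ?S \<xi>" for \<xi>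
      proof -
        \<comment> \<open>Cauchy-Schwarz with w split into two square roots: one factor has mass at
          most W, the other is \<open>?S \<xi>\<close>.\<close>
        have "ennreal (norm (propagate K F t \<xi>)) \<le> (\<integral>\<^sup>+\<eta>. ennreal (norm (cis (t * norm \<eta>) * (K \<xi> \<eta> * F \<eta>))) \<partial>lborel)"
          unfolding propagate_def by (rule ennreal_norm_integral_le)
        also have "\<dots> \<le> (\<integral>\<^sup>+\<eta>. ennreal (sqrt (w (\<xi> - \<eta>))) * ennreal (sqrt (w (\<xi> - \<eta>)) * b \<eta>) \<partial>lborel)"
          using le' by (intro nn_integral_mono) (simp add: ennreal_mult[symmetric] w b norm_mult mult.assoc[symmetric] ennreal_leI)
        finally have "(ennreal (norm (propagate K F t \<xi>)))\<^sup>2 \<le> (\<integral>\<^sup>+\<eta>. ennreal (sqrt (w (\<xi> - \<eta>))) * ennreal (sqrt (w (\<xi> - \<eta>)) * b \<eta>) \<partial>lborel)\<^sup>2"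
          by (rule power_mono) simp
        also have "\<dots> \<le> (\<integral>\<^sup>+\<eta>. (ennreal (sqrt (w (\<xi> - \<eta>))))\<^sup>2 \<partial>lborel) * (\<integral>\<^sup>+\<eta>. (ennreal (sqrt (w (\<xi> - \<eta>)) * b \<eta>))\<^sup>2 \<partial>lborel)"
          by (rule Cauchy_Schwarz_nn_integral) measurable
        also have "\<dots> = (\<integral>\<^sup>+\<eta>. ennreal (w (\<xi> - \<eta>)) \<partial>lborel) * ?S \<xi>"
          by (simp add: ennreal_power w b power_mult_distrib)
        also have "\<dots> \<le> ennreal (max C1 W) * ?S \<xi>"
        proof (rule mult_right_mono)
          have "(\<integral>\<^sup>+\<eta>. ennreal (w (\<xi> - \<eta>)) \<partial>lborel) \<le> (\<integral>\<^sup>+\<eta>. ennreal (w0 (\<xi> - \<eta>)) \<partial>lborel)"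
            by (intro nn_integral_mono ennreal_leI w)
          also have "\<dots> = ennreal W" unfolding W(1)[symmetric] by (rule nn_integral_lborel_reflect) measurable
          also have "\<dots> \<le> ennreal (max C1 W)" by (intro ennreal_leI) simp
          finally show "(\<integral>\<^sup>+\<eta>. ennreal (w (\<xi> - \<eta>)) \<partial>lborel) \<le> ennreal (max C1 W)" .
        qed simp
        finally show ?thesis by (simp add: ennreal_power)
      qed
      then have "ennreal (energy s (propagate K F t)) \<le> (\<integral>\<^sup>+\<xi>. ennreal (m \<xi>) * (ennreal (max C1 W) * ?S \<xi>) \<partial>lborel)"
        unfolding E by (intro nn_integral_mono mult_left_mono) auto
      also note final
      finally show ?thesis using C by (simp add: ennreal_le_iff energy_nonneg)
    qed
    have "(\<integral>\<^sup>+t. ennreal (energy s (propagate K F t)) \<partial>lborel)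
      = (\<integral>\<^sup>+t. (\<integral>\<^sup>+\<xi>. ennreal (m \<xi>) * ennreal ((norm (propagate K F t \<xi>))\<^sup>2) \<partial>lborel) \<partial>lborel)"
      unfolding E ..
    also have "\<dots> = (\<integral>\<^sup>+\<xi>. (\<integral>\<^sup>+t. ennreal (m \<xi>) * ennreal ((norm (propagate K F t \<xi>))\<^sup>2) \<partial>lborel) \<partial>lborel)"
      unfolding propagate_def by (rule lborel_pair.Fubini'[symmetric]) measurable
    also have "\<dots> = (\<integral>\<^sup>+\<xi>. ennreal (m \<xi>) * (\<integral>\<^sup>+t. ennreal ((norm (propagate K F t \<xi>))\<^sup>2) \<partial>lborel) \<partial>lborel)"
      unfolding propagate_def by (intro nn_integral_cong nn_integral_cmult) measurable
    also have "\<dots> \<le> (\<integral>\<^sup>+\<xi>. ennreal (m \<xi>) * (ennreal (max C1 W) * ?S \<xi>) \<partial>lborel)"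
    proof (intro nn_integral_mono mult_left_mono)
      fix \<xi>
      have "integrable lborel (\<lambda>\<eta>. K \<xi> \<eta> * F \<eta>)"
      proof (rule Bochner_Integration.integrable_bound[OF integrable_mult_right[OF integrable_norm[OF rapid_integrable[OF F]], of A]])
        have "w z \<le> 1" for z
          using w(2)[of z] by (rule order_trans) (auto simp: w0_def inverse_le_1_iff one_le_power)
        then show "AE \<eta> in lborel. norm (K \<xi> \<eta> * F \<eta>) \<le> norm (A * norm (F \<eta>))"
          using le'[of \<xi>] b by (intro AE_I2 order_trans[OF le']) (simp add: b_def[symmetric] mult_left_le_one_le w)
      qed measurable
      then have "(\<integral>\<^sup>+t. ennreal ((norm (propagate K F t \<xi>))\<^sup>2) \<partial>lborel) \<le> ennreal C1 * ?S \<xi>"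
        unfolding propagate_def
        by (rule C1(2)) (use w le' b in \<open>auto simp: w0_def\<close>)
      also have "\<dots> \<le> ennreal (max C1 W) * ?S \<xi>"
        by (intro mult_right_mono ennreal_leI) auto
      finally show "(\<integral>\<^sup>+t. ennreal ((norm (propagate K F t \<xi>))\<^sup>2) \<partial>lborel) \<le> ennreal (max C1 W) * ?S \<xi>" .
    qed simp
    also note final
    finally have "(\<integral>\<^sup>+t. ennreal (energy s (propagate K F t)) \<partial>lborel) \<le> ennreal (C * A\<^sup>2 * energy s F)" .
    with pointwise show "energy s (propagate K F t) \<le> C * A\<^sup>2 * energy s F \<and>
      (\<integral>\<^sup>+t. ennreal (energy s (propagate K F t)) \<partial>lborel) \<le> ennreal (C * A\<^sup>2 * energy s F)" for t by blast
  qed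
qed

section \<open>Localisation by a Gaussian\<close>

text \<open>The constant A does not depend on k. This comes from (4|z|)^k <= k! exp(4|z|), a single
  term of the exponential series; the linear exponent is then absorbed by part of the Gaussian. The
  base 4 is chosen so that a later factor 2^k still leaves geometric decay.\<close>

lemma gauss_kernel_power_bound:
  obtains A where "0 \<le> A"
    "\<And>k (z::'a::euclidean_space). gauss_kernel z * norm z ^ k \<le> A * (fact k / 4 ^ k) * decay N z"
proof -
  obtain C where C: "0 \<le> C" "\<And>z::'a. exp (- (norm ((1 / 2) *\<^sub>R z))\<^sup>2 / 2) \<le> C * decay N z"
    by (rule gauss_bracket_bound[of "1 / 2" N]) auto
  define c where "c = (2 * pi) powr (- real DIM('a) / 2)"
  have c: "0 \<le> c" by (simp add: c_def)
  show ?thesis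
  proof (rule that)
    \<comment> \<open>A Gaussian with exponent -|z|^2/8 is kept for the polynomial decay. The rest
      is 4r - 3r^2/8 with r = |z|, whose maximum 32/3 lies below 11.\<close>
    show "0 \<le> c * exp 11 * C" using c C by simp
    fix k and z :: 'a
    have "gauss_kernel z * norm z ^ k = gauss_kernel z * ((4 * norm z) ^ k / 4 ^ k)"
      by (simp add: power_mult_distrib)
    also have "\<dots> \<le> gauss_kernel z * (fact k * exp (4 * norm z) / 4 ^ k)"
      by (intro mult_left_mono divide_right_mono power_le_fact_exp) (auto simp: gauss_kernel_nonneg)
    also have "\<dots> = (c * (fact k / 4 ^ k)) * exp (4 * norm z - (norm z)\<^sup>2 / 2)"
    proof -
      have "exp (4 * norm z - (norm z)\<^sup>2 / 2) = exp (- (norm z)\<^sup>2 / 2) * exp (4 * norm z)"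
        by (simp add: mult_exp_exp)
      then show ?thesis by (simp add: gauss_kernel_def c_def mult_ac)
    qed
    also have "\<dots> \<le> (c * (fact k / 4 ^ k)) * exp (11 + - (norm ((1 / 2) *\<^sub>R z))\<^sup>2 / 2)"
    proof (intro mult_left_mono)
      have "0 \<le> (3 * norm z - 16)\<^sup>2" by simp
      then have "4 * norm z - (norm z)\<^sup>2 / 2 \<le> 11 + - (norm ((1 / 2) *\<^sub>R z))\<^sup>2 / 2"
        by (simp add: power2_diff power_mult_distrib power_divide)
      then show "exp (4 * norm z - (norm z)\<^sup>2 / 2) \<le> exp (11 + - (norm ((1 / 2) *\<^sub>R z))\<^sup>2 / 2)"
        by simp
    qed (use c in auto)
    also have "\<dots> = (c * (fact k / 4 ^ k) * exp 11) * exp (- (norm ((1 / 2) *\<^sub>R z))\<^sup>2 / 2)"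
      by (simp only: exp_add mult.assoc)
    also have "\<dots> \<le> (c * (fact k / 4 ^ k) * exp 11) * (C * decay N z)"
      using c by (intro mult_left_mono C) auto
    also have "\<dots> = c * exp 11 * C * (fact k / 4 ^ k) * decay N z"
      by (simp add: mult_ac)
    finally show "gauss_kernel z * norm z ^ k \<le> c * exp 11 * C * (fact k / 4 ^ k) * decay N z" .
  qed
qed

text \<open>The coefficient (i \<tau>)^k / k! is kept outside, so the kernel does not depend on
  \<tau> and \<open>propagate\<close> involves the starting time only.\<close>

definition wave_kernel :: "nat \<Rightarrow> 'a::euclidean_space \<Rightarrow> 'a \<Rightarrow> complex" where
  "wave_kernel k \<xi> \<eta> = of_real (gauss_kernel (\<xi> - \<eta>) * (norm \<eta> - norm \<xi>) ^ k)"

lemma wave_kernel_bound: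
  obtains A where "0 \<le> A"
    "\<And>k \<xi> (\<eta>::'a::euclidean_space). norm (wave_kernel k \<xi> \<eta>) \<le> A * (fact k / 4 ^ k) * decay N (\<xi> - \<eta>)"
proof -
  obtain A where A: "0 \<le> A"
    "\<And>k (z::'a). gauss_kernel z * norm z ^ k \<le> A * (fact k / 4 ^ k) * decay N z"
    by (rule gauss_kernel_power_bound[of N]) blast
  have "norm (wave_kernel k \<xi> \<eta>) \<le> A * (fact k / 4 ^ k) * decay N (\<xi> - \<eta>)" for k and \<xi> \<eta> :: 'a
  proof -
    have "\<bar>norm \<eta> - norm \<xi>\<bar> \<le> norm (\<xi> - \<eta>)"
      using norm_triangle_ineq3[of \<eta> \<xi>] by (simp add: norm_minus_commute)
    then have "norm (wave_kernel k \<xi> \<eta>) \<le> gauss_kernel (\<xi> - \<eta>) * norm (\<xi> - \<eta>) ^ k"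
      unfolding wave_kernel_def norm_of_real abs_mult power_abs
      by (intro mult_mono power_mono) (auto simp: gauss_kernel_nonneg)
    then show ?thesis using A(2) by (rule order_trans)
  qed
  with A(1) show ?thesis using that by blast
qed

lemma wave_kernel_measurable [measurable]:
  "(\<lambda>(\<xi>, \<eta>). wave_kernel k \<xi> \<eta>) \<in> borel_measurable (borel \<Otimes>\<^sub>M borel)"
  unfolding wave_kernel_def by measurable

lemma rapid_propagate_wave_kernel:
  fixes F :: "'a::euclidean_space \<Rightarrow> complex"
  assumes "rapid F"
  shows "rapid (propagate (wave_kernel k) F t)"
proof (rule rapid_propagate[OF assms])
  show "continuous_on UNIV (\<lambda>\<xi>. wave_kernel k \<xi> \<eta>)" for \<eta> :: 'a
    unfolding wave_kernel_def by (intro continuous_intros)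
  show "wave_kernel k \<xi> \<in> borel_measurable borel" for \<xi> :: 'a
    unfolding wave_kernel_def by measurable
  show "\<exists>A\<ge>0. \<forall>\<xi> \<eta>::'a. norm (wave_kernel k \<xi> \<eta>) \<le> A * decay N (\<xi> - \<eta>)" for N
  proof -
    obtain A where "0 \<le> A"
      "\<And>k \<xi> (\<eta>::'a). norm (wave_kernel k \<xi> \<eta>) \<le> A * (fact k / 4 ^ k) * decay N (\<xi> - \<eta>)"
      by (rule wave_kernel_bound[of N]) blast
    then show ?thesis by (intro exI[of _ "A * (fact k / 4 ^ k)"]) auto
  qed
qed

lemma sums_integral_dominated:
  fixes f :: "nat \<Rightarrow> 'a \<Rightarrow> 'b::{banach, second_countable_topology}"
  assumes meas: "\<And>k. f k \<in> borel_measurable M"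
    and le: "\<And>k x. norm (f k x) \<le> c k * g x" and c: "summable c" "\<And>k. 0 \<le> c k" and g: "integrable M g"
    and sums: "\<And>x. (\<lambda>k. f k x) sums h x"
  shows "(\<lambda>k. integral\<^sup>L M (f k)) sums integral\<^sup>L M h"
proof -
  have i: "integrable M (f k)" for k
    by (rule Bochner_Integration.integrable_bound[OF integrable_mult_right[OF g, of "c k"] meas])
      (intro AE_I2 order_trans[OF le], simp)
  have "(\<lambda>k. integral\<^sup>L M (f k)) sums (\<integral>x. (\<Sum>k. f k x) \<partial>M)"
  proof (rule sums_integral[OF i])
    show "AE x in M. summable (\<lambda>k. norm (f k x))"
    proof (intro AE_I2)
      fix x show "summable (\<lambda>k. norm (f k x))"
        by (rule summable_comparison_test'[OF summable_mult2[OF c(1), of "g x"], of 0]) (simp add: le)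
    qed
    show "summable (\<lambda>k. \<integral>x. norm (f k x) \<partial>M)"
    proof (rule summable_comparison_test'[OF summable_mult2[OF c(1), of "integral\<^sup>L M g"], of 0])
      fix k
      have "(\<integral>x. norm (f k x) \<partial>M) \<le> (\<integral>x. c k * g x \<partial>M)"
        by (intro integral_mono integrable_norm i integrable_mult_right g le)
      then show "norm (\<integral>x. norm (f k x) \<partial>M) \<le> c k * integral\<^sup>L M g" by simp
    qed
  qed
  moreover have "(\<Sum>k. f k x) = h x" for x using sums[of x] by (rule sums_unique[symmetric])
  ultimately show ?thesis by simp
qed

text \<open>The Gaussian is the characteristic function of \<open>gauss_kernel\<close>, so
  multiplication by it turns into convolution of the transform.\<close>

lemma gauss_times_ift:
  fixes G :: "'a::euclidean_space \<Rightarrow> complex"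
  assumes G: "rapid G"
  shows "of_real (exp (- (norm x)\<^sup>2 / 2)) * ift G x = ift (\<lambda>\<xi>. \<integral>\<eta>. of_real (gauss_kernel (\<xi> - \<eta>)) * G \<eta> \<partial>lborel) x"
proof -
  note [measurable] = rapid_measurable[OF G]
  obtain A where A: "0 \<le> A" "\<And>z::'a. gauss_kernel z \<le> A * decay (2 * DIM('a)) z"
    by (rule gauss_kernel_bracket_bound[of "2 * DIM('a)"]) blast
  have "(LBINT \<xi>. cis (x \<bullet> \<xi>) * (LBINT \<eta>. of_real (gauss_kernel (\<xi> - \<eta>)) * G \<eta>))
    = (LBINT \<xi>. (LBINT \<eta>. cis (x \<bullet> \<xi>) * (of_real (gauss_kernel (\<xi> - \<eta>)) * G \<eta>)))"
    by simp
  also have "\<dots> = (LBINT \<eta>. (LBINT \<xi>. cis (x \<bullet> \<xi>) * (of_real (gauss_kernel (\<xi> - \<eta>)) * G \<eta>)))"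
  proof (rule Fubini_dominated)
    show "integrable lborel (\<lambda>\<xi>::'a. A * decay (2 * DIM('a)) \<xi>)"
      by (intro integrable_mult_right integrable_inverse_bracket)
    show "integrable lborel (\<lambda>\<eta>. (1 + norm \<eta>) ^ (2 * DIM('a)) * norm (G \<eta>))"
      by (rule integrable_bracket_rapid[OF G])
    fix \<xi> \<eta> :: 'a
    have "gauss_kernel (\<xi> - \<eta>) \<le> A * ((1 + norm \<eta>) ^ (2 * DIM('a)) * decay (2 * DIM('a)) \<xi>)"
      by (rule order_trans[OF A(2) mult_left_mono[OF bracket_convolution_le A(1)]])
    from mult_right_mono[OF this, of "norm (G \<eta>)"]
    show "norm (cis (x \<bullet> \<xi>) * (of_real (gauss_kernel (\<xi> - \<eta>)) * G \<eta>))
      \<le> A * decay (2 * DIM('a)) \<xi> * ((1 + norm \<eta>) ^ (2 * DIM('a)) * norm (G \<eta>))"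
      by (simp add: norm_mult gauss_kernel_nonneg mult_ac)
  qed measurable
  also have "\<dots> = (LBINT \<eta>. of_real (exp (- (norm x)\<^sup>2 / 2)) * (cis (x \<bullet> \<eta>) * G \<eta>))"
  proof (rule integral_ext)
    fix \<eta>
    have "(LBINT \<xi>. cis (x \<bullet> \<xi>) * (of_real (gauss_kernel (\<xi> - \<eta>)) * G \<eta>))
      = (LBINT \<xi>. cis (x \<bullet> (\<eta> + \<xi>)) * (of_real (gauss_kernel (\<eta> + \<xi> - \<eta>)) * G \<eta>))"
      by (rule integral_lborel_translate[symmetric]) measurable
    also have "\<dots> = (LBINT \<xi>. (cis (x \<bullet> \<eta>) * G \<eta>) * (cis (x \<bullet> \<xi>) * of_real (gauss_kernel \<xi>)))"
      by (rule integral_ext) (simp add: inner_add_right cis_mult[symmetric] mult_ac)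
    also have "\<dots> = (cis (x \<bullet> \<eta>) * G \<eta>) * of_real (exp (- (norm x)\<^sup>2 / 2))"
      by (simp only: integral_mult_right_zero integral_cis_gauss_kernel)
    finally show "(LBINT \<xi>. cis (x \<bullet> \<xi>) * (of_real (gauss_kernel (\<xi> - \<eta>)) * G \<eta>))
      = of_real (exp (- (norm x)\<^sup>2 / 2)) * (cis (x \<bullet> \<eta>) * G \<eta>)" by (simp add: mult_ac)
  qed
  also have "\<dots> = of_real (exp (- (norm x)\<^sup>2 / 2)) * (LBINT \<eta>. cis (x \<bullet> \<eta>) * G \<eta>)"
    by (rule integral_mult_right_zero)
  finally show ?thesis by (simp add: ift_def)
qed

text \<open>Multiplication by a Gaussian nearly commutes with the short time propagator: the
  commutator has phase \<open>\<tau> * (norm \<eta> - norm \<xi>)\<close>, where \<open>\<xi> - \<eta>\<close> is a frequency of the Gaussian,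
  and expanding the exponential separates \<open>\<tau>\<close> from the frequencies.\<close>

lemma gauss_wave_sums:
  fixes F :: "'a::euclidean_space \<Rightarrow> complex"
  assumes F: "rapid F" and \<tau>: "\<bar>\<tau>\<bar> \<le> 1"
  shows "(\<lambda>k. ((\<i> * of_real \<tau>) ^ k / fact k) * ift (phase \<tau> (propagate (wave_kernel k) F t)) x)
    sums (of_real (exp (- (norm x)\<^sup>2 / 2)) * ift (phase (t + \<tau>) F) x)"
proof -
  note [measurable] = rapid_measurable[OF F]
  let ?D = "2 * DIM('a)"
  let ?c = "\<lambda>k. (\<i> * of_real \<tau>) ^ k / fact k" and ?P = "\<lambda>k. propagate (wave_kernel k) F t"
    and ?Q = "\<lambda>k \<xi> \<eta>. cis (\<tau> * norm \<xi>) * (cis (t * norm \<eta>) * (wave_kernel k \<xi> \<eta> * F \<eta>))"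
  obtain A where A: "0 \<le> A"
    "\<And>k \<xi> (\<eta>::'a). norm (wave_kernel k \<xi> \<eta>) \<le> A * (fact k / 4 ^ k) * decay ?D (\<xi> - \<eta>)"
    by (rule wave_kernel_bound[of ?D]) blast
  have co: "norm (?c k) \<le> 1 / fact k" for k
    using \<tau> by (simp add: norm_divide norm_power norm_mult power_le_one divide_right_mono)
  \<comment> \<open>The 1/k! of the series cancels the k! of the kernel bound. What remains is
    geometric of ratio 1/4 and dominates both interchanges of sum and integral.\<close>
  have sum4: "summable (\<lambda>k. (1 / 4 :: real) ^ k)" by (rule summable_geometric) simp
  define U where "U \<xi> = (LBINT \<eta>. of_real (gauss_kernel (\<xi> - \<eta>)) * (cis ((t + \<tau>) * norm \<eta>) * F \<eta>))" for \<xi>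
  have U: "(\<lambda>k. ?c k * (cis (\<tau> * norm \<xi>) * ?P k \<xi>)) sums U \<xi>" for \<xi>
  proof -
    have "(\<lambda>k. \<integral>\<eta>. ?c k * ?Q k \<xi> \<eta> \<partial>lborel) sums U \<xi>"
      unfolding U_def
    proof (rule sums_integral_dominated[OF _ _ sum4])
      show "integrable lborel (\<lambda>\<eta>. A * norm (F \<eta>))"
        by (intro integrable_mult_right integrable_norm rapid_integrable F)
      fix k \<eta>
      have "norm (wave_kernel k \<xi> \<eta>) \<le> A * (fact k / 4 ^ k) * 1"
        using A(1) by (intro order_trans[OF A(2)] mult_left_mono) (auto simp: inverse_le_1_iff one_le_power)
      then have "norm (?c k * ?Q k \<xi> \<eta>)
        \<le> 1 / fact k * ((A * (fact k / 4 ^ k) * 1) * norm (F \<eta>))"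
        unfolding norm_mult norm_cis mult_1 using A(1)
        by (intro mult_mono co mult_right_mono) auto
      also have "\<dots> = (1 / 4) ^ k * (A * norm (F \<eta>))" by (simp add: power_divide)
      finally show "norm (?c k * ?Q k \<xi> \<eta>)
        \<le> (1 / 4) ^ k * (A * norm (F \<eta>))" .
    next
      fix \<eta> :: 'a
      let ?\<theta> = "\<tau> * (norm \<eta> - norm \<xi>)"
      have pw: "(\<i> * of_real ?\<theta>) ^ k = (\<i> * of_real \<tau>) ^ k * of_real ((norm \<eta> - norm \<xi>) ^ k)" for k
        by (simp only: of_real_mult mult.assoc[symmetric] power_mult_distrib of_real_power)
      have "(\<lambda>k. (\<i> * of_real ?\<theta>) ^ k /\<^sub>R fact k) sums cis ?\<theta>"
        unfolding cis_conv_exp by (rule exp_converges)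
      from sums_mult2[OF this, of "cis (\<tau> * norm \<xi>) * cis (t * norm \<eta>) * of_real (gauss_kernel (\<xi> - \<eta>)) * F \<eta>"]
      have "(\<lambda>k. ?c k * ?Q k \<xi> \<eta>) sums
        (cis ?\<theta> * (cis (\<tau> * norm \<xi>) * cis (t * norm \<eta>) * of_real (gauss_kernel (\<xi> - \<eta>)) * F \<eta>))"
        unfolding pw by (simp add: wave_kernel_def scaleR_conv_of_real divide_inverse mult_ac)
      also have "cis ?\<theta> * (cis (\<tau> * norm \<xi>) * cis (t * norm \<eta>) * of_real (gauss_kernel (\<xi> - \<eta>)) * F \<eta>)
        = (cis ?\<theta> * cis (\<tau> * norm \<xi>) * cis (t * norm \<eta>)) * (of_real (gauss_kernel (\<xi> - \<eta>)) * F \<eta>)"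
        by (simp add: mult_ac)
      \<comment> \<open>The phases add up as \<tau>(|\<eta>| - |\<xi>|) + \<tau>|\<xi>| + t|\<eta>|
        = (t + \<tau>)|\<eta>|.\<close>
      also have "cis ?\<theta> * cis (\<tau> * norm \<xi>) * cis (t * norm \<eta>) = cis ((t + \<tau>) * norm \<eta>)"
        unfolding cis_mult by (simp add: algebra_simps)
      also have "cis ((t + \<tau>) * norm \<eta>) * (of_real (gauss_kernel (\<xi> - \<eta>)) * F \<eta>) = of_real (gauss_kernel (\<xi> - \<eta>)) * (cis ((t + \<tau>) * norm \<eta>) * F \<eta>)"
        by (simp add: mult_ac)
      finally show "(\<lambda>k. ?c k * ?Q k \<xi> \<eta>) sums
        (of_real (gauss_kernel (\<xi> - \<eta>)) * (cis ((t + \<tau>) * norm \<eta>) * F \<eta>))" .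
    qed (auto simp: wave_kernel_def)
    then show ?thesis by (simp add: propagate_def)
  qed
  define B where "B = (LBINT \<eta>. (1 + norm \<eta>) ^ ?D * norm (F \<eta>))"
  have B: "0 \<le> B" unfolding B_def by simp
  have H: "norm (?P k \<xi>) \<le> A * (fact k / 4 ^ k) * B * decay ?D \<xi>" for k \<xi>
    unfolding B_def by (rule norm_propagate_le[OF F _ A(2)]) (use A(1) in auto)
  have [measurable]: "propagate (wave_kernel k) F t \<in> borel_measurable borel" for k
    by (rule rapid_measurable[OF rapid_propagate_wave_kernel[OF F]])
  have "(\<lambda>k. \<integral>\<xi>. cis (x \<bullet> \<xi>) * (?c k * (cis (\<tau> * norm \<xi>) * ?P k \<xi>)) \<partial>lborel)
    sums (LBINT \<xi>. cis (x \<bullet> \<xi>) * U \<xi>)"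
  proof (rule sums_integral_dominated[OF _ _ sum4])
    show "integrable lborel (\<lambda>\<xi>::'a. A * B * decay ?D \<xi>)"
      by (intro integrable_mult_right integrable_inverse_bracket)
    show "(\<lambda>k. cis (x \<bullet> \<xi>) * (?c k * (cis (\<tau> * norm \<xi>) * ?P k \<xi>))) sums (cis (x \<bullet> \<xi>) * U \<xi>)" for \<xi>
      by (rule sums_mult[OF U])
    fix k \<xi>
    have "norm (cis (x \<bullet> \<xi>) * (?c k * (cis (\<tau> * norm \<xi>) * ?P k \<xi>)))
      \<le> 1 / fact k * (A * (fact k / 4 ^ k) * B * decay ?D \<xi>)"
      unfolding norm_mult norm_cis mult_1 by (intro mult_mono co H) auto
    also have "\<dots> = (1 / 4) ^ k * (A * B * decay ?D \<xi>)" by (simp add: power_divide)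
    finally show "norm (cis (x \<bullet> \<xi>) * (?c k * (cis (\<tau> * norm \<xi>) * ?P k \<xi>)))
      \<le> (1 / 4) ^ k * (A * B * decay ?D \<xi>)" .
  qed auto
  from sums_scaleR_right[OF this, of "1 / (2 * pi) ^ DIM('a)"]
  have "(\<lambda>k. ift (\<lambda>\<xi>. ?c k * (cis (\<tau> * norm \<xi>) * ?P k \<xi>)) x) sums ift U x"
    unfolding ift_def .
  moreover have "ift U x = of_real (exp (- (norm x)\<^sup>2 / 2)) * ift (phase (t + \<tau>) F) x"
    unfolding gauss_times_ift[OF rapid_cis[OF F]] U_def ..
  ultimately show ?thesis unfolding ift_mult by simp
qed

text \<open>The weights (1/2)^(k+1) sum to 1, so the series is a mean value of the c k and cannot
  reach N if they all stay strictly below it.\<close>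

lemma exists_term_ge:
  fixes c :: "nat \<Rightarrow> real"
  assumes s: "summable (\<lambda>k. (1 / 2) ^ Suc k * c k)" and N: "N \<le> (\<Sum>k. (1 / 2) ^ Suc k * c k)"
  shows "\<exists>k. N \<le> c k"
proof (rule ccontr)
  assume "\<not> ?thesis"
  then have lt: "c k < N" for k by (simp add: not_le)
  have s': "(\<lambda>k. (1 / 2) ^ Suc k * N) sums (1 * N)"
    by (rule sums_mult2[OF power_half_series])
  have "0 < (\<Sum>k. (1 / 2) ^ Suc k * N - (1 / 2) ^ Suc k * c k)"
  proof (rule suminf_pos)
    show "summable (\<lambda>k. (1 / 2) ^ Suc k * N - (1 / 2) ^ Suc k * c k)"
      by (intro summable_diff s sums_summable[OF s'])
    show "0 < (1 / 2) ^ Suc k * N - (1 / 2) ^ Suc k * c k" for k using lt[of k] by simp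
  qed
  also have "\<dots> = N - (\<Sum>k. (1 / 2) ^ Suc k * c k)"
    using suminf_diff[OF sums_summable[OF s'] s] sums_unique[OF s'] by simp
  finally show False using N by simp
qed

text \<open>For each \<tau> a single index k dominates the series, so the power q can be taken
  termwise. That index depends on \<tau>, and summing over all k on the right removes the
  dependence. In the coefficient, exp(1/2) inverts the Gaussian on the unit ball, 2^(k+1) undoes the
  averaging weights, and 1/k! is from the exponential series.\<close>

lemma wave_sup_translate_le:
  fixes F :: "'a::euclidean_space \<Rightarrow> complex"
  assumes F: "rapid F" and q: "0 < q" and x: "norm x \<le> 1"
  shows "wave_sup q {0<..<1} (phase t F) x
    \<le> (\<Sum>k. ennreal ((exp (1 / 2) * 2 ^ Suc k / fact k) powr q) * wave_sup q {0<..<1} (propagate (wave_kernel k) F t) x)"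
  unfolding wave_sup_def[of q "{0<..<1}" "\<lambda>\<xi>. cis (t * norm \<xi>) * F \<xi>"]
proof (rule SUP_least)
  fix \<tau> :: real assume \<tau>: "\<tau> \<in> {0<..<1}"
  define v where "v k = norm (ift (phase \<tau> (propagate (wave_kernel k) F t)) x)" for k
  define d :: "nat \<Rightarrow> real" where "d k = exp (1 / 2) * 2 ^ Suc k / fact k" for k
  let ?N = "norm (ift (\<lambda>\<xi>. cis (\<tau> * norm \<xi>) * (cis (t * norm \<xi>) * F \<xi>)) x)"
  obtain A where A: "0 \<le> A"
    "\<And>k \<xi> (\<eta>::'a). norm (wave_kernel k \<xi> \<eta>) \<le> A * (fact k / 4 ^ k) * decay (2 * DIM('a)) (\<xi> - \<eta>)"
    by (rule wave_kernel_bound[of "2 * DIM('a)"]) blast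
  let ?S = "\<lambda>k. ((\<i> * of_real \<tau>) ^ k / fact k) * ift (phase \<tau> (propagate (wave_kernel k) F t)) x"
  have sums: "?S sums (of_real (exp (- (norm x)\<^sup>2 / 2)) * ift (phase (t + \<tau>) F) x)"
    by (rule gauss_wave_sums[OF F]) (use \<tau> in auto)
  have nS: "norm (?S k) \<le> 1 / fact k * v k" for k
    unfolding norm_mult v_def using \<tau>
    by (intro mult_right_mono) (auto simp: norm_divide norm_power norm_mult power_le_one divide_right_mono)
  \<comment> \<open>\<open>B\<close> serves to make the series of the \<open>v k\<close> summable,
    which the selection of a dominating term presupposes; it does not enter the final bound.\<close>
  define B where "B = (1 / (2 * pi) ^ DIM('a)) * (LBINT \<xi>. A * (LBINT \<eta>. (1 + norm \<eta>) ^ (2 * DIM('a)) * norm (F \<eta>)) * decay (2 * DIM('a)) (\<xi>::'a))"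
  have v: "v k \<le> (fact k / 4 ^ k) * B" for k
  proof -
    let ?I = "\<integral>\<eta>. (1 + norm \<eta>) ^ (2 * DIM('a)) * norm (F \<eta>) \<partial>lborel"
    have H: "norm (propagate (wave_kernel k) F t \<xi>) \<le> A * (fact k / 4 ^ k) * ?I * decay (2 * DIM('a)) \<xi>" for \<xi>
      by (rule norm_propagate_le[OF F _ A(2)]) (use A(1) in auto)
    have "v k \<le> (1 / (2 * pi) ^ DIM('a)) * (LBINT \<xi>. norm (cis (\<tau> * norm \<xi>) * propagate (wave_kernel k) F t \<xi>))"
      unfolding v_def by (rule norm_ift_le)
    also have "\<dots> \<le> (1 / (2 * pi) ^ DIM('a)) * (LBINT \<xi>. (fact k / 4 ^ k) * (A * ?I * decay (2 * DIM('a)) (\<xi>::'a)))"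
    proof (intro mult_left_mono integral_mono)
      show "integrable lborel (\<lambda>\<xi>. norm (cis (\<tau> * norm \<xi>) * propagate (wave_kernel k) F t \<xi>))"
        by (intro integrable_norm rapid_integrable rapid_cis rapid_propagate_wave_kernel F)
      show "integrable lborel (\<lambda>\<xi>::'a. (fact k / 4 ^ k) * (A * ?I * decay (2 * DIM('a)) \<xi>))"
        by (intro integrable_mult_right integrable_inverse_bracket)
      show "norm (cis (\<tau> * norm \<xi>) * propagate (wave_kernel k) F t \<xi>) \<le> (fact k / 4 ^ k) * (A * ?I * decay (2 * DIM('a)) \<xi>)" for \<xi>
        using H[of \<xi>] by (simp add: norm_mult mult_ac)
    qed simp
    also have "\<dots> = (fact k / 4 ^ k) * B"
      unfolding B_def by (subst integral_mult_right_zero) (simp add: mult_ac)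
    finally show ?thesis .
  qed
  have sv: "summable (\<lambda>k. 1 / fact k * v k)"
  proof (rule summable_comparison_test')
    show "summable (\<lambda>k. (1 / 4) ^ k * B)" by (intro summable_mult2 summable_geometric) simp
    fix k :: nat
    have "1 / fact k * v k \<le> 1 / fact k * ((fact k / 4 ^ k) * B)" by (intro mult_left_mono v) simp
    then show "norm (1 / fact k * v k) \<le> (1 / 4) ^ k * B" by (simp add: power_divide v_def)
  qed
  \<comment> \<open>On the unit ball the Gaussian is at least exp(-1/2), so the localisation can be
    undone.\<close>
  have "?N * exp (- (1 / 2)) \<le> ?N * exp (- (norm x)\<^sup>2 / 2)"
    using x by (intro mult_left_mono) (auto simp: power_le_one)
  also have "\<dots> = norm (\<Sum>k. ?S k)"
    unfolding sums_unique[OF sums, symmetric] norm_mult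
    by (simp add: mult.assoc[symmetric] cis_mult distrib_right add.commute)
  also have "\<dots> \<le> (\<Sum>k. 1 / fact k * v k)"
    by (rule norm_suminf_le) (use sv nS in auto)
  finally have "?N \<le> exp (1 / 2) * (\<Sum>k. 1 / fact k * v k)"
    by (simp add: exp_minus field_simps)
  also have "\<dots> = (\<Sum>k. exp (1 / 2) * (1 / fact k * v k))" by (rule suminf_mult[OF sv, symmetric])
  also have "(\<lambda>k. exp (1 / 2) * (1 / fact k * v k)) = (\<lambda>k. (1 / 2) ^ Suc k * (d k * v k))"
    by (simp add: d_def power_divide)
  finally have le: "?N \<le> (\<Sum>k. (1 / 2) ^ Suc k * (d k * v k))" .
  have "summable (\<lambda>k. exp (1 / 2) * (1 / fact k * v k))" by (rule summable_mult[OF sv])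
  then have "summable (\<lambda>k. (1 / 2) ^ Suc k * (d k * v k))"
    by (simp add: d_def power_divide)
  from exists_term_ge[OF this le] obtain k where k: "?N \<le> d k * v k" by blast
  have "ennreal (?N powr q) \<le> ennreal ((d k * v k) powr q)"
    using k q by (intro ennreal_leI powr_mono2) auto
  also have "\<dots> = ennreal (d k powr q) * ennreal (v k powr q)"
    by (simp add: powr_mult ennreal_mult)
  also have "\<dots> \<le> ennreal (d k powr q) * wave_sup q {0<..<1} (propagate (wave_kernel k) F t) x"
    unfolding v_def wave_sup_def by (intro mult_left_mono SUP_upper \<tau>) simp
  also have "\<dots> \<le> (\<Sum>k. ennreal (d k powr q) * wave_sup q {0<..<1} (propagate (wave_kernel k) F t) x)"
    using sum_le_suminf[of "\<lambda>k. ennreal (d k powr q) * wave_sup q {0<..<1} (propagate (wave_kernel k) F t) x" "{k}"]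
    by auto
  finally show "ennreal (?N powr q) \<le> (\<Sum>k. ennreal ((exp (1 / 2) * 2 ^ Suc k / fact k) powr q) * wave_sup q {0<..<1} (propagate (wave_kernel k) F t) x)"
    unfolding d_def .
qed

section \<open>From local to global times\<close>

lemma continuous_on_ift_time:
  fixes F :: "'a::euclidean_space \<Rightarrow> complex"
  assumes F: "rapid F"
  shows "continuous_on UNIV (\<lambda>p. ift (\<lambda>\<xi>. cis (fst p * norm \<xi>) * F \<xi>) (snd p))"
  unfolding ift_def
proof (intro continuous_on_scaleR continuous_on_const continuous_on_integral_dominated)
  note [measurable] = rapid_measurable[OF F]
  show "integrable lborel (\<lambda>\<xi>. norm (F \<xi>))" by (intro integrable_norm rapid_integrable F)
  show "continuous_on UNIV (\<lambda>p. cis (snd p \<bullet> \<xi>) * (cis (fst p * norm \<xi>) * F \<xi>))" for \<xi> :: 'a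
    by (intro continuous_intros)
  show "(\<lambda>\<xi>. cis (snd p \<bullet> \<xi>) * (cis (fst p * norm \<xi>) * F \<xi>)) \<in> borel_measurable borel" for p :: "real \<times> 'a"
    by measurable
qed (auto simp: norm_mult)

text \<open>For each \<tau> the function is continuous jointly in (t, x), so the supremum over
  \<tau> is lower semicontinuous. This provides the joint measurability for exchanging the t- and
  x-integrals.\<close>

lemma wave_sup_translate_measurable:
  fixes F :: "'a::euclidean_space \<Rightarrow> complex"
  assumes F: "rapid F" and q: "0 < q"
  shows "(\<lambda>(t, x). wave_sup q I (phase t F) x) \<in> borel_measurable (borel \<Otimes>\<^sub>M borel)"
proof -
  have "(\<lambda>p :: real \<times> 'a. SUP \<tau>\<in>I. ennreal (norm (ift (\<lambda>\<xi>. cis (fst p * norm \<xi>) * (cis (\<tau> * norm \<xi>) * F \<xi>)) (snd p)) powr q))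
    \<in> borel_measurable borel"
    using q by (intro borel_measurable_SUP_continuous continuous_on_ennreal continuous_on_powr'
        continuous_on_norm continuous_on_ift_time rapid_cis F continuous_on_const) auto
  then show ?thesis
    by (simp add: borel_prod wave_sup_def split_beta' mult.left_commute)
qed

text \<open>A time r is reached from every starting time t in (r - 1, r), because then r - t lies in
  (0, 1). These starting times form a set of measure 1.\<close>

lemma wave_sup_UNIV_le:
  fixes F :: "'a::euclidean_space \<Rightarrow> complex"
  shows "wave_sup q UNIV F x \<le> (\<integral>\<^sup>+t. wave_sup q {0<..<1} (phase t F) x \<partial>lborel)"
  unfolding wave_sup_def[of q UNIV]
proof (rule SUP_least)
  fix r :: real
  let ?c = "ennreal (norm (ift (phase r F) x) powr q)"
  have "?c = (\<integral>\<^sup>+t. ?c * indicator {r - 1<..<r} t \<partial>lborel)"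
    by (subst nn_integral_cmult_indicator) auto
  also have "\<dots> \<le> (\<integral>\<^sup>+t. wave_sup q {0<..<1} (phase t F) x \<partial>lborel)"
  proof (intro nn_integral_mono)
    fix t
    have "?c \<le> wave_sup q {0<..<1} (phase t F) x" if t: "t \<in> {r - 1<..<r}"
      unfolding wave_sup_def
    proof (rule SUP_upper2)
      show "r - t \<in> {0<..<1}" using t by auto
      show "?c \<le> ennreal (norm (ift (\<lambda>\<xi>. cis ((r - t) * norm \<xi>) * (cis (t * norm \<xi>) * F \<xi>)) x) powr q)"
        by (simp add: mult.assoc[symmetric] cis_mult left_diff_distrib)
    qed
    then show "?c * indicator {r - 1<..<r} t \<le> wave_sup q {0<..<1} (phase t F) x"
      by (simp split: split_indicator)
  qed
  finally show "?c \<le> (\<integral>\<^sup>+t. wave_sup q {0<..<1} (phase t F) x \<partial>lborel)" .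
qed

text \<open>Interpolation between L^1 and L^\<infinity>: of the power q/2, all but one factor of e t
  is replaced by the bound M. The exponent q/2 - 1 has to be nonnegative, which is where q >= 2
  enters.\<close>

lemma nn_integral_powr_half_le:
  fixes e :: "'a::euclidean_space \<Rightarrow> real"
  assumes q: "2 \<le> q" and M: "0 \<le> M" and le: "\<And>t. e t \<le> M" and e: "\<And>t. 0 \<le> e t"
    and [measurable]: "e \<in> borel_measurable borel" and int: "(\<integral>\<^sup>+t. ennreal (e t) \<partial>lborel) \<le> ennreal M"
  shows "(\<integral>\<^sup>+t. ennreal (e t powr (q / 2)) \<partial>lborel) \<le> ennreal (M powr (q / 2))"
proof -
  \<comment> \<open>At z = 0 both sides vanish, also for q = 2, since \<open>0 powr a\<close> is 0
    for every a.\<close>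
  have split: "z powr (q / 2) = z powr (q / 2 - 1) * z" if "0 \<le> z" for z :: real
    using that powr_add[of z "q / 2 - 1" 1] by simp
  have "(\<integral>\<^sup>+t. ennreal (e t powr (q / 2)) \<partial>lborel) \<le> (\<integral>\<^sup>+t. ennreal (M powr (q / 2 - 1)) * ennreal (e t) \<partial>lborel)"
  proof (intro nn_integral_mono)
    fix t
    have "e t powr (q / 2) \<le> M powr (q / 2 - 1) * e t"
      unfolding split[OF e] using q by (intro mult_right_mono powr_mono2 le e) auto
    then show "ennreal (e t powr (q / 2)) \<le> ennreal (M powr (q / 2 - 1)) * ennreal (e t)"
      by (simp add: ennreal_mult[symmetric] e ennreal_leI)
  qed
  also have "\<dots> = ennreal (M powr (q / 2 - 1)) * (\<integral>\<^sup>+t. ennreal (e t) \<partial>lborel)"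
    by (rule nn_integral_cmult) measurable
  also have "\<dots> \<le> ennreal (M powr (q / 2 - 1)) * ennreal M"
    by (intro mult_left_mono int) simp
  also have "\<dots> = ennreal (M powr (q / 2))"
    by (simp add: ennreal_mult[symmetric] M split[OF M])
  finally show ?thesis .
qed

text \<open>Global times are averaged over unit windows, each window is expanded in k, and the local
  estimate is applied to every \<open>propagate (wave_kernel k) F t\<close>. Its right-hand side is
  a power q/2 of the energy, whose integral over t is finite by local smoothing and
  interpolation.\<close>

lemma maximal_estimate_global:
  assumes est: "\<And>G :: 'a::euclidean_space \<Rightarrow> complex. rapid G \<Longrightarrow>
      sup_bound q s (ball 0 1) {0<..<1} K G"
    and K: "0 \<le> K" and s: "0 \<le> s" and q: "2 \<le> q"
  obtains K' where "0 \<le> K'" "\<And>F :: 'a \<Rightarrow> complex. rapid F \<Longrightarrow>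
      sup_bound q s (ball 0 1) UNIV K' F"
proof -
  have q0: "0 < q" using q by simp
  obtain C where C: "0 \<le> C"
    "\<And>k (F :: 'a::euclidean_space \<Rightarrow> complex) A t.
      \<lbrakk>(\<lambda>(\<xi>, \<eta>). k \<xi> \<eta>) \<in> borel_measurable (borel \<Otimes>\<^sub>M borel); rapid F; \<And>t. rapid (propagate k F t); 0 \<le> A;
       \<And>\<xi> \<eta>. norm (k \<xi> \<eta>) \<le> A * decay (2 * DIM('a) + 2 * nat \<lceil>s\<rceil>) (\<xi> - \<eta>)\<rbrakk> \<Longrightarrow>
      energy s (propagate k F t) \<le> C * A\<^sup>2 * energy s F \<and>
      (\<integral>\<^sup>+t. ennreal (energy s (propagate k F t)) \<partial>lborel) \<le> ennreal (C * A\<^sup>2 * energy s F)"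
    by (rule propagate_energy_le[OF s]) blast
  obtain A where A: "0 \<le> A"
    "\<And>k \<xi> (\<eta>::'a). norm (wave_kernel k \<xi> \<eta>) \<le> A * (fact k / 4 ^ k) * decay (2 * DIM('a) + 2 * nat \<lceil>s\<rceil>) (\<xi> - \<eta>)"
    by (rule wave_kernel_bound[of "2 * DIM('a) + 2 * nat \<lceil>s\<rceil>"]) blast
  define d :: "nat \<Rightarrow> real" where "d k = exp (1 / 2) * 2 ^ Suc k / fact k" for k
  define A' where "A' k = A * (fact k / 4 ^ k)" for k :: nat
  have A': "0 \<le> A' k" for k using A(1) by (simp add: A'_def)
  \<comment> \<open>\<open>L\<close> collects the factors independent of k; the final constant
    \<open>2 * L\<close> comes from the geometric series of ratio 1/2.\<close>
  define L where "L = (2 * exp (1 / 2) * A) powr q * C powr (q / 2) * K"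
  have L: "0 \<le> L" using K by (simp add: L_def)
  show ?thesis
  proof (rule that)
    show "0 \<le> 2 * L" using L by simp
    fix F :: "'a \<Rightarrow> complex" assume F: "rapid F"
    note [measurable] = rapid_measurable[OF F]
    let ?E = "energy s F"
    let ?H = "\<lambda>k t. propagate (wave_kernel k) F t"
    have H: "rapid (?H k t)" for k t by (rule rapid_propagate_wave_kernel[OF F])
    have [measurable]: "(\<lambda>t. energy s (?H k t)) \<in> borel_measurable borel" for k
      unfolding energy_def propagate_def wave_kernel_def by measurable
    have meas: "(\<lambda>(t, x). wave_sup q {0<..<1} (phase t F) x) \<in> borel_measurable (borel \<Otimes>\<^sub>M borel)"
      by (rule wave_sup_translate_measurable[OF F q0])
    have meas_term: "(\<lambda>x. ennreal (d k powr q) * (wave_sup q {0<..<1} (?H k t) x * indicator (ball 0 1) x)) \<in> borel_measurable lborel" for k t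
      by (intro borel_measurable_times_ennreal borel_measurable_const borel_measurable_indicator)
        (simp_all add: borel_measurable_wave_sup[OF H q0])
    have term_le: "ennreal (d k powr q) * (ennreal K * (\<integral>\<^sup>+t. ennreal (energy s (?H k t) powr (q / 2)) \<partial>lborel))
      \<le> ennreal ((1 / 2) ^ k * (L * ?E powr (q / 2)))" for k
    proof -
      let ?M = "C * (A' k)\<^sup>2 * ?E"
      have M: "0 \<le> ?M" using C(1) by (simp add: energy_nonneg)
      have "(\<integral>\<^sup>+t. ennreal (energy s (?H k t) powr (q / 2)) \<partial>lborel) \<le> ennreal (?M powr (q / 2))"
      proof (rule nn_integral_powr_half_le[OF q M])
        show "energy s (?H k t) \<le> ?M" for t
          by (rule C(2)[THEN conjunct1, OF wave_kernel_measurable F H A' A(2)[folded A'_def]])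
        show "(\<integral>\<^sup>+t. ennreal (energy s (?H k t)) \<partial>lborel) \<le> ennreal ?M"
          by (rule C(2)[THEN conjunct2, OF wave_kernel_measurable F H A' A(2)[folded A'_def]])
      qed (auto simp: energy_nonneg)
      then have "ennreal (d k powr q) * (ennreal K * (\<integral>\<^sup>+t. ennreal (energy s (?H k t) powr (q / 2)) \<partial>lborel))
        \<le> ennreal (d k powr q) * (ennreal K * ennreal (?M powr (q / 2)))"
        by (intro mult_left_mono) auto
      also have "\<dots> = ennreal (d k powr q * (K * ?M powr (q / 2)))"
        using K by (simp add: ennreal_mult[symmetric])
      also have "d k powr q * (K * ?M powr (q / 2)) = (d k * A' k) powr q * (C powr (q / 2) * K * ?E powr (q / 2))"
      proof -
        have "((A' k)\<^sup>2) powr (q / 2) = A' k powr q"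
          using A'[of k] by (simp add: powr_powr flip: powr_numeral)
        then show ?thesis by (simp add: powr_mult mult_ac)
      qed
      also have "\<dots> \<le> (1 / 2) ^ k * (L * ?E powr (q / 2))"
      proof -
        \<comment> \<open>The factorials cancel, and 2^(k+1) / 4^k leaves 2 (1/2)^k.\<close>
        have "d k * A' k = (2 * exp (1 / 2) * A) * (1 / 2) ^ k"
        proof -
          have "(4::real) ^ k = 2 ^ k * 2 ^ k" by (simp flip: power_mult_distrib)
          then show ?thesis by (simp add: d_def A'_def field_simps)
        qed
        then have "(d k * A' k) powr q = (2 * exp (1 / 2) * A) powr q * ((1 / 2) ^ k) powr q"
          by (simp only: powr_mult)
        \<comment> \<open>As the base is at most 1 and q >= 1, the power q can be lowered to 1,
          which gives a geometric series that is the same for all q.\<close>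
        also have "((1 / 2 :: real) ^ k) powr q \<le> ((1 / 2) ^ k) powr 1"
          using q by (intro powr_mono') (auto simp: power_le_one)
        finally have "(d k * A' k) powr q \<le> (2 * exp (1 / 2) * A) powr q * (1 / 2) ^ k"
          by (simp add: mult_left_mono)
        then have "(d k * A' k) powr q * (C powr (q / 2) * K * ?E powr (q / 2))
          \<le> ((2 * exp (1 / 2) * A) powr q * (1 / 2) ^ k) * (C powr (q / 2) * K * ?E powr (q / 2))"
          using K by (intro mult_right_mono) auto
        then show ?thesis by (simp add: L_def mult_ac)
      qed
      finally show ?thesis by (simp add: ennreal_leI)
    qed
    have "(\<integral>\<^sup>+x\<in>ball 0 1. wave_sup q UNIV F x \<partial>lborel)
      \<le> (\<integral>\<^sup>+x. (\<integral>\<^sup>+t. wave_sup q {0<..<1} (phase t F) x * indicator (ball 0 1) x \<partial>lborel) \<partial>lborel)"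
    proof (intro nn_integral_mono)
      fix x :: 'a
      have "(\<lambda>t. wave_sup q {0<..<1} (phase t F) x) \<in> borel_measurable lborel"
        using measurable_compose[OF measurable_Pair2'[of x borel borel] meas] by simp
      then show "wave_sup q UNIV F x * indicator (ball 0 1) x
        \<le> (\<integral>\<^sup>+t. wave_sup q {0<..<1} (phase t F) x * indicator (ball 0 1) x \<partial>lborel)"
        by (subst nn_integral_multc) (auto intro!: mult_right_mono wave_sup_UNIV_le)
    qed
    also have "\<dots> = (\<integral>\<^sup>+t. (\<integral>\<^sup>+x\<in>ball 0 1. wave_sup q {0<..<1} (phase t F) x \<partial>lborel) \<partial>lborel)"
    proof (rule lborel_pair.Fubini')
      have [measurable]: "ball (0::'a) 1 \<in> sets borel" by simp
      show "(\<lambda>(t, x). wave_sup q {0<..<1} (phase t F) x * indicator (ball 0 1) x) \<in> borel_measurable (lborel \<Otimes>\<^sub>M lborel)"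
        using meas by measurable
    qed
    also have "\<dots> \<le> (\<integral>\<^sup>+t. (\<Sum>k. ennreal (d k powr q) * (ennreal K * ennreal (energy s (?H k t) powr (q / 2)))) \<partial>lborel)"
    proof (intro nn_integral_mono)
      fix t
      have "(\<integral>\<^sup>+x\<in>ball 0 1. wave_sup q {0<..<1} (phase t F) x \<partial>lborel)
        \<le> (\<integral>\<^sup>+x. (\<Sum>k. ennreal (d k powr q) * (wave_sup q {0<..<1} (?H k t) x * indicator (ball 0 1) x)) \<partial>lborel)"
      proof (intro nn_integral_mono)
        fix x :: 'a
        show "wave_sup q {0<..<1} (phase t F) x * indicator (ball 0 1) x
          \<le> (\<Sum>k. ennreal (d k powr q) * (wave_sup q {0<..<1} (?H k t) x * indicator (ball 0 1) x))"
        proof (cases "x \<in> ball 0 1")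
          case True
          then have "norm x \<le> 1" by simp
          from wave_sup_translate_le[OF F q0 this, of t] True show ?thesis
            by (simp only: d_def indicator_simps mult_1_right)
        qed simp
      qed
      also have "\<dots> = (\<Sum>k. \<integral>\<^sup>+x. ennreal (d k powr q) * (wave_sup q {0<..<1} (?H k t) x * indicator (ball 0 1) x) \<partial>lborel)"
        by (rule nn_integral_suminf[OF meas_term])
      also have "\<dots> = (\<Sum>k. ennreal (d k powr q) * (\<integral>\<^sup>+x\<in>ball 0 1. wave_sup q {0<..<1} (?H k t) x \<partial>lborel))"
        by (intro suminf_cong nn_integral_cmult borel_measurable_times_ennreal borel_measurable_indicator)
          (simp_all add: borel_measurable_wave_sup[OF H q0])
      also have "\<dots> \<le> (\<Sum>k. ennreal (d k powr q) * (ennreal K * ennreal (energy s (?H k t) powr (q / 2))))"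
      proof (intro suminf_le mult_left_mono)
        fix k
        have "ennreal K * ennreal (energy s (?H k t) powr (q / 2)) = ennreal (K * energy s (?H k t) powr (q / 2))"
          using K by (intro ennreal_mult[symmetric]) auto
        with est[OF H[of k t]]
        show "(\<integral>\<^sup>+x\<in>ball 0 1. wave_sup q {0<..<1} (?H k t) x \<partial>lborel) \<le> ennreal K * ennreal (energy s (?H k t) powr (q / 2))"
          by (simp only:)
      qed simp_all
      finally show "(\<integral>\<^sup>+x\<in>ball 0 1. wave_sup q {0<..<1} (phase t F) x \<partial>lborel) \<le> \<dots>" .
    qed
    also have "\<dots> = (\<Sum>k. \<integral>\<^sup>+t. ennreal (d k powr q) * (ennreal K * ennreal (energy s (?H k t) powr (q / 2))) \<partial>lborel)"
      by (rule nn_integral_suminf) measurable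
    also have "\<dots> = (\<Sum>k. ennreal (d k powr q) * (ennreal K * (\<integral>\<^sup>+t. ennreal (energy s (?H k t) powr (q / 2)) \<partial>lborel)))"
      by (intro suminf_cong) (simp add: nn_integral_cmult)
    also have "\<dots> \<le> (\<Sum>k. ennreal ((1 / 2) ^ k * (L * ?E powr (q / 2))))"
      by (intro suminf_le term_le) auto
    also have "\<dots> = ennreal (2 * (L * ?E powr (q / 2)))"
    proof (rule suminf_ennreal_eq)
      show "(\<lambda>k. (1 / 2) ^ k * (L * ?E powr (q / 2))) sums (2 * (L * ?E powr (q / 2)))"
        using sums_mult2[OF geometric_sums[of "1 / 2 :: real"], of "L * ?E powr (q / 2)"] by simp
    qed (use L in auto)
    finally show "(\<integral>\<^sup>+x\<in>ball 0 1. wave_sup q UNIV F x \<partial>lborel) \<le> ennreal (2 * L * ?E powr (q / 2))"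
      by (simp add: mult.assoc)
  qed
qed

theorem proposition1p4:
  fixes q s :: real
  assumes "CARD('d::finite) \<ge> 2" and "q \<ge> 2" and "s \<ge> 0"
  shows "(\<exists>C::real. \<forall>f :: real^'d \<Rightarrow> complex. schwartz f \<longrightarrow>
            Lp_norm q (ball 0 1) (wave_maximal {0<..<1} f) \<le> ennreal C * sobolev_norm s f)
     \<longleftrightarrow> (\<exists>C::real. \<forall>f :: real^'d \<Rightarrow> complex. schwartz f \<longrightarrow>
            Lp_norm q (ball 0 1) (wave_maximal UNIV f) \<le> ennreal C * sobolev_norm s f)"
proof -
  have q0: "0 < q" using assms by simp
  show ?thesis
    unfolding maximal_estimate_iff[OF assms(3) q0]
  proof
    assume "\<exists>K\<ge>0. \<forall>f :: real^'d \<Rightarrow> complex. schwartz f \<longrightarrow>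
      sup_bound q s (ball 0 1) {0<..<1} K (fourier f)"
    then obtain K where K: "0 \<le> K" "\<And>f :: real^'d \<Rightarrow> complex. schwartz f \<Longrightarrow>
      sup_bound q s (ball 0 1) {0<..<1} K (fourier f)"
      by blast
    \<comment> \<open>The extension to all rapid transforms is essential: the estimate will be
      applied to the localised pieces, whose transforms may fail to be smooth at the origin.\<close>
    have "sup_bound q s (ball 0 1) {0<..<1} K G"
      if "rapid G" for G :: "real^'d \<Rightarrow> complex"
      by (rule maximal_estimate_rapid[OF K(2) _ assms(3) q0 that]) auto
    from maximal_estimate_global[OF this K(1) assms(3,2)] obtain K' where
      "0 \<le> K'" "\<And>F :: real^'d \<Rightarrow> complex. rapid F \<Longrightarrow>
        sup_bound q s (ball 0 1) UNIV K' F"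
      by blast
    then show "\<exists>K\<ge>0. \<forall>f :: real^'d \<Rightarrow> complex. schwartz f \<longrightarrow>
      sup_bound q s (ball 0 1) UNIV K (fourier f)"
      using rapid_fourier by blast
  next
    have "(\<integral>\<^sup>+x\<in>ball 0 1. wave_sup q {0<..<1} G x \<partial>lborel) \<le> (\<integral>\<^sup>+x\<in>ball 0 1. wave_sup q UNIV G x \<partial>lborel)"
      for G :: "real^'d \<Rightarrow> complex"
      unfolding wave_sup_def by (intro nn_integral_mono mult_right_mono SUP_subset_mono) auto
    then show "\<exists>K\<ge>0. \<forall>f :: real^'d \<Rightarrow> complex. schwartz f \<longrightarrow>
      sup_bound q s (ball 0 1) {0<..<1} K (fourier f)"
      if "\<exists>K\<ge>0. \<forall>f :: real^'d \<Rightarrow> complex. schwartz f \<longrightarrow>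
      sup_bound q s (ball 0 1) UNIV K (fourier f)"
      using that order_trans by blast
  qed
qed

end
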